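(* Let $\mathrm{w}\neq 0$ be a real number, let $\nu_1,\nu_2,\nu_3$ be nonnegative integers, and let $1\le q<\infty$. Suppose that all eigenvalues of $B_H^{-1}A_H$ and of $M_{B_h}^{-1}M_{A_h}$ have positive real parts, and consider the new two-grid waveform relaxation operator $\mathcal{N}=\mathcal{K}^{\nu_3}\,\mathcal{CR}\,\mathcal{K}^{\nu_1}$ defined in the context as an operator in $L_q(0,\infty)=L_q((0,\infty);\mathbb{C}^{N})$. Then $\mathcal{N}$ is a bounded operator with spectral radius $$\rho(\mathcal{N})=\sup_{\operatorname{Re}(z)\ge 0}\rho(\mathbf{N}(z))=\sup_{\xi\in\mathbb{R}}\rho(\mathbf{N}(i\xi)),$$ where $\mathbf{N}(z)$ is the matrix-valued Laplace symbol of $\mathcal{N}$ given in the context.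
   Context: Setting. $\Omega\subset\mathbb{R}^2$ is a bounded domain, triangulated by an admissible mesh $\Omega_h$ (two different elements meet in the empty set, a vertex, or a whole edge), and $V_h$ is the space of continuous piecewise linear functions on $\Omega_h$ vanishing on $\partial\Omega$, with nodal basis $\phi_1,\dots,\phi_N$. The mass matrix is $B_h=\big(\int_\Omega\phi_i\phi_j\,d\mathbf{x}\big)\in\mathbb{R}^{N\times N}$ and the stiffness matrix is $A_h=\big(\int_\Omega\nabla\phi_i\cdot\nabla\phi_j\,d\mathbf{x}\big)\in\mathbb{R}^{N\times N}$. They arise from the semi-discretization $B_h\dot{\mathbf u}_h+A_h\mathbf u_h=F_h$, $\mathbf u_h(0)=g_h$, of the heat equation with homogeneous Dirichlet conditions. The matrices $B_H,A_H\in\mathbb{R}^{N_H\times N_H}$ are the mass and stiffness matrices obtained in the same way on the coarse mesh $\Omega_H$, $H=2h$, with $\Omega_{2h}\subset\Omega_h$. The matrix $p\in\mathbb{R}^{N\times N_H}$ is the prolongation (linear interpolation), and $r\in\mathbb{R}^{N_H\times N}$ is the restriction, the adjoint of $p$ up to a fixed positive scaling factor. Splittings: $B_h=M_{B_h}-N_{B_h}$ and $A_h=M_{A_h}-N_{A_h}$, with $M_{B_h}$ invertible. (For example, in the Gauss-Seidel splitting $M_{B_h},M_{A_h}$ are the lower triangular parts including the diagonal, and $-N_{B_h},-N_{A_h}$ are the strictly upper triangular parts.) Convolution: for a matrix-valued kernel $k$, $(k\star u)(t)=\int_0^t k(t-s)u(s)\,ds$. Standard waveform relaxation operator: $$\mathcal{K}u(t)=M_{B_h}^{-1}N_{B_h}u(t)+(k_c\star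 u)(t),\qquad k_c(t)=e^{-M_{B_h}^{-1}M_{A_h}t}M_{B_h}^{-1}\big(N_{A_h}-M_{A_h}M_{B_h}^{-1}N_{B_h}\big).$$ Correction kernels: $$C_{2c}(t)=p\,e^{-B_H^{-1}A_Ht}B_H^{-1}\big(A_HB_H^{-1}rB_h-rA_h\big),\qquad C_{1c}(t)=\Big(1+\frac1{\mathrm{w}^2}\Big)C_{2c}(t).$$ New two-grid correction waveform operator: $$\mathcal{CR}\,u=(I-pB_H^{-1}rB_h)\Big(I+\mathrm{w}\,\mathcal{K}^{\nu_2}\Big(I-\Big(1+\frac1{\mathrm{w}^2}\Big)pB_H^{-1}rB_h\Big)\Big)u+\mathcal{CR}_c u,$$ $$\mathcal{CR}_c u=C_{2c}\star\Big(\Big(I+\mathrm{w}\,\mathcal{K}^{\nu_2}\Big(I-\Big(1+\frac1{\mathrm{w}^2}\Big)pB_H^{-1}rB_h\Big)\Big)u\Big)+\mathrm{w}\,(I-pB_H^{-1}rB_h)\,\mathcal{K}^{\nu_2}(C_{1c}\star u)+\mathrm{w}\,C_{2c}\star\big(\mathcal{K}^{\nu_2}(C_{1c}\star u)\big).$$ New two-grid waveform relaxation operator: $\mathcal{N}u=\mathcal{K}^{\nu_3}\,\mathcal{CR}\,\mathcal{K}^{\nu_1}u$. Laplace symbol of $\mathcal{N}$: $$\mathbf{N}(z)=\mathbf{K}(z)^{\nu_3}\,\mathbf{R}(z)\,\mathbf{K}(z)^{\nu_1},\qquad \mathbf{K}(z)=(zM_{B_h}+M_{A_h})^{-1}(zN_{B_h}+N_{A_h}),$$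 $$\mathbf{L}(z)=p\,(A_H+zB_H)^{-1}\big(A_HB_H^{-1}rB_h-rA_h\big),$$ $$\begin{aligned}\mathbf{R}(z)={}&(I-pB_H^{-1}rB_h)\Big(I+\mathrm{w}\,\mathbf{K}(z)^{\nu_2}\Big(I-\Big(1+\frac1{\mathrm{w}^2}\Big)pB_H^{-1}rB_h\Big)\Big)\\&+\mathbf{L}(z)\Big(I+\mathrm{w}\,\mathbf{K}(z)^{\nu_2}\Big(I-\Big(1+\frac1{\mathrm{w}^2}\Big)pB_H^{-1}rB_h\Big)\Big)\\&+\mathrm{w}\,(I-pB_H^{-1}rB_h)\,\mathbf{K}(z)^{\nu_2}\Big(1+\frac1{\mathrm{w}^2}\Big)\mathbf{L}(z)+\mathrm{w}\,\mathbf{L}(z)\,\mathbf{K}(z)^{\nu_2}\Big(1+\frac1{\mathrm{w}^2}\Big)\mathbf{L}(z).\end{aligned}$$ $\rho(\cdot)$ denotes the spectral radius of a bounded operator or of a matrix. *)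

theory Defs
  imports "HOL-Analysis.Analysis"
begin

section \<open>Linear finite elements on a triangulated plane domain\<close>

(* The library notion triangulation says that the intersection of any two elements is a common
   face; for distinct triangles this is the empty set, a common vertex or a common whole edge.
   Together, the last two conditions of the definition say that the elements fill the domain and
   that its boundary runs along edges only. *)
definition admissible_mesh :: "(real^2) set \<Rightarrow> (real^2) set set \<Rightarrow> bool" where
  "admissible_mesh \<Omega> \<T> \<longleftrightarrow>
     triangulation \<T> \<and> (\<forall>K\<in>\<T>. 2 simplex K) \<and>
     \<Union>\<T> = closure \<Omega> \<and> (\<forall>K\<in>\<T>. interior K \<subseteq> \<Omega>)"

definition mesh_size :: "(real^2) set set \<Rightarrow> real" where
  "mesh_size \<T> = Max (diameter ` \<T>)"

definition mesh_refines :: "(real^2) set set \<Rightarrow> (real^2) set set \<Rightarrow> bool" where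
  "mesh_refines \<T>' \<T> \<longleftrightarrow> (\<forall>K\<in>\<T>. \<exists>F\<subseteq>\<T>'. K = \<Union>F)"

definition mesh_vertices :: "(real^2) set set \<Rightarrow> (real^2) set" where
  "mesh_vertices \<T> = (\<Union>K\<in>\<T>. {x. x extreme_point_of K})"

(* Values of a member outside the closure of the domain are irrelevant. *)
definition fe_space :: "(real^2) set \<Rightarrow> (real^2) set set \<Rightarrow> (real^2 \<Rightarrow> real) set" where
  "fe_space \<Omega> \<T> =
     {v. continuous_on (closure \<Omega>) v \<and>
         (\<forall>K\<in>\<T>. \<exists>a b. \<forall>x\<in>K. v x = a \<bullet> x + b) \<and>
         (\<forall>x\<in>frontier \<Omega>. v x = 0)}"

(* The index type enumerates the mesh vertices that do not lie on the boundary; its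
   cardinality is the dimension of the finite element space. *)
definition nodal_basis ::
  "(real^2) set \<Rightarrow> (real^2) set set \<Rightarrow> ('n::finite \<Rightarrow> real^2) \<Rightarrow> ('n \<Rightarrow> real^2 \<Rightarrow> real) \<Rightarrow> bool" where
  "nodal_basis \<Omega> \<T> node \<phi> \<longleftrightarrow>
     bij_betw node UNIV (mesh_vertices \<T> \<inter> \<Omega>) \<and>
     (\<forall>j. \<phi> j \<in> fe_space \<Omega> \<T>) \<and>
     (\<forall>i j. \<phi> j (node i) = (if i = j then 1 else 0))"

(* Unspecified where f is not differentiable; for finite element functions this only concerns
   points on the edges, a null set. *)
definition gradient :: "(real^2 \<Rightarrow> real) \<Rightarrow> real^2 \<Rightarrow> real^2" where
  "gradient f x = (THE D. GDERIV f x :> D)"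

definition mass_matrix :: "(real^2) set \<Rightarrow> ('n::finite \<Rightarrow> real^2 \<Rightarrow> real) \<Rightarrow> real^'n^'n" where
  "mass_matrix \<Omega> \<phi> = (\<chi> i j. LINT x:\<Omega>|lebesgue. \<phi> i x * \<phi> j x)"

definition stiffness_matrix :: "(real^2) set \<Rightarrow> ('n::finite \<Rightarrow> real^2 \<Rightarrow> real) \<Rightarrow> real^'n^'n" where
  "stiffness_matrix \<Omega> \<phi> = (\<chi> i j. LINT x:\<Omega>|lebesgue. gradient (\<phi> i) x \<bullet> gradient (\<phi> j) x)"

(* Column j holds the values of the j-th coarse basis function at the fine nodes. *)
definition prolongation ::
  "('n::finite \<Rightarrow> real^2) \<Rightarrow> ('m::finite \<Rightarrow> real^2 \<Rightarrow> real) \<Rightarrow> real^'m^'n" where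
  "prolongation node \<phi>H = (\<chi> i j. \<phi>H j (node i))"


section \<open>Complex matrices\<close>

abbreviation cmat :: "real^'m^'n \<Rightarrow> complex^'m^'n" where
  "cmat \<equiv> map_matrix complex_of_real"

definition matrix_power :: "complex^'n^'n \<Rightarrow> nat \<Rightarrow> complex^'n^'n" where
  "matrix_power A k = (((**) A) ^^ k) (mat 1)"

definition matrix_exp :: "complex^'n^'n \<Rightarrow> complex^'n^'n" where
  "matrix_exp A = (\<Sum>k. (1 / fact k) *\<^sub>R matrix_power A k)"

definition eigenvalues :: "complex^'n^'n \<Rightarrow> complex set" where
  "eigenvalues A = {\<mu>. \<exists>v. v \<noteq> 0 \<and> A *v v = \<mu> *s v}"

(* Valued in ennreal, like the spectral radius of an operator below, so that all suprema
   are genuine. *)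
definition matrix_spectral_radius :: "complex^'n^'n \<Rightarrow> ennreal" where
  "matrix_spectral_radius A = (SUP \<mu>\<in>eigenvalues A. ennreal (cmod \<mu>))"


section \<open>Bounded operators in \<open>L\<^sub>q((0,\<infinity>); \<complex>\<^sup>N)\<close>\<close>

(* Elements of the space are represented by functions; equality of elements is equality almost
   everywhere on the half-line. *)
abbreviation half_line :: "real measure" where
  "half_line \<equiv> restrict_space lborel {0<..}"

definition Lq_space :: "real \<Rightarrow> (real \<Rightarrow> complex^'n) set" where
  "Lq_space q = {u \<in> borel_measurable half_line. integrable half_line (\<lambda>t. norm (u t) powr q)}"

definition Lq_norm :: "real \<Rightarrow> (real \<Rightarrow> complex^'n) \<Rightarrow> real" where
  "Lq_norm q u = (LINT t|half_line. norm (u t) powr q) powr (1 / q)"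

definition ae_eq :: "(real \<Rightarrow> complex^'n) \<Rightarrow> (real \<Rightarrow> complex^'n) \<Rightarrow> bool" where
  "ae_eq u v \<longleftrightarrow> (AE t in half_line. u t = v t)"

definition Lq_bounded_operator ::
  "real \<Rightarrow> ((real \<Rightarrow> complex^'n) \<Rightarrow> (real \<Rightarrow> complex^'n)) \<Rightarrow> bool" where
  "Lq_bounded_operator q T \<longleftrightarrow>
     (\<forall>u\<in>Lq_space q. T u \<in> Lq_space q) \<and>
     (\<forall>u\<in>Lq_space q. \<forall>v\<in>Lq_space q. ae_eq u v \<longrightarrow> ae_eq (T u) (T v)) \<and>
     (\<forall>u\<in>Lq_space q. \<forall>v\<in>Lq_space q. ae_eq (T (\<lambda>t. u t + v t)) (\<lambda>t. T u t + T v t)) \<and>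
     (\<forall>c. \<forall>u\<in>Lq_space q. ae_eq (T (\<lambda>t. c *s u t)) (\<lambda>t. c *s T u t)) \<and>
     (\<exists>C. \<forall>u\<in>Lq_space q. Lq_norm q (T u) \<le> C * Lq_norm q u)"

(* Complement of the set of \<mu> for which \<mu>I - T has a bounded two-sided inverse S. *)
definition Lq_spectrum ::
  "real \<Rightarrow> ((real \<Rightarrow> complex^'n) \<Rightarrow> (real \<Rightarrow> complex^'n)) \<Rightarrow> complex set" where
  "Lq_spectrum q T =
     {\<mu>. \<not> (\<exists>S. Lq_bounded_operator q S \<and>
               (\<forall>u\<in>Lq_space q. ae_eq (S (\<lambda>t. \<mu> *s u t - T u t)) u \<and>
                               ae_eq (\<lambda>t. \<mu> *s S u t - T (S u) t) u))}"

definition Lq_spectral_radius ::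
  "real \<Rightarrow> ((real \<Rightarrow> complex^'n) \<Rightarrow> (real \<Rightarrow> complex^'n)) \<Rightarrow> ennreal" where
  "Lq_spectral_radius q T = (SUP \<mu>\<in>Lq_spectrum q T. ennreal (cmod \<mu>))"


section \<open>Waveform relaxation operators\<close>

definition convolution ::
  "(real \<Rightarrow> complex^'n^'k) \<Rightarrow> (real \<Rightarrow> complex^'n) \<Rightarrow> real \<Rightarrow> complex^'k" where
  "convolution k u t = (LINT s:{0..t}|lborel. k (t - s) *v u s)"

definition wr_kernel ::
  "complex^'n^'n \<Rightarrow> complex^'n^'n \<Rightarrow> complex^'n^'n \<Rightarrow> complex^'n^'n \<Rightarrow> real \<Rightarrow> complex^'n^'n" where
  "wr_kernel M\<^sub>B N\<^sub>B M\<^sub>A N\<^sub>A t =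
     matrix_exp (- t *\<^sub>R (matrix_inv M\<^sub>B ** M\<^sub>A)) ** matrix_inv M\<^sub>B **
       (N\<^sub>A - M\<^sub>A ** matrix_inv M\<^sub>B ** N\<^sub>B)"

definition wr_operator ::
  "complex^'n^'n \<Rightarrow> complex^'n^'n \<Rightarrow> complex^'n^'n \<Rightarrow> complex^'n^'n \<Rightarrow>
   (real \<Rightarrow> complex^'n) \<Rightarrow> (real \<Rightarrow> complex^'n)" where
  "wr_operator M\<^sub>B N\<^sub>B M\<^sub>A N\<^sub>A u =
     (\<lambda>t. (matrix_inv M\<^sub>B ** N\<^sub>B) *v u t + convolution (wr_kernel M\<^sub>B N\<^sub>B M\<^sub>A N\<^sub>A) u t)"

definition wr_symbol ::
  "complex^'n^'n \<Rightarrow> complex^'n^'n \<Rightarrow> complex^'n^'n \<Rightarrow> complex^'n^'n \<Rightarrow> complex \<Rightarrow> complex^'n^'n" where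
  "wr_symbol M\<^sub>B N\<^sub>B M\<^sub>A N\<^sub>A z = matrix_inv (mat z ** M\<^sub>B + M\<^sub>A) ** (mat z ** N\<^sub>B + N\<^sub>A)"

definition coarse_projection ::
  "complex^'m^'n \<Rightarrow> complex^'n^'m \<Rightarrow> complex^'m^'m \<Rightarrow> complex^'n^'n \<Rightarrow> complex^'n^'n" where
  "coarse_projection p r B\<^sub>H B\<^sub>h = p ** matrix_inv B\<^sub>H ** r ** B\<^sub>h"

definition correction_kernel ::
  "complex^'m^'n \<Rightarrow> complex^'n^'m \<Rightarrow> complex^'m^'m \<Rightarrow> complex^'m^'m \<Rightarrow>
   complex^'n^'n \<Rightarrow> complex^'n^'n \<Rightarrow> real \<Rightarrow> complex^'n^'n" where
  "correction_kernel p r B\<^sub>H A\<^sub>H B\<^sub>h A\<^sub>h t =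
     p ** matrix_exp (- t *\<^sub>R (matrix_inv B\<^sub>H ** A\<^sub>H)) ** matrix_inv B\<^sub>H **
       (A\<^sub>H ** matrix_inv B\<^sub>H ** r ** B\<^sub>h - r ** A\<^sub>h)"

definition correction_symbol ::
  "complex^'m^'n \<Rightarrow> complex^'n^'m \<Rightarrow> complex^'m^'m \<Rightarrow> complex^'m^'m \<Rightarrow>
   complex^'n^'n \<Rightarrow> complex^'n^'n \<Rightarrow> complex \<Rightarrow> complex^'n^'n" where
  "correction_symbol p r B\<^sub>H A\<^sub>H B\<^sub>h A\<^sub>h z =
     p ** matrix_inv (A\<^sub>H + mat z ** B\<^sub>H) **
       (A\<^sub>H ** matrix_inv B\<^sub>H ** r ** B\<^sub>h - r ** A\<^sub>h)"

(* In the two-grid operators below, \<K> is the standard waveform relaxation operator, P the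
   coarse projection, and C the correction kernel C_2c; in the symbols, \<K> and L are the
   values of the symbols of \<K> and of the convolution with C at the point considered. *)

definition inner_stage ::
  "((real \<Rightarrow> complex^'n) \<Rightarrow> (real \<Rightarrow> complex^'n)) \<Rightarrow> complex^'n^'n \<Rightarrow> real \<Rightarrow> nat \<Rightarrow>
   (real \<Rightarrow> complex^'n) \<Rightarrow> (real \<Rightarrow> complex^'n)" where
  "inner_stage \<K> P w \<nu>\<^sub>2 u =
     (\<lambda>t. u t + w *\<^sub>R (\<K> ^^ \<nu>\<^sub>2) (\<lambda>s. (mat 1 - (1 + 1 / w\<^sup>2) *\<^sub>R P) *v u s) t)"

definition two_grid_correction_conv ::
  "((real \<Rightarrow> complex^'n) \<Rightarrow> (real \<Rightarrow> complex^'n)) \<Rightarrow> complex^'n^'n \<Rightarrow> (real \<Rightarrow> complex^'n^'n) \<Rightarrow>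
   real \<Rightarrow> nat \<Rightarrow> (real \<Rightarrow> complex^'n) \<Rightarrow> (real \<Rightarrow> complex^'n)" where
  "two_grid_correction_conv \<K> P C w \<nu>\<^sub>2 u =
     (let C\<^sub>1 = (\<lambda>t. (1 + 1 / w\<^sup>2) *\<^sub>R C t);
          y = (\<K> ^^ \<nu>\<^sub>2) (convolution C\<^sub>1 u)
      in (\<lambda>t. convolution C (inner_stage \<K> P w \<nu>\<^sub>2 u) t
              + w *\<^sub>R ((mat 1 - P) *v y t)
              + w *\<^sub>R convolution C y t))"

definition two_grid_correction ::
  "((real \<Rightarrow> complex^'n) \<Rightarrow> (real \<Rightarrow> complex^'n)) \<Rightarrow> complex^'n^'n \<Rightarrow> (real \<Rightarrow> complex^'n^'n) \<Rightarrow>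
   real \<Rightarrow> nat \<Rightarrow> (real \<Rightarrow> complex^'n) \<Rightarrow> (real \<Rightarrow> complex^'n)" where
  "two_grid_correction \<K> P C w \<nu>\<^sub>2 u =
     (\<lambda>t. (mat 1 - P) *v inner_stage \<K> P w \<nu>\<^sub>2 u t + two_grid_correction_conv \<K> P C w \<nu>\<^sub>2 u t)"

definition two_grid_wr ::
  "((real \<Rightarrow> complex^'n) \<Rightarrow> (real \<Rightarrow> complex^'n)) \<Rightarrow> complex^'n^'n \<Rightarrow> (real \<Rightarrow> complex^'n^'n) \<Rightarrow>
   real \<Rightarrow> nat \<Rightarrow> nat \<Rightarrow> nat \<Rightarrow> (real \<Rightarrow> complex^'n) \<Rightarrow> (real \<Rightarrow> complex^'n)" where
  "two_grid_wr \<K> P C w \<nu>\<^sub>1 \<nu>\<^sub>2 \<nu>\<^sub>3 u =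
     (\<K> ^^ \<nu>\<^sub>3) (two_grid_correction \<K> P C w \<nu>\<^sub>2 ((\<K> ^^ \<nu>\<^sub>1) u))"

definition two_grid_correction_symbol ::
  "complex^'n^'n \<Rightarrow> complex^'n^'n \<Rightarrow> complex^'n^'n \<Rightarrow> real \<Rightarrow> nat \<Rightarrow> complex^'n^'n" where
  "two_grid_correction_symbol \<K> P L w \<nu>\<^sub>2 =
     (mat 1 - P) ** (mat 1 + w *\<^sub>R (matrix_power \<K> \<nu>\<^sub>2 ** (mat 1 - (1 + 1 / w\<^sup>2) *\<^sub>R P)))
     + L ** (mat 1 + w *\<^sub>R (matrix_power \<K> \<nu>\<^sub>2 ** (mat 1 - (1 + 1 / w\<^sup>2) *\<^sub>R P)))
     + w *\<^sub>R ((mat 1 - P) ** matrix_power \<K> \<nu>\<^sub>2 ** ((1 + 1 / w\<^sup>2) *\<^sub>R L))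
     + w *\<^sub>R (L ** matrix_power \<K> \<nu>\<^sub>2 ** ((1 + 1 / w\<^sup>2) *\<^sub>R L))"

definition two_grid_symbol ::
  "complex^'n^'n \<Rightarrow> complex^'n^'n \<Rightarrow> complex^'n^'n \<Rightarrow> real \<Rightarrow> nat \<Rightarrow> nat \<Rightarrow> nat \<Rightarrow> complex^'n^'n" where
  "two_grid_symbol \<K> P L w \<nu>\<^sub>1 \<nu>\<^sub>2 \<nu>\<^sub>3 =
     matrix_power \<K> \<nu>\<^sub>3 ** two_grid_correction_symbol \<K> P L w \<nu>\<^sub>2 ** matrix_power \<K> \<nu>\<^sub>1"

end

(* A stable convolution operator is a rational function of the single operator E = convolution with
   exp(-t), whose symbol is e = 1/(z+1); the half-plane Re z >= 0 together with infinity becomes the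
   closed disc with diameter [0,1] in the e-plane. The two-grid operator is d(E)^-1 Q(E) with a matrix
   Q of polynomials and a scalar polynomial d without zeros in the disc. If det(\<mu> d - Q) has no zero
   in the disc, then \<mu> I - N is inverted by the adjugate, because a polynomial without zeros in the disc is
   inverted factor by factor and convolution with a decaying exponential is bounded in L_q (Young).
   Conversely, for Re z > 0 a left eigenvector of N(z) gives, through the Laplace transform at z, a
   continuous functional that vanishes on the range of \<mu> I - N. The boundary of the half-plane, the
   point at infinity and the maximum principle for the spectral radius are treated by Hurwitz's theorem
   applied to det(d(e) - \<tau> Q(e)). *)

theory Submission
  imports Defs "HOL-Complex_Analysis.Great_Picard"
    "HOL-Computational_Algebra.Fundamental_Theorem_Algebra"
begin

text \<open>The obstacle is the point at infinity. A supremum over the half-plane need not be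
  attained, and inverting \<mu> I - N boundedly also requires control of the limit of the symbol. In
  the coordinate e this limit is the value at the ordinary point e = 0 of a compact disc. The matrix
  exponentials solve linear equations whose coefficients are polynomials in E, so neither Jordan
  forms nor a Wiener theorem for half-line convolutions enters. Denominators stay scalar, hence
  commute with all matrices, and need not be in lowest terms.

  The eigenvalues of N(z) are in general not holomorphic in z, so no maximum principle is applied to
  them. The bound \<rho> \<le> s is instead expressed as det(d - \<tau> Q) \<noteq> 0 for all \<tau>
  with s |\<tau>| < 1, where \<tau> stands for the reciprocal of an eigenvalue. The determinant is
  jointly polynomial in \<tau> and e, the admissible \<tau> form an open connected set, and s = 0 is
  no exception.

  The Laplace functional is used only for Re z > 0, where it is continuous on every L_q; the
  imaginary axis is then reached by a limit.\<close>

text \<open>Members are functions, not classes modulo null sets: a convolution does not see null sets, so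
  the operator identities below hold pointwise. Values at negative times are unrestricted.\<close>

typedef locfun = "{u :: real \<Rightarrow> complex. \<forall>T. set_integrable lborel {0..T} u}"
  morphisms lf Lf
  by (rule exI[of _ "\<lambda>_. 0"]) (simp add: set_integrable_def)

setup_lifting type_definition_locfun

section \<open>Locally integrable functions as a complex vector space\<close>

instantiation locfun :: ab_group_add
begin
lift_definition zero_locfun :: locfun is "\<lambda>_. 0" by (simp add: set_integrable_def)
lift_definition plus_locfun :: "locfun \<Rightarrow> locfun \<Rightarrow> locfun" is "\<lambda>u v t. u t + v t"
  by (simp add: set_integral_add)
lift_definition minus_locfun :: "locfun \<Rightarrow> locfun \<Rightarrow> locfun" is "\<lambda>u v t. u t - v t"
  by (simp add: set_integral_diff)
lift_definition uminus_locfun :: "locfun \<Rightarrow> locfun" is "\<lambda>u t. - u t"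
  by (auto simp: set_integrable_def)
instance by standard (transfer; auto)+
end

lift_definition lscale :: "complex \<Rightarrow> locfun \<Rightarrow> locfun" is "\<lambda>c u t. c * u t"
  by auto

lemma locfun_eqI: "(\<And>t. lf u t = lf v t) \<Longrightarrow> u = v"
  by (metis ext lf_inject)

lemma lf_simps [simp]:
  "lf 0 t = 0" "lf (u + v) t = lf u t + lf v t" "lf (u - v) t = lf u t - lf v t"
  "lf (- u) t = - lf u t" "lf (lscale c u) t = c * lf u t"
  by (transfer; simp)+

lemma lf_sum [simp]: "lf (\<Sum>i\<in>I. u i) t = (\<Sum>i\<in>I. lf (u i) t)"
  by (induction I rule: infinite_finite_induct) auto

lemma set_integrable_lf: "set_integrable lborel {0..T} (lf u)"
  using lf[of u] by auto

lemma lscale_simps [simp]: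
  "lscale 0 u = 0" "lscale 1 u = u" "lscale c 0 = 0" "lscale a (lscale b u) = lscale (a * b) u"
  "lscale (- 1) u = - u"
  by (auto intro!: locfun_eqI)

lemma lscale_add: "lscale c (u + v) = lscale c u + lscale c v" "lscale (a + b) u = lscale a u + lscale b u"
  by (auto intro!: locfun_eqI simp: algebra_simps)

lemma lscale_sum: "lscale c (\<Sum>i\<in>I. u i) = (\<Sum>i\<in>I. lscale c (u i))"
  by (auto intro!: locfun_eqI simp: sum_distrib_left)

subsection \<open>Convolution with continuous kernels\<close>

lemma set_integrable_cont_mult:
  fixes k u :: "real \<Rightarrow> complex"
  assumes k: "continuous_on UNIV k" and u: "set_integrable lborel {a..b} u"
  shows "set_integrable lborel {a..b} (\<lambda>s. k s * u s)"
proof -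
  have "compact (k ` {a..b})"
    by (intro compact_continuous_image continuous_on_subset[OF k]) auto
  then obtain B where B: "\<And>s. s \<in> {a..b} \<Longrightarrow> norm (k s) \<le> B"
    by (meson bounded_iff compact_imp_bounded imageI)
  have [measurable]: "k \<in> borel_measurable borel"
    using k by (simp add: borel_measurable_continuous_onI)
  have um [measurable]: "(\<lambda>s. indicator {a..b} s *\<^sub>R u s) \<in> borel_measurable lborel"
    using u unfolding set_integrable_def by (rule borel_measurable_integrable)
  have eq: "indicator {a..b} s *\<^sub>R (k s * u s) = k s * (indicator {a..b} s *\<^sub>R u s)" for s
    by simp
  have "integrable lborel (\<lambda>s. k s * (indicator {a..b} s *\<^sub>R u s))"
  proof (rule Bochner_Integration.integrable_bound[where f="\<lambda>s. B *\<^sub>R (indicator {a..b} s *\<^sub>R u s)"])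
    show "integrable lborel (\<lambda>s. B *\<^sub>R (indicator {a..b} s *\<^sub>R u s))"
      using u unfolding set_integrable_def by (intro integrable_scaleR_right) auto
    show "(\<lambda>s. k s * (indicator {a..b} s *\<^sub>R u s)) \<in> borel_measurable lborel"
      by measurable
    have "norm (k s * (indicator {a..b} s *\<^sub>R u s)) \<le> norm (B *\<^sub>R (indicator {a..b} s *\<^sub>R u s))" for s
      using B[of s] by (auto simp: indicator_def norm_mult intro!: mult_right_mono)
    then show "AE s in lborel. norm (k s * (indicator {a..b} s *\<^sub>R u s)) \<le> norm (B *\<^sub>R (indicator {a..b} s *\<^sub>R u s))"
      by simp
  qed
  then show ?thesis unfolding set_integrable_def eq .
qed

lemma set_integrable_conv:
  assumes "continuous_on UNIV k"
  shows "set_integrable lborel {0..t} (\<lambda>s. k (t - s) * lf u s)"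
  by (intro set_integrable_cont_mult[of "\<lambda>s. k (t - s)"] set_integrable_lf
        continuous_on_compose2[OF assms] continuous_intros) auto

text \<open>For t in [0,T] only the values of \<open>k\<close> and \<open>u\<close> on [0,T] enter.
  There \<open>k\<close> is bounded by some B, so the convolution is bounded by B times the integral
  of |u| over [0,T].\<close>

lemma conv_locally_integrable:
  fixes k u :: "real \<Rightarrow> complex"
  assumes k: "continuous_on UNIV k" and u: "\<forall>T. set_integrable lborel {0..T} u"
  shows "set_integrable lborel {0..T} (\<lambda>t. LINT s:{0..t}|lborel. k (t - s) * u s)"
proof -
  \<comment> \<open>The truncation is integrable on the whole line and does not change the
    convolution at times up to T.\<close>
  define u0 where "u0 = (\<lambda>s. indicator {0..T} s *\<^sub>R u s)"
  have u0i: "integrable lborel u0" using u unfolding set_integrable_def u0_def by auto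
  then have [measurable]: "u0 \<in> borel_measurable borel"
    using borel_measurable_integrable by fastforce
  have [measurable]: "k \<in> borel_measurable borel"
    using k by (simp add: borel_measurable_continuous_onI)
  have "compact (k ` {0..T})"
    by (intro compact_continuous_image continuous_on_subset[OF k]) auto
  then obtain B where B: "\<And>s. s \<in> {0..T} \<Longrightarrow> norm (k s) \<le> B"
    by (meson bounded_iff compact_imp_bounded imageI)
  have eq: "indicator {0..T} t *\<^sub>R (LINT s:{0..t}|lborel. k (t - s) * u s) =
     indicator {0..T} t *\<^sub>R (LINT s|lborel. (if 0 \<le> s \<and> s \<le> t then k (t - s) * u0 s else 0))" for t
    by (auto simp: indicator_def set_lebesgue_integral_def u0_def intro!: Bochner_Integration.integral_cong)
  have m: "(\<lambda>t. LINT s|lborel. (if 0 \<le> s \<and> s \<le> t then k (t - s) * u0 s else 0)) \<in> borel_measurable lborel"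
    by measurable
  have bd: "norm (LINT s|lborel. (if 0 \<le> s \<and> s \<le> t then k (t - s) * u0 s else 0)) \<le> B * (LINT s|lborel. norm (u0 s))"
    if t: "t \<in> {0..T}" for t
  proof -
    have B0: "B \<ge> 0" using B[of t] t norm_ge_zero order_trans by blast
    have "norm (LINT s|lborel. (if 0 \<le> s \<and> s \<le> t then k (t - s) * u0 s else 0))
      \<le> (LINT s|lborel. norm (if 0 \<le> s \<and> s \<le> t then k (t - s) * u0 s else 0))"
      by simp
    also have "\<dots> \<le> (LINT s|lborel. B * norm (u0 s))"
      using u0i B t B0 by (intro Bochner_Integration.integral_mono') (auto simp: norm_mult intro!: mult_right_mono)
    finally show ?thesis by simp
  qed
  show ?thesis unfolding set_integrable_def eq
  proof (rule Bochner_Integration.integrable_bound[where f="\<lambda>t. indicator {0..T} t *\<^sub>R (B * (LINT s|lborel. norm (u0 s)))"])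
    show "integrable lborel (\<lambda>t. indicator {0..T} t *\<^sub>R (B * (LINT s|lborel. norm (u0 s))))"
      by (rule integrable_real_indicator[THEN integrable_scaleR_left]) (auto simp: emeasure_lborel_Icc_eq)
    show "(\<lambda>t. indicator {0..T} t *\<^sub>R (LINT s|lborel. (if 0 \<le> s \<and> s \<le> t then k (t - s) * u0 s else 0))) \<in> borel_measurable lborel"
      using m by measurable
    have "norm (indicator {0..T} t *\<^sub>R (LINT s|lborel. (if 0 \<le> s \<and> s \<le> t then k (t - s) * u0 s else 0)))
      \<le> norm (indicator {0..T} t *\<^sub>R (B * (LINT s|lborel. norm (u0 s))))" for t
      using bd[of t] by (auto simp: indicator_def)
    then show "AE t in lborel. norm (indicator {0..T} t *\<^sub>R (LINT s|lborel. (if 0 \<le> s \<and> s \<le> t then k (t - s) * u0 s else 0)))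
      \<le> norm (indicator {0..T} t *\<^sub>R (B * (LINT s|lborel. norm (u0 s))))" by simp
  qed
qed

text \<open>Lifting demands a locally integrable result for every kernel, so a discontinuous kernel
  gets the default value 0. The formula is available only under the continuity premise of
  \<open>lf_lconv\<close>.\<close>

lift_definition lconv :: "(real \<Rightarrow> complex) \<Rightarrow> locfun \<Rightarrow> locfun" is
  "\<lambda>k u t. if continuous_on UNIV k then LINT s:{0..t}|lborel. k (t - s) * u s else 0"
  subgoal for k u T using conv_locally_integrable[of k u T] by (cases "continuous_on UNIV k") (auto simp: set_integrable_def)
  done

lemma lf_lconv:
  "continuous_on UNIV k \<Longrightarrow> lf (lconv k u) t = (LINT s:{0..t}|lborel. k (t - s) * lf u s)"
  by transfer simp

lemma lconv_add:
  assumes "continuous_on UNIV k"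
  shows "lconv k (u + v) = lconv k u + lconv k v"
proof (rule locfun_eqI)
  fix t show "lf (lconv k (u + v)) t = lf (lconv k u + lconv k v) t"
    using set_integral_add(2)[OF set_integrable_conv[OF assms, of t u] set_integrable_conv[OF assms, of t v]]
    by (simp add: lf_lconv assms algebra_simps)
qed

lemma lconv_scale: "continuous_on UNIV k \<Longrightarrow> lconv k (lscale c u) = lscale c (lconv k u)"
  by (rule locfun_eqI) (simp add: lf_lconv mult.left_commute)

lemma lconv_0 [simp]: "lconv k 0 = 0"
  by (rule locfun_eqI, transfer) (simp add: set_lebesgue_integral_def)

lemma lconv_kernel_add:
  assumes "continuous_on UNIV k" "continuous_on UNIV l"
  shows "lconv (\<lambda>t. k t + l t) u = lconv k u + lconv l u"
proof (rule locfun_eqI)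
  fix t show "lf (lconv (\<lambda>t. k t + l t) u) t = lf (lconv k u + lconv l u) t"
    using set_integral_add(2)[OF set_integrable_conv[OF assms(1), of t u] set_integrable_conv[OF assms(2), of t u]]
    by (simp add: lf_lconv assms algebra_simps continuous_on_add)
qed

lemma lconv_kernel_scale:
  assumes "continuous_on UNIV k"
  shows "lconv (\<lambda>t. c * k t) u = lscale c (lconv k u)"
proof (rule locfun_eqI)
  fix t show "lf (lconv (\<lambda>t. c * k t) u) t = lf (lscale c (lconv k u)) t"
    by (simp add: lf_lconv assms continuous_on_mult continuous_on_const mult.assoc)
qed

lemma lconv_kernel_sum:
  assumes "\<And>i. i \<in> I \<Longrightarrow> continuous_on UNIV (k i)"
  shows "lconv (\<lambda>t. \<Sum>i\<in>I. k i t) u = (\<Sum>i\<in>I. lconv (k i) u)"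
  using assms
proof (induction I rule: infinite_finite_induct)
  case (insert x F)
  then show ?case
    using lconv_kernel_add[of "k x" "\<lambda>t. \<Sum>i\<in>F. k i t"] by (simp add: continuous_on_sum)
qed (auto intro!: locfun_eqI simp: lf_lconv set_lebesgue_integral_def)

text \<open>Fubini's theorem on the triangle 0 \<le> r \<le> s \<le> t. The composed kernel is a
  parameter constrained at nonnegative times only, so a closed formula that is visibly continuous on
  the whole line can be supplied.\<close>

lemma lconv_assoc:
  fixes k1 k2 k3 :: "real \<Rightarrow> complex"
  assumes k: "continuous_on UNIV k1" "continuous_on UNIV k2" "continuous_on UNIV k3"
    and k3: "\<And>t. 0 \<le> t \<Longrightarrow> k3 t = (LINT s:{0..t}|lborel. k1 (t - s) * k2 s)"
  shows "lconv k1 (lconv k2 u) = lconv k3 u"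
proof (rule locfun_eqI)
  fix t
  show "lf (lconv k1 (lconv k2 u)) t = lf (lconv k3 u) t"
  proof (cases "t \<ge> 0")
    case False
    then show ?thesis using k by (simp add: lf_lconv set_lebesgue_integral_def)
  next
    case True
    define u0 where "u0 = (\<lambda>s. indicator {0..t} s *\<^sub>R lf u s)"
    have u0i: "integrable lborel u0" using set_integrable_lf unfolding set_integrable_def u0_def by auto
    then have [measurable]: "u0 \<in> borel_measurable borel"
      using borel_measurable_integrable by fastforce
    have [measurable]: "k1 \<in> borel_measurable borel" "k2 \<in> borel_measurable borel"
      using k by (simp_all add: borel_measurable_continuous_onI)
    have "compact (k1 ` {0..t})" "compact (k2 ` {0..t})"
      using k by (auto intro!: compact_continuous_image intro: continuous_on_subset)
    then have "bounded (k1 ` {0..t})" "bounded (k2 ` {0..t})"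
      by (simp_all add: compact_imp_bounded)
    then obtain B1 B2 where B: "\<And>s. s \<in> {0..t} \<Longrightarrow> norm (k1 s) \<le> B1" "\<And>s. s \<in> {0..t} \<Longrightarrow> norm (k2 s) \<le> B2"
      unfolding bounded_iff ball_simps by blast
    have B0: "B1 \<ge> 0" "B2 \<ge> 0"
      using order_trans[OF norm_ge_zero B(1)[of 0]] order_trans[OF norm_ge_zero B(2)[of 0]] True by auto
    \<comment> \<open>The integrand on the triangle, extended by zero to the plane so that both
      orders of integration run over the full line.\<close>
    define g where "g = (\<lambda>s r. if 0 \<le> r \<and> r \<le> s \<and> s \<le> t then k1 (t - s) * k2 (s - r) * u0 r else 0)"
    have gm: "(\<lambda>(s, r). g s r) \<in> borel_measurable (lborel \<Otimes>\<^sub>M lborel)"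
      unfolding g_def by measurable
    have gi: "integrable (lborel \<Otimes>\<^sub>M lborel) (\<lambda>(s, r). g s r)"
    proof (rule Bochner_Integration.integrable_bound[OF _ gm])
      have i1: "integrable lborel (\<lambda>s. indicator {0..t} s * (B1 * B2) :: real)"
        using integrable_real_indicator[of "{0..t}" lborel] by (intro integrable_mult_left) (auto simp: emeasure_lborel_Icc_eq)
      have "integrable (lborel \<Otimes>\<^sub>M lborel) (\<lambda>x::real \<times> real. (indicator {0..t} (fst x) * (B1 * B2)) * norm (u0 (snd x)))"
      proof (intro lborel_pair.Fubini_integrable AE_I2)
        show "integrable lborel (\<lambda>x. LINT y|lborel. norm ((indicator {0..t} (fst (x, y)) * (B1 * B2)) * norm (u0 (snd (x, y)))))"
          using B0 i1 by (simp add: abs_mult)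
        show "integrable lborel (\<lambda>y. indicator {0..t} (fst (x, y)) * (B1 * B2) * norm (u0 (snd (x, y))))" for x
          using u0i by simp
      qed measurable
      then show "integrable (lborel \<Otimes>\<^sub>M lborel) (\<lambda>(s, r). (indicator {0..t} s * (B1 * B2)) * norm (u0 r))"
        unfolding case_prod_beta' .
      have "norm (g s r) \<le> norm ((indicator {0..t} s * (B1 * B2)) * norm (u0 r))" for s r
        using B(1)[of "t - s"] B(2)[of "s - r"] B0
        by (auto simp: g_def norm_mult indicator_def intro!: mult_right_mono mult_mono)
      then show "AE x in lborel \<Otimes>\<^sub>M lborel. norm (case x of (s, r) \<Rightarrow> g s r)
         \<le> norm (case x of (s, r) \<Rightarrow> (indicator {0..t} s * (B1 * B2)) * norm (u0 r))"
        by (auto simp: case_prod_beta)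
    qed
    have "lf (lconv k1 (lconv k2 u)) t = (LINT s|lborel. (LINT r|lborel. g s r))"
      unfolding lf_lconv[OF k(1)] lf_lconv[OF k(2)] set_lebesgue_integral_def
    proof (intro Bochner_Integration.integral_cong refl)
      fix s
      show "indicator {0..t} s *\<^sub>R (k1 (t - s) * (LINT r|lborel. indicator {0..s} r *\<^sub>R (k2 (s - r) * lf u r))) = (LINT r|lborel. g s r)"
      proof (cases "0 \<le> s \<and> s \<le> t")
        case T: True
        have "(LINT r|lborel. g s r) = (LINT r|lborel. k1 (t - s) * (indicator {0..s} r *\<^sub>R (k2 (s - r) * lf u r)))"
          using T by (intro Bochner_Integration.integral_cong) (auto simp: g_def u0_def indicator_def)
        also have "\<dots> = k1 (t - s) * (LINT r|lborel. indicator {0..s} r *\<^sub>R (k2 (s - r) * lf u r))"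
          by (rule integral_mult_right_zero)
        finally show ?thesis using T by simp
      next
        case F: False
        then have "g s r = 0" for r by (auto simp: g_def)
        then show ?thesis using F by simp
      qed
    qed
    also have "\<dots> = (LINT r|lborel. (LINT s|lborel. g s r))"
      by (rule lborel_pair.Fubini_integral[symmetric, OF gi])
    also have "\<dots> = lf (lconv k3 u) t"
      unfolding lf_lconv[OF k(3)] set_lebesgue_integral_def
    proof (intro Bochner_Integration.integral_cong refl)
      fix r
      show "(LINT s|lborel. g s r) = indicator {0..t} r *\<^sub>R (k3 (t - r) * lf u r)"
      proof (cases "0 \<le> r \<and> r \<le> t")
        case T: True
        have "k3 (t - r) = (LINT s|lborel. indicator {0..t-r} s *\<^sub>R (k1 (t - r - s) * k2 s))"
          using T k3[of "t - r"] by (simp add: set_lebesgue_integral_def)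
        also have "\<dots> = (LINT s|lborel. indicator {r..t} s *\<^sub>R (k1 (t - s) * k2 (s - r)))"
          by (subst lborel_integral_real_affine[where c=1 and t="-r"])
             (auto simp: indicator_def algebra_simps intro!: Bochner_Integration.integral_cong)
        finally have "k3 (t - r) * lf u r = (LINT s|lborel. (indicator {r..t} s *\<^sub>R (k1 (t - s) * k2 (s - r))) * lf u r)"
          by (simp only: integral_mult_left_zero)
        also have "\<dots> = (LINT s|lborel. g s r)"
          using T by (intro Bochner_Integration.integral_cong) (auto simp: g_def u0_def indicator_def)
        finally show ?thesis using T by simp
      next
        case F: False
        then have "g s r = 0" for s by (auto simp: g_def)
        then show ?thesis using F by simp
      qed
    qed
    finally show ?thesis .
  qed
qed

section \<open>Exponential kernels and the resolvent identity\<close>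

text \<open>The solution operator of w' = l w + u with w(0) = 0, in other words the resolvent at l
  of differentiation with zero initial value.\<close>

definition expconv :: "complex \<Rightarrow> locfun \<Rightarrow> locfun" where
  "expconv l = lconv (\<lambda>t. exp (l * of_real t))"

lemma continuous_exp_kernel [simp, intro]: "continuous_on UNIV (\<lambda>t. exp (l * complex_of_real t))"
  by (intro continuous_intros)

lemma FTC_set_integral:
  fixes F f :: "real \<Rightarrow> complex"
  assumes "0 \<le> t" and F: "\<And>x. (F has_vector_derivative f x) (at x)" and f: "continuous_on UNIV f"
  shows "(LINT s:{0..t}|lborel. f s) = F t - F 0"
  unfolding set_lebesgue_integral_def
  by (rule integral_FTC_Icc[OF assms(1)]) (auto intro: has_vector_derivative_at_within F continuous_on_subset[OF f])

text \<open>For distinct exponents the convolution of the two exponentials is their divided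
  difference; for equal exponents both sides vanish.\<close>

lemma resolvent_identity:
  "lscale (l - k) (expconv l (expconv k u)) = expconv l u - expconv k u"
proof (cases "l = k")
  case False
  define k3 where "k3 = (\<lambda>t. (1 / (l - k)) * (exp (l * complex_of_real t) + (- 1) * exp (k * complex_of_real t)))"
  have c3: "continuous_on UNIV k3" unfolding k3_def by (intro continuous_intros)
  have "expconv l (expconv k u) = lconv k3 u"
    unfolding expconv_def
  proof (rule lconv_assoc)
    fix t :: real assume t: "0 \<le> t"
    \<comment> \<open>The exponents l (t - s) and k s are merged, so one antiderivative in s
      evaluates the convolution integral.\<close>
    define F where "F = (\<lambda>s. exp (l * of_real t + (k - l) * complex_of_real s) / (k - l))"
    have "(LINT s:{0..t}|lborel. exp (l * of_real t + (k - l) * complex_of_real s)) = F t - F 0"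
    proof (rule FTC_set_integral[OF t])
      show "(F has_vector_derivative exp (l * of_real t + (k - l) * complex_of_real s)) (at s)" for s
        unfolding F_def using False
        by (auto intro!: derivative_eq_intros has_vector_derivative_real_field simp: divide_simps)
    qed (intro continuous_intros)
    also have "F t - F 0 = k3 t"
      using False by (simp add: F_def k3_def algebra_simps divide_simps)
    finally show "k3 t = (LINT s:{0..t}|lborel. exp (l * of_real (t - s)) * exp (k * complex_of_real s))"
      by (simp add: algebra_simps flip: exp_add)
  qed (use c3 in auto)
  also have "\<dots> = lscale (1 / (l - k)) (expconv l u + lscale (-1) (expconv k u))"
    unfolding k3_def expconv_def
    by (subst lconv_kernel_scale, intro continuous_intros, subst lconv_kernel_add, intro continuous_intros, intro continuous_intros,
        subst lconv_kernel_scale[where c="-1"], auto)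
  finally show ?thesis using False by simp
qed auto

lemma expconv_add: "expconv l (u + v) = expconv l u + expconv l v"
  unfolding expconv_def by (rule lconv_add) auto

lemma expconv_scale: "expconv l (lscale c u) = lscale c (expconv l u)"
  unfolding expconv_def by (rule lconv_scale) auto

lemma expconv_0 [simp]: "expconv l 0 = 0"
  by (simp add: expconv_def)

lemma expconv_diff: "expconv l (u - v) = expconv l u - expconv l v"
  using expconv_add[of l "u - v" v] by (simp add: eq_diff_eq)

lemma expconv_sum: "expconv c (\<Sum>j\<in>J. f j) = (\<Sum>j\<in>J. expconv c (f j))"
  by (induction J rule: infinite_finite_induct) (simp_all add: expconv_add)

abbreviation E1 :: "locfun \<Rightarrow> locfun" where "E1 \<equiv> expconv (- 1)"

subsection \<open>Polynomials in an integration operator\<close>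

text \<open>Horner evaluation of the polynomial at the operator \<open>E1\<close>. It makes
  \<open>locfun\<close> a module over the complex polynomials with the variable acting as
  \<open>E1\<close>; since the ring is commutative, determinants of polynomial matrices make sense
  for operators.\<close>

definition pact :: "complex poly \<Rightarrow> locfun \<Rightarrow> locfun" where
  "pact p u = fold_coeffs (\<lambda>a w. lscale a u + E1 w) p 0"

lemma pact_0 [simp]: "pact 0 u = 0"
  by (simp add: pact_def)

lemma pact_pCons [simp]: "pact (pCons a p) u = lscale a u + E1 (pact p u)"
  by (cases "p = 0 \<and> a = 0") (auto simp: pact_def)

lemma pact_1 [simp]: "pact 1 u = u"
  by (simp add: one_pCons)

lemma pact_add: "pact (p + q) u = pact p u + pact q u"
  by (induction p q rule: poly_induct2) (simp_all add: lscale_add expconv_add)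

lemma pact_smult: "pact (smult c p) u = lscale c (pact p u)"
  by (induction p) (simp_all add: lscale_add expconv_scale)

lemma pact_vadd: "pact p (u + v) = pact p u + pact p v"
  by (induction p) (simp_all add: lscale_add expconv_add)

lemma pact_vscale: "pact p (lscale c u) = lscale c (pact p u)"
  by (induction p) (simp_all add: lscale_add expconv_scale mult.commute)

lemma pact_v0 [simp]: "pact p 0 = 0"
  by (induction p) simp_all

lemma pact_mult: "pact (p * q) u = pact p (pact q u)"
  by (induction p) (simp_all add: pact_add pact_smult)

lemma pact_minus: "pact (- p) u = - pact p u"
  using pact_smult[of "-1" p u] by simp

lemma pact_diff: "pact (p - q) u = pact p u - pact q u"
  using pact_add[of p "- q" u] by (simp add: pact_minus)

lemma pact_vsum: "pact p (\<Sum>i\<in>I. u i) = (\<Sum>i\<in>I. pact p (u i))"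
  by (induction I rule: infinite_finite_induct) (auto simp: pact_vadd)

lemma pact_sum: "pact (\<Sum>i\<in>I. p i) u = (\<Sum>i\<in>I. pact (p i) u)"
  by (induction I rule: infinite_finite_induct) (auto simp: pact_add)

section \<open>Stable polynomials and their inverses\<close>

definition spec_disc :: "complex set" where "spec_disc = cball (1/2) (1/2)"

definition stable :: "complex poly \<Rightarrow> bool" where
  "stable d \<longleftrightarrow> (\<forall>e\<in>spec_disc. poly d e \<noteq> 0)"

text \<open>Squaring |1/2 - e| \<le> 1/2 gives |e|^2 \<le> Re e, and Re (1/e) is Re e / |e|^2. With
  1/e = z + 1 the condition reads Re z \<ge> 0.\<close>

lemma spec_disc_inverse_iff:
  assumes "e \<noteq> 0"
  shows "e \<in> spec_disc \<longleftrightarrow> Re (1 / e) \<ge> 1"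
proof -
  have pos: "(Re e)\<^sup>2 + (Im e)\<^sup>2 > 0" using assms by (simp add: complex_neq_0)
  have "e \<in> spec_disc \<longleftrightarrow> cmod (1/2 - e) \<le> 1/2" by (simp add: spec_disc_def dist_norm)
  also have "\<dots> \<longleftrightarrow> (cmod (1/2 - e))\<^sup>2 \<le> (1/2)\<^sup>2"
    using abs_le_square_iff[of "cmod (1/2 - e)" "1/2"] by simp
  also have "\<dots> \<longleftrightarrow> (Re e)\<^sup>2 + (Im e)\<^sup>2 \<le> Re e"
    unfolding cmod_power2 using mult_le_cancel_right_pos[of 4 "(Re e)\<^sup>2 + (Im e)\<^sup>2" "Re e"]
    by (simp add: power2_eq_square algebra_simps)
  also have "\<dots> \<longleftrightarrow> Re (1 / e) \<ge> 1"
    using pos by (simp add: Re_divide field_simps)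
  finally show ?thesis .
qed

lemma stable_1: "stable 1" by (simp add: stable_def)

lemma stable_mult: "stable (p * q) \<longleftrightarrow> stable p \<and> stable q"
  by (auto simp: stable_def)

text \<open>Factors of a stable polynomial are inverted one root at a time: by the resolvent identity,
  \<open>(e - \<rho>)\<^sup>-\<^sup>1\<close> acts as \<open>- a (1 + a E)\<close> with \<open>a = 1 / \<rho>\<close> and \<open>E\<close> the convolution with
  \<open>exp ((a - 1) t)\<close>, which decays because \<open>\<rho>\<close> lies outside the disc.\<close>

inductive stable_op :: "(locfun \<Rightarrow> locfun) \<Rightarrow> bool" where
  id: "stable_op (\<lambda>u. u)"
| scale: "stable_op S \<Longrightarrow> stable_op (\<lambda>u. lscale c (S u))"
| add: "stable_op S \<Longrightarrow> stable_op T \<Longrightarrow> stable_op (\<lambda>u. S u + T u)"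
| exp: "Re l < 0 \<Longrightarrow> stable_op S \<Longrightarrow> stable_op (\<lambda>u. expconv l (S u))"

lemma stable_op_comp: "stable_op S \<Longrightarrow> stable_op T \<Longrightarrow> stable_op (\<lambda>u. S (T u))"
  by (induction rule: stable_op.induct) (auto intro: stable_op.intros)

lemma stable_op_0: "stable_op (\<lambda>u. 0)"
  using stable_op.scale[OF stable_op.id, of 0] by simp

lemma stable_op_pact: "stable_op (pact p)"
proof (induction p)
  case 0
  then show ?case using stable_op_0 by simp
next
  case (pCons a p)
  show ?case
    unfolding pact_pCons by (intro stable_op.intros pCons) simp
qed

lemma linear_factor_inverse:
  assumes r: "r \<notin> spec_disc"
  shows "\<exists>S. stable_op S \<and> (\<forall>u. S (pact [:-r, 1:] u) = u) \<and> (\<forall>u. pact [:-r, 1:] (S u) = u)"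
proof -
  have r0: "r \<noteq> 0" using r by (auto simp: spec_disc_def dist_norm)
  define a where "a = 1 / r"
  have ra: "r * a = 1" using r0 by (simp add: a_def)
  \<comment> \<open>A root outside the disc has Re (1/r) < 1, which is exactly decay of the kernel
    exp((a - 1) t).\<close>
  have Re: "Re (a - 1) < 0" using spec_disc_inverse_iff[OF r0] r by (simp add: a_def)
  \<comment> \<open>Since r a = 1, e - r equals - r (1 - a e). The resolvent identity for the
    exponents a - 1 and - 1, which differ by a, shows that 1 + a \<open>expconv (a - 1)\<close>
    inverts 1 - a E on both sides.\<close>
  define S where "S = (\<lambda>u. lscale (- a) (u + lscale a (expconv (a - 1) u)))"
  have res1: "lscale a (expconv (a - 1) (E1 u)) = expconv (a - 1) u - E1 u" for u
    using resolvent_identity[of "a - 1" "- 1" u] by simp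
  have res2: "lscale a (E1 (expconv (a - 1) u)) = expconv (a - 1) u - E1 u" for u
    using arg_cong[OF resolvent_identity[of "- 1" "a - 1" u], of "lscale (- 1)"] by simp
  have P: "pact [:-r, 1:] u = E1 u - lscale r u" for u
    by (rule locfun_eqI) simp
  have "S (pact [:-r, 1:] u) = u" for u
  proof -
    have "S (pact [:-r, 1:] u) = lscale (- a) (E1 u - lscale r u + (lscale a (expconv (a - 1) (E1 u)) - lscale (r * a) (expconv (a - 1) u)))"
      unfolding P S_def expconv_diff
      by (intro locfun_eqI) (simp add: expconv_scale lscale_add algebra_simps)
    also have "\<dots> = u" unfolding res1 ra using ra by (intro locfun_eqI) (simp add: mult.commute)
    finally show ?thesis .
  qed
  moreover have "pact [:-r, 1:] (S u) = u" for u
  proof -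
    have "pact [:-r, 1:] (S u) = lscale (- a) (E1 u - lscale r u + (lscale a (E1 (expconv (a - 1) u)) - lscale (r * a) (expconv (a - 1) u)))"
      unfolding P S_def
      by (intro locfun_eqI) (simp add: expconv_add expconv_scale lscale_add algebra_simps)
    also have "\<dots> = u" unfolding res2 ra using ra by (intro locfun_eqI) (simp add: mult.commute)
    finally show ?thesis .
  qed
  moreover have "stable_op S" unfolding S_def using Re by (intro stable_op.intros) auto
  ultimately show ?thesis by blast
qed

lemma stable_inverse:
  assumes "stable d"
  shows "\<exists>S. stable_op S \<and> (\<forall>u. S (pact d u) = u) \<and> (\<forall>u. pact d (S u) = u)"
  using assms
proof (induction "degree d" arbitrary: d)
  case 0
  then obtain c where d: "d = [:c:]" using degree_eq_zeroE by metis
  \<comment> \<open>Any point of the disc would do: stability of a constant only says that the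
    constant is nonzero.\<close>
  have "0 \<in> spec_disc" by (simp add: spec_disc_def dist_norm)
  then have "c \<noteq> 0" using 0 d by (auto simp: stable_def)
  then show ?case
    by (intro exI[of _ "lscale (1 / c)"] conjI stable_op.scale stable_op.id) (auto simp: d)
next
  case (Suc n)
  then obtain r where r: "poly d r = 0"
    using fundamental_theorem_of_algebra[of d] by (auto simp: constant_degree)
  then obtain d' where d': "d = [:- r, 1:] * d'" by (auto simp: poly_eq_0_iff_dvd dvd_def)
  have "d \<noteq> 0" using Suc(2) by auto
  then have "d' \<noteq> 0" using d' mult_zero_right by metis
  then have "degree d = degree [:- r, 1:] + degree d'" unfolding d'
    by (intro degree_mult_eq) (simp_all only: pCons_eq_0_iff one_neq_zero simp_thms)
  then have "degree d = Suc (degree d')" by simp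
  then have "degree d' = n" using Suc(2) by simp
  moreover have "r \<notin> spec_disc" using Suc(3) r by (auto simp: stable_def)
  moreover have "stable d'" using Suc(3) by (simp add: d' stable_mult del: mult_pCons_left)
  ultimately have "\<exists>S. stable_op S \<and> (\<forall>u. S (pact d' u) = u) \<and> (\<forall>u. pact d' (S u) = u)"
    and "\<exists>T. stable_op T \<and> (\<forall>u. T (pact [:-r, 1:] u) = u) \<and> (\<forall>u. pact [:-r, 1:] (T u) = u)"
    by (intro Suc(1) linear_factor_inverse; simp)+
  then obtain S T where S: "stable_op S" "\<forall>u. S (pact d' u) = u" "\<forall>u. pact d' (S u) = u"
    and T: "stable_op T" "\<forall>u. T (pact [:-r, 1:] u) = u" "\<forall>u. pact [:-r, 1:] (T u) = u"
    by (elim exE conjE) (rule that)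
  show ?case
    unfolding d' pact_mult
  proof (intro exI[of _ "\<lambda>u. S (T u)"] conjI)
    show "stable_op (\<lambda>u. S (T u))" by (rule stable_op_comp[OF S(1) T(1)])
  qed (simp_all add: S(2,3) T(2,3) del: pact_pCons)
qed

text \<open>For stable \<open>d\<close> the choice is immaterial, since a two-sided inverse of
  \<open>pact d\<close> is unique; choosing it among the members of \<open>stable_op\<close> gives
  the norm bound.\<close>

definition stable_inv :: "complex poly \<Rightarrow> locfun \<Rightarrow> locfun" where
  "stable_inv d = (SOME S. stable_op S \<and> (\<forall>u. S (pact d u) = u) \<and> (\<forall>u. pact d (S u) = u))"

lemma stable_inv:
  assumes "stable d"
  shows "stable_op (stable_inv d)" "stable_inv d (pact d u) = u" "pact d (stable_inv d u) = u"
  using someI_ex[OF stable_inverse[OF assms]] unfolding stable_inv_def by auto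

subsection \<open>Matrices of polynomials\<close>

definition mact :: "complex poly^'n^'m \<Rightarrow> locfun^'n \<Rightarrow> locfun^'m" where
  "mact Q U = (\<chi> i. \<Sum>j\<in>UNIV. pact (Q $ i $ j) (U $ j))"

definition vact :: "complex poly \<Rightarrow> locfun^'n \<Rightarrow> locfun^'n" where
  "vact d U = (\<chi> i. pact d (U $ i))"

definition vscale :: "complex \<Rightarrow> locfun^'n \<Rightarrow> locfun^'n" where
  "vscale c U = (\<chi> i. lscale c (U $ i))"

definition pmul :: "complex poly \<Rightarrow> complex poly^'n^'m \<Rightarrow> complex poly^'n^'m" where
  "pmul d Q = (\<chi> i j. d * Q $ i $ j)"

definition pconst :: "complex^'n^'m \<Rightarrow> complex poly^'n^'m" where
  "pconst A = (\<chi> i j. [:A $ i $ j:])"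

definition peval :: "complex \<Rightarrow> complex poly^'n^'m \<Rightarrow> complex^'n^'m" where
  "peval e Q = (\<chi> i j. poly (Q $ i $ j) e)"

lemma mact_mult: "mact (P ** Q) U = mact P (mact Q U)"
proof -
  have "mact (P ** Q) U $ i = mact P (mact Q U) $ i" for i
    unfolding mact_def matrix_matrix_mult_def
    by (simp add: pact_sum pact_vsum pact_mult) (rule sum.swap)
  then show ?thesis by (simp add: vec_eq_iff)
qed

lemma mact_add: "mact (P + Q) U = mact P U + mact Q U"
  by (simp add: mact_def vec_eq_iff pact_add sum.distrib)

lemma mact_diff: "mact (P - Q) U = mact P U - mact Q U"
  by (simp add: mact_def vec_eq_iff pact_diff sum_subtractf)

lemma mact_vadd: "mact P (U + V) = mact P U + mact P V"
  by (simp add: mact_def vec_eq_iff pact_vadd sum.distrib)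

lemma mact_vscale: "mact P (vscale c U) = vscale c (mact P U)"
  by (simp add: mact_def vec_eq_iff vscale_def pact_vscale lscale_sum)

lemma mact_pmul: "mact (pmul d Q) U = vact d (mact Q U)"
  by (simp add: mact_def vact_def pmul_def vec_eq_iff pact_mult pact_vsum)

lemma mact_mat: "mact (mat d) U = vact d U"
  by (simp add: mact_def vact_def mat_def vec_eq_iff if_distrib[of "\<lambda>p. pact p _"] cong: if_cong)

text \<open>Commutation of scalar denominators with matrices is what allows fractions to be
  composed.\<close>

lemma mact_vact: "mact Q (vact d U) = vact d (mact Q U)"
  by (simp add: mact_def vact_def vec_eq_iff pact_vsum mult.commute flip: pact_mult)

lemma vact_add: "vact d (U + V) = vact d U + vact d V"
  by (simp add: vact_def vec_eq_iff pact_vadd)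

lemma vact_mult: "vact (p * q) U = vact p (vact q U)"
  by (simp add: vact_def vec_eq_iff pact_mult)

lemma vact_vscale: "vact d (vscale c U) = vscale c (vact d U)"
  by (simp add: vact_def vscale_def vec_eq_iff pact_vscale)

lemma vact_smult: "vact (smult c d) U = vscale c (vact d U)"
  by (simp add: vact_def vscale_def vec_eq_iff pact_smult)

lemma vact_1: "vact 1 U = U"
  by (simp add: vact_def vec_eq_iff)

lemma stable_vact_inj: "stable d \<Longrightarrow> vact d U = vact d V \<Longrightarrow> U = V"
  by (simp add: vact_def vec_eq_iff) (metis stable_inv(2))

lemma vact_stable_inv: "stable d \<Longrightarrow> vact d (\<chi> i. stable_inv d (V $ i)) = V"
  by (simp add: vact_def vec_eq_iff stable_inv)

section \<open>Adjugates over a commutative ring\<close>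

text \<open>The adjugate: replacing row j by the k-th unit vector yields the cofactor belonging to
  position (j, k). It is formulated over commutative rings because the entries will be
  polynomials.\<close>

definition adj :: "'a::comm_ring_1^'n^'n \<Rightarrow> 'a^'n^'n" where
  "adj A = (\<chi> k j. det (\<chi> i. if i = j then axis k 1 else A $ i))"

text \<open>Linearity of the determinant in row j collects an entry of the product into the
  determinant of A with row j replaced by row i. That is det A for i = j, and otherwise two rows
  coincide.\<close>

lemma mult_adj:
  fixes A :: "'a::comm_ring_1^'n^'n"
  shows "A ** adj A = mat (det A)"
proof -
  have "(A ** adj A) $ i $ j = (mat (det A) :: 'a^'n^'n) $ i $ j" for i j
  proof -
    have row: "A $ i = (\<Sum>k\<in>UNIV. A $ i $ k *s axis k 1)"
      by (simp add: vec_eq_iff axis_def if_distrib cong: if_cong)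
    have "(A ** adj A) $ i $ j = (\<Sum>k\<in>UNIV. det (\<chi> l. if l = j then A $ i $ k *s axis k 1 else A $ l))"
      by (simp add: matrix_matrix_mult_def adj_def det_row_mul)
    also have "\<dots> = det (\<chi> l. if l = j then A $ i else A $ l)"
      by (subst (2) row) (simp add: det_linear_row_sum)
    also have "\<dots> = (mat (det A) :: 'a^'n^'n) $ i $ j"
    proof (cases "i = j")
      case True
      then have "(\<chi> l. if l = j then A $ i else A $ l) = A" by (simp add: vec_eq_iff)
      then show ?thesis using True by (simp add: mat_def)
    next
      case False
      then have "det (\<chi> l. if l = j then A $ i else A $ l) = 0"
        by (intro det_identical_rows[of i j]) (auto simp: row_def vec_eq_iff)
      then show ?thesis using False by (simp add: mat_def)
    qed
    finally show ?thesis .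
  qed
  then show ?thesis by (simp add: vec_eq_iff)
qed

text \<open>Transposing the right-hand identity yields a left factor at once, so commutation of a
  matrix with its adjugate need not be proved.\<close>

definition left_adj :: "'a::comm_ring_1^'n^'n \<Rightarrow> 'a^'n^'n" where
  "left_adj A = transpose (adj (transpose A))"

lemma left_adj_mult:
  fixes A :: "'a::comm_ring_1^'n^'n"
  shows "left_adj A ** A = mat (det A)"
  using arg_cong[OF mult_adj[of "transpose A"], of transpose]
  by (simp add: left_adj_def matrix_transpose_mul)

text \<open>Multiplication by \<open>left_adj M\<close> turns the system into the scalar polynomial
  det M acting on each component.\<close>

lemma mact_inj:
  assumes "stable (det M)" "mact M U = mact M V"
  shows "U = V"
proof -
  have "mact (left_adj M ** M) U = mact (left_adj M ** M) V"
    using assms by (simp add: mact_mult)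
  then show ?thesis
    using stable_vact_inj[OF assms(1)] by (simp add: left_adj_mult mact_mat)
qed

lemma peval_mult: "peval e (P ** Q) = peval e P ** peval e Q"
  by (simp add: peval_def matrix_matrix_mult_def vec_eq_iff poly_sum)

lemma peval_simps:
  "peval e (P + Q) = peval e P + peval e Q" "peval e (P - Q) = peval e P - peval e Q"
  "peval e (pmul d Q) = mat (poly d e) ** peval e Q" "peval e (pconst A) = A"
  by (simp_all add: peval_def matrix_matrix_mult_def vec_eq_iff pmul_def mat_def pconst_def
       if_distrib if_distribR cong: if_cong)

lemma peval_mat: "peval e (mat d) = mat (poly d e)"
  by (simp add: peval_def vec_eq_iff mat_def)

lemma poly_det: "poly (det M) e = det (peval e M)"
  by (simp add: det_def peval_def poly_sum poly_prod)

subsection \<open>Young's inequality for exponential kernels\<close>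

text \<open>The modulus of an exponential convolution kernel as a function on the plane. Its
  integrals over either variable are at most 1/x, the two hypotheses of Schur's test.\<close>

definition exp_kernel :: "real \<Rightarrow> real \<Rightarrow> real \<Rightarrow> real" where
  "exp_kernel x t s = (if 0 < s \<and> s \<le> t then exp (- x * (t - s)) else 0)"

lemma exp_kernel_measurable [measurable]:
  "(\<lambda>(t, s). exp_kernel x t s) \<in> borel_measurable (borel \<Otimes>\<^sub>M borel)"
  unfolding exp_kernel_def by measurable

lemma exp_kernel_measurable_section [measurable]: "exp_kernel x t \<in> borel_measurable borel"
  "(\<lambda>t. exp_kernel x t s) \<in> borel_measurable borel"
  unfolding exp_kernel_def by measurable

lemma exp_kernel_nonneg: "exp_kernel x t s \<ge> 0"
  by (simp add: exp_kernel_def)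

lemma nn_integral_exp_half_line:
  assumes "x > 0"
  shows "(\<integral>\<^sup>+s. ennreal (exp (- x * s)) * indicator {0..} s \<partial>lborel) = ennreal (1 / x)"
proof -
  have "(\<integral>\<^sup>+s. ennreal (exp (- x * s)) * indicator {0..} s \<partial>lborel) = 0 - (- (1 / x) * exp (- x * 0))"
  proof (rule nn_integral_FTC_atLeast)
    show "((\<lambda>s. - (1 / x) * exp (- x * s)) has_real_derivative exp (- x * s)) (at s)" for s
      using assms by (auto intro!: derivative_eq_intros)
    have "((\<lambda>s. exp (- x * s)) \<longlongrightarrow> 0) at_top"
      by (intro filterlim_compose[OF exp_at_bot] filterlim_tendsto_neg_mult_at_bot[OF tendsto_const _ filterlim_ident])
         (use assms in auto)
    then show "((\<lambda>s. - (1 / x) * exp (- x * s)) \<longlongrightarrow> 0) at_top"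
      by (intro tendsto_mult_right_zero)
  qed auto
  then show ?thesis by simp
qed

lemma exp_kernel_integral_right:
  assumes "x > 0" shows "(\<integral>\<^sup>+s. ennreal (exp_kernel x t s) \<partial>lborel) \<le> ennreal (1 / x)"
proof -
  have "(\<integral>\<^sup>+s. ennreal (exp_kernel x t s) \<partial>lborel) = (\<integral>\<^sup>+s. ennreal (exp_kernel x t (t + (-1) * s)) \<partial>lborel)"
    by (subst nn_integral_real_affine[where c="-1" and t=t]) auto
  also have "\<dots> \<le> (\<integral>\<^sup>+s. ennreal (exp (- x * s)) * indicator {0..} s \<partial>lborel)"
    by (intro nn_integral_mono) (auto simp: exp_kernel_def indicator_def)
  finally show ?thesis using nn_integral_exp_half_line[OF assms] by simp
qed

lemma exp_kernel_integral_left: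
  assumes "x > 0" shows "(\<integral>\<^sup>+t. ennreal (exp_kernel x t s) \<partial>lborel) \<le> ennreal (1 / x)"
proof -
  have "(\<integral>\<^sup>+t. ennreal (exp_kernel x t s) \<partial>lborel) = (\<integral>\<^sup>+t. ennreal (exp_kernel x (s + 1 * t) s) \<partial>lborel)"
    by (subst nn_integral_real_affine[where c=1 and t=s]) auto
  also have "\<dots> \<le> (\<integral>\<^sup>+t. ennreal (exp (- x * t)) * indicator {0..} t \<partial>lborel)"
    by (intro nn_integral_mono) (auto simp: exp_kernel_def indicator_def)
  finally show ?thesis using nn_integral_exp_half_line[OF assms] by simp
qed

text \<open>Convexity: the graph of v^q lies above its tangent at \<delta>, and the tangent
  inequality is solved for v. This is Young's inequality for v/\<delta> and 1; for q = 1 the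
  conjugate exponent is infinite, hence the case split.\<close>

lemma powr_tangent:
  fixes v q \<delta> :: real
  assumes "v \<ge> 0" "q \<ge> 1" "\<delta> > 0"
  shows "v \<le> \<delta> powr (1 - q) * v powr q / q + (1 - 1 / q) * \<delta>"
proof (cases "q = 1")
  case False
  with assms have q: "q > 1" by simp
  have "v / \<delta> * 1 \<le> (v / \<delta>) powr q / q + 1 powr (q / (q - 1)) / (q / (q - 1))"
    using q assms by (intro Youngs_inequality) (auto simp: field_simps)
  then have "\<delta> * (v / \<delta>) \<le> \<delta> * ((v / \<delta>) powr q / q + (1 - 1 / q))"
    using assms(3) q by (intro mult_left_mono) (auto simp: field_simps)
  moreover have "\<delta> * (v / \<delta>) powr q = \<delta> powr (1 - q) * v powr q"
    using assms by (simp add: powr_divide powr_diff)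
  ultimately show ?thesis using assms(3) by (simp add: algebra_simps)
qed (use assms in simp)

text \<open>Jensen's inequality for a measure of mass at most 1/x, obtained by integrating
  \<open>powr_tangent\<close> against the kernel at a well-chosen \<delta>.\<close>

lemma exp_kernel_jensen:
  fixes v :: "real \<Rightarrow> real"
  assumes x: "x > 0" and q: "q \<ge> 1" and v: "\<And>s. v s \<ge> 0" and [measurable]: "v \<in> borel_measurable borel"
    and A: "(\<integral>\<^sup>+s. ennreal (exp_kernel x t s * v s) \<partial>lborel) = ennreal A" "A \<ge> 0"
  shows "ennreal (A powr q) \<le> ennreal ((1 / x) powr (q - 1)) * (\<integral>\<^sup>+s. ennreal (exp_kernel x t s * v s powr q) \<partial>lborel)"
proof (cases "A = 0 \<or> (\<integral>\<^sup>+s. ennreal (exp_kernel x t s * v s powr q) \<partial>lborel) = \<infinity>")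
  case True
  then show ?thesis using x by (auto simp: ennreal_mult_eq_top_iff)
next
  case False
  with A(2) have A0: "A > 0" by simp
  from False obtain I where I: "(\<integral>\<^sup>+s. ennreal (exp_kernel x t s * v s powr q) \<partial>lborel) = ennreal I" "I \<ge> 0"
    by (cases "\<integral>\<^sup>+s. ennreal (exp_kernel x t s * v s powr q) \<partial>lborel") auto
  \<comment> \<open>The mean value of v if the kernel had mass exactly 1/x. With this choice the
    linear terms reduce to A - A/q, and A cancels against the left-hand side.\<close>
  define \<delta> where "\<delta> = A * x"
  have d: "\<delta> > 0" using A0 x by (simp add: \<delta>_def)
  define c where "c = \<delta> powr (1 - q) / q"
  have c: "c > 0" using d q by (simp add: c_def)
  have d2: "(1 - 1 / q) * \<delta> \<ge> 0" using d q by simp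
  have "ennreal A \<le> (\<integral>\<^sup>+s. ennreal (c * (exp_kernel x t s * v s powr q) + (1 - 1 / q) * \<delta> * exp_kernel x t s) \<partial>lborel)"
    unfolding A(1)[symmetric]
  proof (intro nn_integral_mono ennreal_leI)
    fix s
    show "exp_kernel x t s * v s \<le> c * (exp_kernel x t s * v s powr q) + (1 - 1 / q) * \<delta> * exp_kernel x t s"
      using mult_left_mono[OF powr_tangent[OF v[of s] q d] exp_kernel_nonneg[of x t s]]
      by (simp add: c_def algebra_simps)
  qed
  also have "\<dots> = (\<integral>\<^sup>+s. ennreal c * ennreal (exp_kernel x t s * v s powr q) + ennreal ((1 - 1 / q) * \<delta>) * ennreal (exp_kernel x t s) \<partial>lborel)"
    using c d2 exp_kernel_nonneg[of x t] by (intro nn_integral_cong) (simp add: ennreal_plus ennreal_mult)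
  also have "\<dots> = ennreal c * ennreal I + ennreal ((1 - 1 / q) * \<delta>) * (\<integral>\<^sup>+s. ennreal (exp_kernel x t s) \<partial>lborel)"
    by (simp add: nn_integral_add nn_integral_cmult I(1))
  also have "\<dots> \<le> ennreal c * ennreal I + ennreal ((1 - 1 / q) * \<delta>) * ennreal (1 / x)"
    by (intro add_left_mono mult_left_mono exp_kernel_integral_right x) simp
  also have "\<dots> = ennreal (c * I + (1 - 1 / q) * \<delta> * (1 / x))"
    using c d2 I(2) x by (subst ennreal_plus) (simp_all add: ennreal_mult[symmetric])
  finally have "A \<le> c * I + (1 - 1 / q) * \<delta> * (1 / x)"
    using c d2 I(2) x by (subst (asm) ennreal_le_iff) auto
  also have "\<dots> = c * I + A - A / q" using x by (simp add: \<delta>_def algebra_simps)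
  finally have "A / q \<le> c * I" by simp
  then have "A \<le> \<delta> powr (1 - q) * I" using q by (simp add: c_def field_simps)
  \<comment> \<open>The factor turns A into A^q on the left, while on the right (A x)^(1 - q) A^(q -
    1) collapses to (1/x)^(q - 1).\<close>
  then have "A * A powr (q - 1) \<le> \<delta> powr (1 - q) * I * A powr (q - 1)"
    by (intro mult_right_mono) auto
  also have "A * A powr (q - 1) = A powr q" using A0 by (simp add: powr_mult_base)
  also have "\<delta> powr (1 - q) * I * A powr (q - 1) = (1 / x) powr (q - 1) * I"
    using A0 x by (simp add: \<delta>_def powr_mult powr_divide powr_diff)
  finally show ?thesis using I x by (simp add: ennreal_mult[symmetric] ennreal_leI)
qed

text \<open>Bounds for the \<open>q\<close>-th power of the norm up to a constant replace Minkowski's inequality, and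
  values in \<open>ennreal\<close> make membership in \<open>L\<^sub>q\<close> part of the bound.\<close>

definition Jq :: "real \<Rightarrow> (real \<Rightarrow> 'a::real_normed_vector) \<Rightarrow> ennreal" where
  "Jq q u = (\<integral>\<^sup>+t. ennreal (norm (u t) powr q) \<partial>half_line)"

lemma Jq_lborel: "Jq q u = (\<integral>\<^sup>+t. ennreal (norm (u t) powr q) * indicator {0<..} t \<partial>lborel)"
  unfolding Jq_def by (rule nn_integral_restrict_space) simp

text \<open>Measurability is known only on bounded intervals, so the function is the pointwise limit
  of its truncations to (0, n].\<close>

lemma lf_measurable_lborel: "(\<lambda>t. indicator {0<..} t *\<^sub>R lf u t) \<in> borel_measurable borel"
proof (rule borel_measurable_LIMSEQ_metric)
  fix n :: nat
  have "set_integrable lborel {0<..real n} (lf u)"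
    by (rule set_integrable_subset[OF set_integrable_lf[of "real n"]]) auto
  then show "(\<lambda>t. indicator {0<..real n} t *\<^sub>R lf u t) \<in> borel_measurable borel"
    unfolding set_integrable_def using borel_measurable_integrable by fastforce
next
  fix t :: real
  obtain N :: nat where N: "t \<le> real N" using real_arch_simple by blast
  have "eventually (\<lambda>n. indicator {0<..real n} t *\<^sub>R lf u t = indicator {0<..} t *\<^sub>R lf u t) sequentially"
    by (rule eventually_sequentiallyI[of N]) (use N in \<open>auto simp: indicator_def\<close>)
  then show "(\<lambda>n. indicator {0<..real n} t *\<^sub>R lf u t) \<longlonglongrightarrow> indicator {0<..} t *\<^sub>R lf u t"
    by (simp add: tendsto_eventually)
qed

lemma lf_measurable [measurable]: "lf u \<in> borel_measurable half_line"
  by (subst borel_measurable_restrict_space_iff) (use lf_measurable_lborel in simp_all)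

text \<open>Young's inequality with the q-th power of the L_1 norm 1 / (- Re l) of the kernel:
  Jensen's inequality at fixed t costs q - 1 powers, Tonelli's theorem in the other variable the
  last one. An input outside L_q makes the right side infinite.\<close>

lemma Jq_expconv:
  assumes l: "Re l < 0" and q: "q \<ge> 1"
  shows "Jq q (lf (expconv l u)) \<le> ennreal ((1 / - Re l) powr q) * Jq q (lf u)"
proof -
  define x where "x = - Re l"
  have x: "x > 0" using l by (simp add: x_def)
  define v where "v = (\<lambda>s. norm (indicator {0<..} s *\<^sub>R lf u s))"
  have [measurable]: "v \<in> borel_measurable borel" unfolding v_def using lf_measurable_lborel by measurable
  have v0: "v s \<ge> 0" for s by (simp add: v_def)
  define I where "I = (\<lambda>t. \<integral>\<^sup>+s. ennreal (exp_kernel x t s * v s powr q) \<partial>lborel)"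
  have pt: "ennreal (norm (lf (expconv l u) t) powr q) * indicator {0<..} t \<le> ennreal ((1 / x) powr (q - 1)) * I t" for t
  proof (cases "t > 0")
    case True
    have int: "set_integrable lborel {0..t} (\<lambda>s. exp (l * complex_of_real (t - s)) * lf u s)"
      by (rule set_integrable_conv[of "\<lambda>t. exp (l * complex_of_real t)"]) auto
    \<comment> \<open>The two integrands may differ at s = 0, which the open half-line excludes and
      the closed interval includes.\<close>
    have eqn: "norm (indicator {0..t} s *\<^sub>R (exp (l * complex_of_real (t - s)) * lf u s)) = exp_kernel x t s * v s" if "s \<noteq> 0" for s
      using that by (auto simp: indicator_def exp_kernel_def v_def norm_mult x_def)
    have AE: "AE s in lborel. norm (indicator {0..t} s *\<^sub>R (exp (l * complex_of_real (t - s)) * lf u s)) = exp_kernel x t s * v s"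
      using AE_lborel_singleton[of 0] by eventually_elim (rule eqn)
    define A where "A = (LINT s|lborel. norm (indicator {0..t} s *\<^sub>R (exp (l * complex_of_real (t - s)) * lf u s)))"
    have A: "(\<integral>\<^sup>+s. ennreal (exp_kernel x t s * v s) \<partial>lborel) = ennreal A"
    proof -
      have "(\<integral>\<^sup>+s. ennreal (exp_kernel x t s * v s) \<partial>lborel) =
         (\<integral>\<^sup>+s. ennreal (norm (indicator {0..t} s *\<^sub>R (exp (l * complex_of_real (t - s)) * lf u s))) \<partial>lborel)"
        using AE by (intro nn_integral_cong_AE) (auto elim!: eventually_mono)
      also have "\<dots> = ennreal A" unfolding A_def
        by (rule nn_integral_eq_integral[OF integrable_norm[OF int[unfolded set_integrable_def]]]) simp
      finally show ?thesis .
    qed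
    have "norm (lf (expconv l u) t) \<le> A"
      unfolding expconv_def lf_lconv[OF continuous_exp_kernel] A_def set_lebesgue_integral_def by (rule integral_norm_bound)
    then have "ennreal (norm (lf (expconv l u) t) powr q) \<le> ennreal (A powr q)"
      using q by (intro ennreal_leI powr_mono2) auto
    also have "\<dots> \<le> ennreal ((1 / x) powr (q - 1)) * I t"
      unfolding I_def by (rule exp_kernel_jensen[OF x q v0 _ A]) (auto simp: A_def)
    finally show ?thesis using True by simp
  qed simp
  have "Jq q (lf (expconv l u)) \<le> (\<integral>\<^sup>+t. ennreal ((1 / x) powr (q - 1)) * I t \<partial>lborel)"
    unfolding Jq_lborel by (intro nn_integral_mono pt)
  also have "\<dots> = ennreal ((1 / x) powr (q - 1)) * (\<integral>\<^sup>+t. I t \<partial>lborel)"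
    unfolding I_def by (rule nn_integral_cmult) measurable
  also have "(\<integral>\<^sup>+t. I t \<partial>lborel) = (\<integral>\<^sup>+s. (\<integral>\<^sup>+t. ennreal (exp_kernel x t s * v s powr q) \<partial>lborel) \<partial>lborel)"
    unfolding I_def by (rule lborel_pair.Fubini') measurable
  also have "\<dots> \<le> (\<integral>\<^sup>+s. ennreal (1 / x) * ennreal (v s powr q) \<partial>lborel)"
  proof (rule nn_integral_mono)
    fix s
    have "(\<integral>\<^sup>+t. ennreal (exp_kernel x t s * v s powr q) \<partial>lborel) = (\<integral>\<^sup>+t. ennreal (exp_kernel x t s) \<partial>lborel) * ennreal (v s powr q)"
      using exp_kernel_nonneg by (subst nn_integral_multc[symmetric]) (simp_all add: ennreal_mult)
    also have "\<dots> \<le> ennreal (1 / x) * ennreal (v s powr q)"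
      by (intro mult_right_mono exp_kernel_integral_left x) simp
    finally show "(\<integral>\<^sup>+t. ennreal (exp_kernel x t s * v s powr q) \<partial>lborel) \<le> \<dots>" .
  qed
  also have "\<dots> = ennreal (1 / x) * Jq q (lf u)"
    unfolding Jq_lborel
    by (subst nn_integral_cmult, measurable) (auto simp: v_def indicator_def intro!: arg_cong2[where f="(*)"] nn_integral_cong)
  finally have "Jq q (lf (expconv l u)) \<le> ennreal ((1 / x) powr (q - 1)) * (ennreal (1 / x) * Jq q (lf u))"
    by (simp add: mult_left_mono)
  also have "\<dots> = ennreal ((1 / x) powr (q - 1) * (1 / x)) * Jq q (lf u)"
    by (subst ennreal_mult) (use x in \<open>simp_all add: mult.assoc\<close>)
  also have "(1 / x) powr (q - 1) * (1 / x) = (1 / x) powr q"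
    using x powr_mult_base[of "1 / x" "q - 1"] by (simp add: mult.commute)
  finally show ?thesis by (simp add: x_def)
qed

section \<open>Bounds for sums and for stable operators\<close>

lemma powr_add_le:
  fixes a b q :: real
  assumes "a \<ge> 0" "b \<ge> 0" "q \<ge> 1"
  shows "(a + b) powr q \<le> 2 powr q * (a powr q + b powr q)"
proof -
  have "(a + b) powr q \<le> (2 * max a b) powr q" using assms by (intro powr_mono2) auto
  also have "\<dots> = 2 powr q * max a b powr q" using assms by (simp add: powr_mult)
  also have "\<dots> \<le> 2 powr q * (a powr q + b powr q)" by (intro mult_left_mono) (auto simp: max_def)
  finally show ?thesis .
qed

lemma Jq_add:
  assumes q: "q \<ge> 1"
  shows "Jq q (lf (u + v)) \<le> ennreal (2 powr q) * (Jq q (lf u) + Jq q (lf v))"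
proof -
  have "Jq q (lf (u + v)) \<le> (\<integral>\<^sup>+t. ennreal (2 powr q) * (ennreal (norm (lf u t) powr q) + ennreal (norm (lf v t) powr q)) \<partial>half_line)"
    unfolding Jq_def
  proof (rule nn_integral_mono)
    fix t
    have "norm (lf (u + v) t) powr q \<le> (norm (lf u t) + norm (lf v t)) powr q"
      using q by (intro powr_mono2) (auto intro: norm_triangle_ineq)
    also have "\<dots> \<le> 2 powr q * (norm (lf u t) powr q + norm (lf v t) powr q)"
      using q by (intro powr_add_le) auto
    finally show "ennreal (norm (lf (u + v) t) powr q) \<le> ennreal (2 powr q) * (ennreal (norm (lf u t) powr q) + ennreal (norm (lf v t) powr q))"
      by (simp add: ennreal_mult[symmetric] ennreal_plus[symmetric] ennreal_leI del: ennreal_plus)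
  qed
  also have "\<dots> = ennreal (2 powr q) * (Jq q (lf u) + Jq q (lf v))"
    unfolding Jq_def by (subst nn_integral_cmult, measurable) (subst nn_integral_add, auto)
  finally show ?thesis .
qed

lemma Jq_scale: "q \<ge> 1 \<Longrightarrow> Jq q (lf (lscale c u)) = ennreal (cmod c powr q) * Jq q (lf u)"
  unfolding Jq_def by (subst nn_integral_cmult[symmetric]) (auto simp: norm_mult powr_mult ennreal_mult)

text \<open>The constant is quantified before the summands; this uniformity is what later gives an
  operator bound.\<close>

lemma Jq_sum:
  assumes q: "q \<ge> 1" and "finite I"
  shows "\<exists>C\<ge>0. \<forall>u. Jq q (lf (\<Sum>i\<in>I. u i)) \<le> ennreal C * (\<Sum>i\<in>I. Jq q (lf (u i)))"
  using assms(2)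
proof (induction I rule: finite_induct)
  case empty
  show ?case using q by (intro exI[of _ 0]) (simp add: Jq_def)
next
  case (insert i I)
  then obtain C where C: "C \<ge> 0" "\<forall>u. Jq q (lf (\<Sum>i\<in>I. u i)) \<le> ennreal C * (\<Sum>i\<in>I. Jq q (lf (u i)))"
    by blast
  show ?case
  \<comment> \<open>The new summand enters with factor 1 and the old ones with C, hence the
    maximum.\<close>
  proof (intro exI[of _ "2 powr q * max 1 C"] conjI allI)
    fix u
    have "Jq q (lf (\<Sum>i\<in>insert i I. u i)) \<le> ennreal (2 powr q) * (Jq q (lf (u i)) + Jq q (lf (\<Sum>i\<in>I. u i)))"
      using insert Jq_add[OF q] by simp
    also have "\<dots> \<le> ennreal (2 powr q) * (ennreal (max 1 C) * Jq q (lf (u i)) + ennreal (max 1 C) * (\<Sum>i\<in>I. Jq q (lf (u i))))"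
    proof (intro mult_left_mono add_mono)
      show "Jq q (lf (u i)) \<le> ennreal (max 1 C) * Jq q (lf (u i))"
        using mult_right_mono[OF ennreal_leI[of 1 "max 1 C"], of "Jq q (lf (u i))"] by simp
      show "Jq q (lf (\<Sum>i\<in>I. u i)) \<le> ennreal (max 1 C) * (\<Sum>i\<in>I. Jq q (lf (u i)))"
        by (rule order_trans[OF C(2)[rule_format]]) (auto intro!: mult_right_mono ennreal_leI)
    qed simp
    also have "\<dots> = ennreal (2 powr q * max 1 C) * (\<Sum>i\<in>insert i I. Jq q (lf (u i)))"
      using insert by (simp add: distrib_left ennreal_mult mult.assoc)
    finally show "Jq q (lf (\<Sum>i\<in>insert i I. u i)) \<le> ennreal (2 powr q * max 1 C) * (\<Sum>i\<in>insert i I. Jq q (lf (u i)))" .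
  qed simp
qed

lemma stable_op_bound:
  assumes "stable_op S" and q: "q \<ge> 1"
  shows "\<exists>C\<ge>0. \<forall>u. Jq q (lf (S u)) \<le> ennreal C * Jq q (lf u)"
  using assms(1)
proof induction
  case id
  show ?case by (intro exI[of _ 1]) auto
next
  case (scale S c)
  then obtain C where C: "C \<ge> 0" "\<And>u. Jq q (lf (S u)) \<le> ennreal C * Jq q (lf u)" by auto
  show ?case
    using mult_left_mono[OF C(2), of "ennreal (cmod c powr q)"] C(1)
    by (intro exI[of _ "cmod c powr q * C"]) (simp add: Jq_scale[OF q] ennreal_mult mult.assoc del: lf_simps)
next
  case (add S T)
  then obtain C D where C: "C \<ge> 0" "\<And>u. Jq q (lf (S u)) \<le> ennreal C * Jq q (lf u)"
    and D: "D \<ge> 0" "\<And>u. Jq q (lf (T u)) \<le> ennreal D * Jq q (lf u)" by auto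
  show ?case
  proof (intro exI[of _ "2 powr q * (C + D)"] conjI allI)
    fix u
    have "Jq q (lf (S u + T u)) \<le> ennreal (2 powr q) * (ennreal C * Jq q (lf u) + ennreal D * Jq q (lf u))"
      by (rule order_trans[OF Jq_add[OF q]]) (intro mult_left_mono add_mono C D, simp)
    then show "Jq q (lf (S u + T u)) \<le> ennreal (2 powr q * (C + D)) * Jq q (lf u)"
      using C(1) D(1) by (simp add: ennreal_mult ennreal_plus distrib_right mult.assoc)
  qed (use C D in auto)
next
  case (exp l S)
  then obtain C where C: "C \<ge> 0" "\<And>u. Jq q (lf (S u)) \<le> ennreal C * Jq q (lf u)" by auto
  show ?case
  proof (intro exI[of _ "(1 / - Re l) powr q * C"] conjI allI)
    fix u
    show "Jq q (lf (expconv l (S u))) \<le> ennreal ((1 / - Re l) powr q * C) * Jq q (lf u)"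
      using order_trans[OF Jq_expconv[OF exp(1) q] mult_left_mono[OF C(2)]] C(1)
      by (simp add: ennreal_mult mult.assoc)
  qed (use C in auto)
qed

subsection \<open>Operators given by a stable matrix fraction\<close>

definition lfv :: "locfun^'n \<Rightarrow> real \<Rightarrow> complex^'n" where
  "lfv U t = (\<chi> i. lf (U $ i) t)"

lemma lfv_inject: "lfv U = lfv V \<longleftrightarrow> U = V"
proof
  assume "lfv U = lfv V"
  then have "lf (U $ i) t = lf (V $ i) t" for i t
    by (metis lfv_def vec_lambda_beta)
  then show "U = V" by (simp add: vec_eq_iff locfun_eqI)
qed simp

lemma lfv_add: "lfv (U + V) = (\<lambda>t. lfv U t + lfv V t)"
  by (simp add: lfv_def vec_eq_iff fun_eq_iff)

lemma lfv_diff: "lfv (U - V) = (\<lambda>t. lfv U t - lfv V t)"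
  by (simp add: lfv_def vec_eq_iff fun_eq_iff)

lemma lfv_vscale: "lfv (vscale c U) = (\<lambda>t. c *s lfv U t)"
  by (simp add: lfv_def vscale_def vec_eq_iff fun_eq_iff)

lemma lfv_mact_pconst: "lfv (mact (pconst A) U) = (\<lambda>t. A *v lfv U t)"
  by (simp add: lfv_def mact_def pconst_def vec_eq_iff fun_eq_iff matrix_vector_mult_def)

lemma lfv_eq_sum: "lfv U t = (\<Sum>i\<in>UNIV. axis i (lf (U $ i) t))"
  by (simp add: lfv_def vec_eq_iff axis_def if_distrib cong: if_cong)

lemma lfv_measurable [measurable]:
  fixes U :: "locfun^'n"
  shows "lfv U \<in> borel_measurable half_line"
proof -
  have "(\<lambda>z. axis i z :: complex^'n) \<in> borel_measurable borel" for i
    unfolding axis_def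
  proof (intro borel_measurable_continuous_onI continuous_on_vec_lambda)
    show "continuous_on UNIV (\<lambda>z :: complex. if j = i then z else 0)" for j
      by (cases "j = i") (auto intro: continuous_intros)
  qed
  then have "(\<lambda>t. \<Sum>i\<in>UNIV. axis i (lf (U $ i) t)) \<in> borel_measurable half_line"
    by (intro borel_measurable_sum measurable_compose[OF lf_measurable])
  then show ?thesis by (simp add: lfv_eq_sum[abs_def])
qed

lemma norm_vec_powr_le:
  fixes v :: "complex^'n"
  assumes q: "q \<ge> 1"
  shows "norm v powr q \<le> real CARD('n) powr q * (\<Sum>i\<in>UNIV. norm (v $ i) powr q)"
proof -
  have "Max (range (\<lambda>i. norm (v $ i))) \<in> range (\<lambda>i. norm (v $ i))"
    by (rule Max_in) auto
  then obtain k where "Max (range (\<lambda>i. norm (v $ i))) = norm (v $ k)" by (elim imageE) (rule that)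
  then have k: "norm (v $ i) \<le> norm (v $ k)" for i
    using Max_ge[of "range (\<lambda>i. norm (v $ i))" "norm (v $ i)"] by simp
  have "norm v \<le> (\<Sum>i\<in>UNIV. norm (v $ i))"
    unfolding norm_vec_def by (rule L2_set_le_sum) simp
  also have "\<dots> \<le> real CARD('n) * norm (v $ k)"
    using sum_bounded_above[of UNIV "\<lambda>i. norm (v $ i)" "norm (v $ k)"] k by simp
  finally have "norm v powr q \<le> (real CARD('n) * norm (v $ k)) powr q"
    using q by (intro powr_mono2) auto
  also have "\<dots> = real CARD('n) powr q * norm (v $ k) powr q" by (simp add: powr_mult)
  also have "\<dots> \<le> real CARD('n) powr q * (\<Sum>i\<in>UNIV. norm (v $ i) powr q)"
    by (intro mult_left_mono member_le_sum) auto
  finally show ?thesis .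
qed

lemma Jq_component: "q \<ge> 1 \<Longrightarrow> Jq q (lf (U $ i)) \<le> Jq q (lfv U)"
  unfolding Jq_def
  by (intro nn_integral_mono ennreal_leI powr_mono2) (auto simp: lfv_def intro: Finite_Cartesian_Product.norm_nth_le order_trans[OF _ Finite_Cartesian_Product.norm_nth_le])

lemma Jq_lfv_le:
  fixes U :: "locfun^'n"
  assumes q: "q \<ge> 1"
  shows "Jq q (lfv U) \<le> ennreal (real CARD('n) powr q) * (\<Sum>i\<in>UNIV. Jq q (lf (U $ i)))"
proof -
  have "Jq q (lfv U) \<le> (\<integral>\<^sup>+t. ennreal (real CARD('n) powr q) * (\<Sum>i\<in>UNIV. ennreal (norm (lf (U $ i) t) powr q)) \<partial>half_line)"
    unfolding Jq_def
  proof (rule nn_integral_mono)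
    fix t
    have "ennreal (norm (lfv U t) powr q) \<le> ennreal (real CARD('n) powr q * (\<Sum>i\<in>UNIV. norm (lf (U $ i) t) powr q))"
      using norm_vec_powr_le[OF q, of "lfv U t"] by (intro ennreal_leI) (simp add: lfv_def)
    then show "ennreal (norm (lfv U t) powr q) \<le> ennreal (real CARD('n) powr q) * (\<Sum>i\<in>UNIV. ennreal (norm (lf (U $ i) t) powr q))"
      by (simp add: ennreal_mult sum_nonneg)
  qed
  also have "\<dots> = ennreal (real CARD('n) powr q) * (\<Sum>i\<in>UNIV. Jq q (lf (U $ i)))"
    unfolding Jq_def by (subst nn_integral_cmult, measurable) (subst nn_integral_sum, auto)
  finally show ?thesis .
qed

text \<open>The fraction d^-1 Q as an operator. It is characterized by the equation
  \<open>vact d W = mact Q U\<close>, and identities between such fractions are checked after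
  clearing denominators.\<close>

definition stable_mact :: "complex poly \<Rightarrow> complex poly^'n^'m \<Rightarrow> locfun^'n \<Rightarrow> locfun^'m" where
  "stable_mact d Q U = (\<chi> i. stable_inv d (mact Q U $ i))"

lemma vact_stable_mact: "stable d \<Longrightarrow> vact d (stable_mact d Q U) = mact Q U"
  by (simp add: stable_mact_def vact_stable_inv)

lemma stable_mact_unique: "stable d \<Longrightarrow> vact d W = mact Q U \<Longrightarrow> W = stable_mact d Q U"
  by (metis stable_vact_inj vact_stable_mact)

lemma stable_mact_bound:
  fixes Q :: "complex poly^'n^'m"
  assumes d: "stable d" and q: "q \<ge> 1"
  shows "\<exists>C\<ge>0. \<forall>U. Jq q (lfv (stable_mact d Q U)) \<le> ennreal C * Jq q (lfv U)"
proof -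
  obtain D where D: "D \<ge> 0" "\<And>u. Jq q (lf (stable_inv d u)) \<le> ennreal D * Jq q (lf u)"
    using stable_op_bound[OF stable_inv(1)[OF d] q] by blast
  obtain S where S: "S \<ge> 0" "\<And>u :: 'n \<Rightarrow> locfun. Jq q (lf (\<Sum>i\<in>UNIV. u i)) \<le> ennreal S * (\<Sum>i\<in>UNIV. Jq q (lf (u i)))"
    using Jq_sum[OF q, of "UNIV :: 'n set"] by auto
  have "\<forall>i j. \<exists>C\<ge>0. \<forall>u. Jq q (lf (pact (Q $ i $ j) u)) \<le> ennreal C * Jq q (lf u)"
    using stable_op_bound[OF stable_op_pact q] by blast
  then obtain P where P: "\<And>i j. P i j \<ge> 0" "\<And>i j u. Jq q (lf (pact (Q $ i $ j) u)) \<le> ennreal (P i j) * Jq q (lf u)"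
    by metis
  define C where "C = real CARD('m) powr q * (\<Sum>i\<in>UNIV. D * (S * (\<Sum>j\<in>UNIV. P i j)))"
  have "Jq q (lfv (stable_mact d Q U)) \<le> ennreal C * Jq q (lfv U)" for U
  proof -
    have comp: "Jq q (lf (stable_mact d Q U $ i)) \<le> ennreal (D * (S * (\<Sum>j\<in>UNIV. P i j))) * Jq q (lfv U)" for i
    proof -
      have "Jq q (lf (stable_mact d Q U $ i)) \<le> ennreal D * Jq q (lf (\<Sum>j\<in>UNIV. pact (Q $ i $ j) (U $ j)))"
        using D(2) by (simp add: stable_mact_def mact_def del: lf_sum)
      also have "\<dots> \<le> ennreal D * (ennreal S * (\<Sum>j\<in>UNIV. Jq q (lf (pact (Q $ i $ j) (U $ j)))))"
        by (intro mult_left_mono S) simp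
      also have "\<dots> \<le> ennreal D * (ennreal S * (\<Sum>j\<in>UNIV. ennreal (P i j) * Jq q (lfv U)))"
        by (intro mult_left_mono sum_mono order_trans[OF P(2)] Jq_component q) simp_all
      also have "\<dots> = ennreal (D * (S * (\<Sum>j\<in>UNIV. P i j))) * Jq q (lfv U)"
        using D(1) S(1) P(1) by (simp add: ennreal_mult sum_nonneg sum_distrib_right mult.assoc flip: sum_ennreal)
      finally show ?thesis .
    qed
    have "Jq q (lfv (stable_mact d Q U)) \<le> ennreal (real CARD('m) powr q) * (\<Sum>i\<in>UNIV. Jq q (lf (stable_mact d Q U $ i)))"
      by (rule Jq_lfv_le[OF q])
    also have "\<dots> \<le> ennreal (real CARD('m) powr q) * (\<Sum>i\<in>UNIV. ennreal (D * (S * (\<Sum>j\<in>UNIV. P i j))) * Jq q (lfv U))"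
      by (intro mult_left_mono sum_mono comp) simp
    also have "\<dots> = ennreal C * Jq q (lfv U)"
      using D(1) S(1) P(1) by (simp add: C_def ennreal_mult sum_nonneg sum_distrib_right mult.assoc flip: sum_ennreal)
    finally show ?thesis .
  qed
  moreover have "C \<ge> 0" using D(1) S(1) P(1) by (auto simp: C_def intro!: mult_nonneg_nonneg sum_nonneg)
  ultimately show ?thesis by blast
qed

lemma stable_mact_add: "stable d \<Longrightarrow> stable_mact d Q (U + V) = stable_mact d Q U + stable_mact d Q V"
  by (rule stable_mact_unique[symmetric]) (auto simp: vact_add vact_stable_mact mact_vadd)

lemma stable_mact_vscale: "stable d \<Longrightarrow> stable_mact d Q (vscale c U) = vscale c (stable_mact d Q U)"
  by (rule stable_mact_unique[symmetric]) (auto simp: vact_vscale vact_stable_mact mact_vscale)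

section \<open>Transfer to the spaces L_q\<close>

lemma Lq_space_iff:
  "u \<in> Lq_space q \<longleftrightarrow> u \<in> borel_measurable half_line \<and> Jq q u < \<infinity>"
  unfolding Lq_space_def Jq_def by (auto simp: integrable_iff_bounded)

lemma Lq_norm_eq:
  assumes "u \<in> borel_measurable half_line"
  shows "Lq_norm q u = enn2real (Jq q u) powr (1 / q)"
  unfolding Lq_norm_def Jq_def using assms by (subst integral_eq_nn_integral) auto

text \<open>Since q \<ge> 1, |u| \<le> 1 + |u|^q, and this is integrable on bounded parts of the
  half-line. The remaining work concerns time 0, which lies in [0,T] but outside the half-line where
  u is known to be measurable.\<close>

lemma Lq_space_lfv:
  assumes "u \<in> Lq_space q" and q: "q \<ge> 1"
  obtains U where "u = lfv U"
proof -
  have um [measurable]: "u \<in> borel_measurable half_line" and ui: "integrable half_line (\<lambda>t. norm (u t) powr q)"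
    using assms by (auto simp: Lq_space_def)
  have "\<forall>T. set_integrable lborel {0..T} (\<lambda>t. u t $ i)" for i
  proof
    fix T :: real
    have nth: "(\<lambda>v :: complex^'a. v $ i) \<in> borel_measurable borel"
      by (intro borel_measurable_continuous_onI continuous_intros)
    have "(\<lambda>t. u t $ i) \<in> borel_measurable half_line"
      using measurable_compose[OF um nth] .
    then have m: "(\<lambda>t. indicator {0<..} t *\<^sub>R (u t $ i)) \<in> borel_measurable borel"
      by (subst (asm) borel_measurable_restrict_space_iff) simp_all
    have "set_integrable lborel {0<..} (\<lambda>t. norm (u t) powr q)"
      using ui by (subst (asm) integrable_restrict_space) (auto simp: set_integrable_def)
    then have b: "integrable lborel (\<lambda>t. indicator {0..T} t + indicator {0<..} t *\<^sub>R norm (u t) powr q)"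
      by (auto simp: set_integrable_def emeasure_lborel_Icc_eq intro!: Bochner_Integration.integrable_add)
    have m2: "(\<lambda>t. indicator {0<..T} t *\<^sub>R (u t $ i)) \<in> borel_measurable borel"
    proof -
      have "(\<lambda>t. indicator {..T} t *\<^sub>R (indicator {0<..} t *\<^sub>R (u t $ i))) \<in> borel_measurable borel"
        using m by measurable
      also have "(\<lambda>t. indicator {..T} t *\<^sub>R (indicator {0<..} t *\<^sub>R (u t $ i))) = (\<lambda>t. indicator {0<..T} t *\<^sub>R (u t $ i))"
        by (auto simp: fun_eq_iff indicator_def)
      finally show ?thesis .
    qed
    have le: "norm (indicator {0<..T} t *\<^sub>R (u t $ i)) \<le> norm (indicator {0..T} t + indicator {0<..} t *\<^sub>R norm (u t) powr q)" for t
    proof (cases "t \<in> {0<..T}")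
      case True
      have "norm (u t $ i) \<le> norm (u t)" by (rule Finite_Cartesian_Product.norm_nth_le)
      also have "\<dots> \<le> 1 + norm (u t) powr q"
      proof (cases "norm (u t) \<le> 1")
        case False
        then have "norm (u t) powr 1 \<le> norm (u t) powr q" using q by (intro powr_mono) auto
        then show ?thesis using False by simp
      qed (simp add: add_increasing2)
      finally show ?thesis using True by (simp add: indicator_def)
    qed simp
    have "integrable lborel (\<lambda>t. indicator {0<..T} t *\<^sub>R (u t $ i))"
      by (rule Bochner_Integration.integrable_bound[OF b]) (use m2 le in auto)
    moreover have "AE t in lborel. indicator {0<..T} t *\<^sub>R (u t $ i) = indicator {0..T} t *\<^sub>R (u t $ i)"
      using AE_lborel_singleton[of 0] by eventually_elim (auto simp: indicator_def)
    moreover have "(\<lambda>t. indicator {0..T} t *\<^sub>R (u t $ i)) \<in> borel_measurable borel"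
    proof -
      \<comment> \<open>Adding the value at the single time 0 back in keeps the function
        measurable.\<close>
      have "(\<lambda>t. indicator {0<..T} t *\<^sub>R (u t $ i) + indicator ({0} \<inter> {0..T}) t *\<^sub>R (u 0 $ i)) \<in> borel_measurable borel"
        using m2 by measurable
      also have "(\<lambda>t. indicator {0<..T} t *\<^sub>R (u t $ i) + indicator ({0} \<inter> {0..T}) t *\<^sub>R (u 0 $ i)) = (\<lambda>t. indicator {0..T} t *\<^sub>R (u t $ i))"
        by (auto simp: fun_eq_iff indicator_def)
      finally show ?thesis .
    qed
    ultimately show "set_integrable lborel {0..T} (\<lambda>t. u t $ i)"
      unfolding set_integrable_def by (subst integrable_cong_AE) (auto elim: eventually_mono)
  qed
  then have "u = lfv (\<chi> i. Lf (\<lambda>t. u t $ i))"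
    by (simp add: lfv_def fun_eq_iff vec_eq_iff Lf_inverse)
  then show ?thesis by (rule that)
qed

lemma ae_eq_iff_Jq:
  assumes "q \<ge> 1"
  shows "ae_eq (lfv U) (lfv V) \<longleftrightarrow> Jq q (lfv (U - V)) = 0"
proof -
  have "Jq q (lfv (U - V)) = 0 \<longleftrightarrow> (AE t in half_line. ennreal (norm (lfv (U - V) t) powr q) = 0)"
    unfolding Jq_def by (rule nn_integral_0_iff_AE) measurable
  also have "\<dots> \<longleftrightarrow> ae_eq (lfv U) (lfv V)"
    unfolding ae_eq_def using assms by (intro AE_cong) (simp add: lfv_diff)
  finally show ?thesis by simp
qed

text \<open>Equality is demanded for all locally integrable inputs and at every time, so
  compositions need no membership check. Inputs not of the form \<open>lfv U\<close> are
  unconstrained; for q \<ge> 1 every member of L_q has that form.\<close>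

definition fraction_op :: "((real \<Rightarrow> complex^'n) \<Rightarrow> (real \<Rightarrow> complex^'m)) \<Rightarrow> complex poly \<Rightarrow> complex poly^'n^'m \<Rightarrow> bool" where
  "fraction_op T d Q \<longleftrightarrow> stable d \<and> (\<forall>U. T (lfv U) = lfv (stable_mact d Q U))"

lemma ae_eq_refl [simp]: "ae_eq u u" by (simp add: ae_eq_def)

lemma fraction_op_bounded:
  fixes T :: "(real \<Rightarrow> complex^'n) \<Rightarrow> (real \<Rightarrow> complex^'n)"
  assumes T: "fraction_op T d Q" and q: "q \<ge> 1"
  shows "Lq_bounded_operator q T"
proof -
  have d: "stable d" and TU: "\<And>U. T (lfv U) = lfv (stable_mact d Q U)"
    using T by (auto simp: fraction_op_def)
  obtain C where C: "C \<ge> 0" "\<And>U. Jq q (lfv (stable_mact d Q U)) \<le> ennreal C * Jq q (lfv U)"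
    using stable_mact_bound[OF d q] by blast
  have 1: "T u \<in> Lq_space q" if u: "u \<in> Lq_space q" for u
  proof -
    obtain U where "u = lfv U" by (rule Lq_space_lfv[OF u q])
    then show ?thesis using u order_le_less_trans[OF C(2)[of U]]
      by (simp add: Lq_space_iff TU ennreal_mult_less_top)
  qed
  \<comment> \<open>By additivity the difference of the images is the image of the difference, and
    the bound sends \<open>Jq\<close> zero to \<open>Jq\<close> zero.\<close>
  have 2: "ae_eq (T u) (T v)" if uv: "u \<in> Lq_space q" "v \<in> Lq_space q" and ae: "ae_eq u v" for u v
  proof -
    obtain U where U: "u = lfv U" by (rule Lq_space_lfv[OF uv(1) q])
    obtain V where V: "v = lfv V" by (rule Lq_space_lfv[OF uv(2) q])
    have "stable_mact d Q U - stable_mact d Q V = stable_mact d Q (U - V)"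
      using stable_mact_add[OF d, of Q "U - V" V] by (simp add: diff_eq_eq)
    then show ?thesis using ae C(2)[of "U - V"] by (simp add: U V TU ae_eq_iff_Jq[OF q])
  qed
  have 3: "T (\<lambda>t. u t + v t) = (\<lambda>t. T u t + T v t)" if uv: "u \<in> Lq_space q" "v \<in> Lq_space q" for u v
  proof -
    obtain U where U: "u = lfv U" by (rule Lq_space_lfv[OF uv(1) q])
    obtain V where V: "v = lfv V" by (rule Lq_space_lfv[OF uv(2) q])
    show ?thesis unfolding U V lfv_add[symmetric] TU stable_mact_add[OF d] by (rule refl)
  qed
  have 4: "T (\<lambda>t. c *s u t) = (\<lambda>t. c *s T u t)" if u: "u \<in> Lq_space q" for u c
  proof -
    obtain U where U: "u = lfv U" by (rule Lq_space_lfv[OF u q])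
    show ?thesis unfolding U lfv_vscale[symmetric] TU stable_mact_vscale[OF d] by (rule refl)
  qed
  have 5: "Lq_norm q (T u) \<le> C powr (1 / q) * Lq_norm q u" if u: "u \<in> Lq_space q" for u
  proof -
    obtain U where U: "u = lfv U" by (rule Lq_space_lfv[OF u q])
    have fin: "Jq q (lfv U) < \<infinity>" using u by (simp add: U Lq_space_iff)
    have "enn2real (Jq q (lfv (stable_mact d Q U))) \<le> enn2real (ennreal C * Jq q (lfv U))"
      using fin by (intro enn2real_mono C) (simp add: ennreal_mult_less_top)
    also have "\<dots> = C * enn2real (Jq q (lfv U))" using C(1) by (simp add: enn2real_mult)
    finally have "enn2real (Jq q (lfv (stable_mact d Q U))) powr (1 / q) \<le> (C * enn2real (Jq q (lfv U))) powr (1 / q)"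
      using q by (intro powr_mono2) auto
    then show ?thesis using C(1) by (simp add: U TU Lq_norm_eq powr_mult)
  qed
  show ?thesis unfolding Lq_bounded_operator_def
    using 1 2 by (intro conjI exI[of _ "C powr (1 / q)"]) (auto simp: 3 4 5)
qed

section \<open>Eigenvalues, determinants and inverses of complex matrices\<close>

lemma mat_mult_comm: "(A :: complex^'n^'m) ** mat c = mat c ** A"
  by (simp add: vec_eq_iff matrix_matrix_mult_def mat_def mult_delta_left mult_delta_right mult.commute)

lemma mat_mult_mat: "(mat a :: complex^'n^'n) ** mat b = mat (a * b)"
  by (simp add: vec_eq_iff matrix_matrix_mult_def mat_def mult_delta_left mult_delta_right)

lemma mat_vector_mult: "(mat c :: complex^'n^'n) *v v = c *s v"
  by (simp add: vec_eq_iff matrix_vector_mult_def mat_def mult_delta_left mult_delta_right)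

lemma det_zero_iff_ker: "det (A :: complex^'n^'n) = 0 \<longleftrightarrow> (\<exists>v. v \<noteq> 0 \<and> A *v v = 0)"
  using invertible_det_nz[of A] invertible_left_inverse[of A] matrix_left_invertible_ker[of A] by blast

lemma eigenvalues_iff_det: "\<mu> \<in> eigenvalues A \<longleftrightarrow> det (mat \<mu> - A) = 0"
proof -
  have "(mat \<mu> - A) *v v = 0 \<longleftrightarrow> A *v v = \<mu> *s v" for v
    by (auto simp: matrix_vector_mult_diff_rdistrib mat_vector_mult)
  then show ?thesis by (auto simp: eigenvalues_def det_zero_iff_ker)
qed

lemma matrix_inv_mult:
  assumes "det (A :: complex^'n^'n) \<noteq> 0"
  shows "A ** matrix_inv A = mat 1" "matrix_inv A ** A = mat 1"
  using someI_ex[of "\<lambda>A'. A ** A' = mat 1 \<and> A' ** A = mat 1"] assms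
  by (auto simp: matrix_inv_def invertible_def simp flip: invertible_det_nz)

subsection \<open>Symbols\<close>

definition disc_point :: "complex \<Rightarrow> complex" where "disc_point z = 1 / (z + 1)"

text \<open>\<open>T\<close> is a stable fraction with symbol \<open>F\<close>. The symbol equation
  is multiplied by the denominator, so \<open>F\<close> can be kept in its given form; since
  \<open>d\<close> has no zero in the disc, the equation still determines
  \<open>F z\<close>.\<close>

definition realizes :: "((real \<Rightarrow> complex^'n) \<Rightarrow> (real \<Rightarrow> complex^'m)) \<Rightarrow> (complex \<Rightarrow> complex^'n^'m) \<Rightarrow> bool" where
  "realizes T F \<longleftrightarrow> (\<exists>d Q. fraction_op T d Q \<and>
     (\<forall>z. Re z \<ge> 0 \<longrightarrow> mat (poly d (disc_point z)) ** F z = peval (disc_point z) Q))"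

lemma realizes_const: "realizes (\<lambda>u t. A *v u t) (\<lambda>z. A)"
  unfolding realizes_def
proof (rule exI[of _ 1], rule exI[of _ "pconst A"], intro conjI allI impI)
  show "fraction_op (\<lambda>u t. A *v u t) 1 (pconst A)"
    unfolding fraction_op_def
  proof (intro conjI allI)
    fix U
    have "mact (pconst A) U = stable_mact 1 (pconst A) U"
      by (rule stable_mact_unique) (simp_all add: stable_1 vact_1)
    then show "(\<lambda>t. A *v lfv U t) = lfv (stable_mact 1 (pconst A) U)"
      by (simp flip: lfv_mact_pconst)
  qed (rule stable_1)
qed (simp add: peval_simps)

lemma realizes_id: "realizes (\<lambda>u. u) (\<lambda>z. mat 1)"
  using realizes_const[of "mat 1"] by simp

lemma realizes_add:
  assumes "realizes T F" "realizes S G"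
  shows "realizes (\<lambda>u t. T u t + S u t) (\<lambda>z. F z + G z)"
proof -
  obtain d Q where T: "fraction_op T d Q" and F: "\<And>z. Re z \<ge> 0 \<Longrightarrow> mat (poly d (disc_point z)) ** F z = peval (disc_point z) Q"
    using assms(1) unfolding realizes_def by blast
  obtain d' Q' where S: "fraction_op S d' Q'" and G: "\<And>z. Re z \<ge> 0 \<Longrightarrow> mat (poly d' (disc_point z)) ** G z = peval (disc_point z) Q'"
    using assms(2) unfolding realizes_def by blast
  have st: "stable d" "stable d'" "stable (d * d')" using T S by (auto simp: fraction_op_def stable_mult)
  show ?thesis unfolding realizes_def
  proof (intro exI[of _ "d * d'"] exI[of _ "pmul d' Q + pmul d Q'"] conjI allI impI)
    show "fraction_op (\<lambda>u t. T u t + S u t) (d * d') (pmul d' Q + pmul d Q')"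
      unfolding fraction_op_def
    proof (intro conjI allI)
      fix U
      have "stable_mact d Q U + stable_mact d' Q' U = stable_mact (d * d') (pmul d' Q + pmul d Q') U"
      proof (rule stable_mact_unique[OF st(3)])
        have "vact (d * d') (stable_mact d Q U) = vact d' (mact Q U)"
          unfolding mult.commute[of d] vact_mult vact_stable_mact[OF st(1)] ..
        moreover have "vact (d * d') (stable_mact d' Q' U) = vact d (mact Q' U)"
          unfolding vact_mult vact_stable_mact[OF st(2)] ..
        ultimately show "vact (d * d') (stable_mact d Q U + stable_mact d' Q' U) = mact (pmul d' Q + pmul d Q') U"
          by (simp add: vact_add mact_add mact_pmul)
      qed
      then show "(\<lambda>t. T (lfv U) t + S (lfv U) t) = lfv (stable_mact (d * d') (pmul d' Q + pmul d Q') U)"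
        using T S by (simp add: fraction_op_def flip: lfv_add)
    qed (rule st(3))
  next
    fix z :: complex assume z: "Re z \<ge> 0"
    have "mat (poly (d * d') (disc_point z)) ** (F z + G z) =
      mat (poly d' (disc_point z)) ** (mat (poly d (disc_point z)) ** F z) + mat (poly d (disc_point z)) ** (mat (poly d' (disc_point z)) ** G z)"
      by (simp add: matrix_add_ldistrib matrix_mul_assoc mat_mult_mat mult.commute)
    then show "mat (poly (d * d') (disc_point z)) ** (F z + G z) = peval (disc_point z) (pmul d' Q + pmul d Q')"
      by (simp add: F[OF z] G[OF z] peval_simps)
  qed
qed

text \<open>The product of the denominators serves because each is scalar: the inner one is moved
  through the outer numerator before it is cleared.\<close>

lemma realizes_comp:
  fixes T :: "(real \<Rightarrow> complex^'n) \<Rightarrow> (real \<Rightarrow> complex^'m)" and S :: "(real \<Rightarrow> complex^'k) \<Rightarrow> (real \<Rightarrow> complex^'n)"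
  assumes "realizes T F" "realizes S G"
  shows "realizes (\<lambda>u. T (S u)) (\<lambda>z. F z ** G z)"
proof -
  obtain d Q where T: "fraction_op T d Q" and F: "\<And>z. Re z \<ge> 0 \<Longrightarrow> mat (poly d (disc_point z)) ** F z = peval (disc_point z) Q"
    using assms(1) unfolding realizes_def by blast
  obtain d' Q' where S: "fraction_op S d' Q'" and G: "\<And>z. Re z \<ge> 0 \<Longrightarrow> mat (poly d' (disc_point z)) ** G z = peval (disc_point z) Q'"
    using assms(2) unfolding realizes_def by blast
  have st: "stable d" "stable d'" "stable (d * d')" using T S by (auto simp: fraction_op_def stable_mult)
  show ?thesis unfolding realizes_def
  proof (intro exI[of _ "d * d'"] exI[of _ "Q ** Q'"] conjI allI impI)
    show "fraction_op (\<lambda>u. T (S u)) (d * d') (Q ** Q')"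
      unfolding fraction_op_def
    proof (intro conjI allI)
      fix U
      have "stable_mact d Q (stable_mact d' Q' U) = stable_mact (d * d') (Q ** Q') U"
      proof (rule stable_mact_unique[OF st(3)])
        have "vact (d * d') (stable_mact d Q (stable_mact d' Q' U)) = vact d' (mact Q (stable_mact d' Q' U))"
          unfolding mult.commute[of d] vact_mult vact_stable_mact[OF st(1)] ..
        also have "\<dots> = mact Q (vact d' (stable_mact d' Q' U))" by (simp add: mact_vact)
        also have "\<dots> = mact (Q ** Q') U" by (simp add: vact_stable_mact[OF st(2)] mact_mult)
        finally show "vact (d * d') (stable_mact d Q (stable_mact d' Q' U)) = mact (Q ** Q') U" .
      qed
      then show "T (S (lfv U)) = lfv (stable_mact (d * d') (Q ** Q') U)"
        using T S by (simp add: fraction_op_def)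
    qed (rule st(3))
  next
    fix z :: complex assume z: "Re z \<ge> 0"
    have "mat (poly (d * d') (disc_point z)) ** (F z ** G z) = (mat (poly d (disc_point z)) ** (mat (poly d' (disc_point z)) ** F z)) ** G z"
      by (simp add: matrix_mul_assoc mat_mult_mat)
    also have "\<dots> = (mat (poly d (disc_point z)) ** (F z ** mat (poly d' (disc_point z)))) ** G z"
      by (simp add: mat_mult_comm)
    also have "\<dots> = (mat (poly d (disc_point z)) ** F z) ** (mat (poly d' (disc_point z)) ** G z)"
      by (simp add: matrix_mul_assoc)
    finally show "mat (poly (d * d') (disc_point z)) ** (F z ** G z) = peval (disc_point z) (Q ** Q')"
      by (simp add: F[OF z] G[OF z] peval_mult)
  qed
qed

lemma realizes_power:
  assumes "realizes T F"
  shows "realizes (T ^^ k) (\<lambda>z. matrix_power (F z) k)"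
proof (induction k)
  case 0
  have "realizes (\<lambda>u. u) (\<lambda>z. mat 1)" by (rule realizes_id)
  then show ?case by (simp add: matrix_power_def id_def)
next
  case (Suc k)
  show ?case using realizes_comp[OF assms Suc] by (simp add: matrix_power_def comp_def)
qed

lemma scaleR_eq_mat: "(c *\<^sub>R (v :: complex^'n)) = mat (complex_of_real c) *v v"
  by (simp add: mat_vector_mult vec_eq_iff scaleR_conv_of_real[where 'a=complex])

lemma scaleR_matrix_eq_mat: "(c *\<^sub>R (A :: complex^'n^'m)) = mat (complex_of_real c) ** A"
  by (simp add: vec_eq_iff matrix_matrix_mult_def mat_def mult_delta_left mult_delta_right scaleR_conv_of_real[where 'a=complex])

lemma realizes_scaleR:
  assumes "realizes T F"
  shows "realizes (\<lambda>u t. c *\<^sub>R T u t) (\<lambda>z. c *\<^sub>R F z)"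
  using realizes_comp[OF realizes_const[of "mat (complex_of_real c)"] assms]
  by (simp add: scaleR_eq_mat scaleR_matrix_eq_mat)

lemma realizes_const_comp: "realizes T F \<Longrightarrow> realizes (\<lambda>u t. A *v T u t) (\<lambda>z. A ** F z)"
  using realizes_comp[OF realizes_const[of A], of T F] by simp

subsection \<open>Convolution with a matrix exponential\<close>

text \<open>Taylor coefficients of one entry of exp(z M). Working entrywise turns the matrix
  exponential into scalar power series that can be differentiated term by term.\<close>

definition exp_entry :: "complex^'n^'n \<Rightarrow> 'n \<Rightarrow> 'n \<Rightarrow> nat \<Rightarrow> complex" where
  "exp_entry M i j k = matrix_power M k $ i $ j / fact k"

lemma matrix_power_Suc: "matrix_power M (Suc k) = M ** matrix_power M k"
  by (simp add: matrix_power_def)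

lemma matrix_power_0: "matrix_power M 0 = mat 1"
  by (simp add: matrix_power_def)

lemma matrix_power_scale: "matrix_power (c *\<^sub>R M) k = (c ^ k) *\<^sub>R matrix_power M k"
proof (induction k)
  case (Suc k)
  have "(c *\<^sub>R M) ** (c ^ k *\<^sub>R matrix_power M k) = c ^ Suc k *\<^sub>R (M ** matrix_power M k)"
    by (simp add: vec_eq_iff matrix_matrix_mult_def scaleR_sum_right algebra_simps)
  then show ?case by (simp add: matrix_power_Suc Suc)
qed (simp add: matrix_power_0)

lemma matrix_power_entry_le:
  "norm (matrix_power M k $ i $ j) \<le> (\<Sum>i\<in>UNIV. \<Sum>l\<in>UNIV. norm (M $ i $ l)) ^ k" (is "_ \<le> ?a ^ k")
proof (induction k arbitrary: i j)
  case 0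
  then show ?case by (simp add: matrix_power_0 mat_def)
next
  case (Suc k)
  have "norm (matrix_power M (Suc k) $ i $ j) \<le> (\<Sum>l\<in>UNIV. norm (M $ i $ l) * norm (matrix_power M k $ l $ j))"
    unfolding matrix_power_Suc matrix_matrix_mult_def by (simp add: norm_mult[symmetric] norm_sum)
  also have "\<dots> \<le> (\<Sum>l\<in>UNIV. norm (M $ i $ l) * ?a ^ k)"
    by (intro sum_mono mult_left_mono Suc) simp
  also have "\<dots> = (\<Sum>l\<in>UNIV. norm (M $ i $ l)) * ?a ^ k" by (simp add: sum_distrib_right)
  also have "\<dots> \<le> ?a * ?a ^ k"
    by (intro mult_right_mono member_le_sum[of i UNIV "\<lambda>i. \<Sum>l\<in>UNIV. norm (M $ i $ l)"]) (auto simp: sum_nonneg)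
  finally show ?case by simp
qed

lemma exp_entry_summable: "summable (\<lambda>k. exp_entry M i j k * z ^ k)"
proof (rule summable_comparison_test')
  define a where "a = (\<Sum>i\<in>UNIV. \<Sum>l\<in>UNIV. norm (M $ i $ l))"
  show "summable (\<lambda>k. (a * norm z) ^ k / fact k)"
    using summable_exp_generic[of "a * norm z"] by (simp add: scaleR_conv_of_real field_simps)
  show "norm (exp_entry M i j k * z ^ k) \<le> (a * norm z) ^ k / fact k" for k
    using mult_right_mono[OF matrix_power_entry_le[of M k i j], of "norm z ^ k / fact k"]
    by (simp add: exp_entry_def norm_mult norm_divide norm_power a_def power_mult_distrib)
qed

definition exp_series :: "complex^'n^'n \<Rightarrow> 'n \<Rightarrow> 'n \<Rightarrow> complex \<Rightarrow> complex" where
  "exp_series M i j z = (\<Sum>k. exp_entry M i j k * z ^ k)"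

text \<open>Convergence of matrices is convergence of entries; with summability of the scalar series
  this identifies the limit that \<open>matrix_exp\<close> denotes.\<close>

lemma matrix_exp_entry:
  "matrix_exp (- t *\<^sub>R M) = (\<chi> i j. exp_series M i j (complex_of_real (- t)))"
proof -
  have "(\<lambda>k. (1 / fact k) *\<^sub>R matrix_power (- t *\<^sub>R M) k) sums (\<chi> i j. exp_series M i j (complex_of_real (- t)))"
    unfolding sums_def
  proof (intro vec_tendstoI)
    fix i j
    have "(\<lambda>k. exp_entry M i j k * complex_of_real (- t) ^ k) sums exp_series M i j (complex_of_real (- t))"
      unfolding exp_series_def by (rule summable_sums[OF exp_entry_summable])
    moreover have "((1 / fact k) *\<^sub>R matrix_power (- t *\<^sub>R M) k) $ i $ j = exp_entry M i j k * complex_of_real (- t) ^ k" for k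
      by (subst matrix_power_scale) (simp add: exp_entry_def scaleR_conv_of_real[where 'a=complex])
    ultimately show "(\<lambda>n. (\<Sum>k<n. (1 / fact k) *\<^sub>R matrix_power (- t *\<^sub>R M) k) $ i $ j)
        \<longlonglongrightarrow> (\<chi> i j. exp_series M i j (complex_of_real (- t))) $ i $ j"
      by (simp add: sums_def sum_component)
  qed
  then show ?thesis unfolding matrix_exp_def by (rule sums_unique[symmetric])
qed

lemma exp_series_0: "exp_series M i j 0 = mat 1 $ i $ j"
  unfolding exp_series_def powser_zero by (simp add: exp_entry_def matrix_power_0)

lemma exp_series_deriv:
  "(exp_series M i j has_field_derivative (\<Sum>l\<in>UNIV. M $ i $ l * exp_series M l j z)) (at z)"
proof -
  \<comment> \<open>The factor k + 1 cancels in the factorial, leaving the entry of M M^k / k!; this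
    is the equation (exp(z M))' = M exp(z M).\<close>
  have "diffs (exp_entry M i j) k * z ^ k = (\<Sum>l\<in>UNIV. M $ i $ l * (exp_entry M l j k * z ^ k))" for k
  proof -
    have "diffs (exp_entry M i j) k = matrix_power M (Suc k) $ i $ j / fact k"
      unfolding diffs_def exp_entry_def fact_Suc by (simp del: of_nat_Suc)
    also have "\<dots> = (\<Sum>l\<in>UNIV. M $ i $ l * exp_entry M l j k)"
      by (simp add: matrix_power_Suc matrix_matrix_mult_def exp_entry_def sum_divide_distrib)
    finally show ?thesis by (simp add: sum_distrib_right mult.assoc)
  qed
  then have "(\<Sum>k. diffs (exp_entry M i j) k * z ^ k) = (\<Sum>l\<in>UNIV. M $ i $ l * exp_series M l j z)"
    by (simp add: exp_series_def suminf_sum suminf_mult exp_entry_summable summable_mult)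
  then show ?thesis
    using termdiffs_strong_converges_everywhere[OF exp_entry_summable[of M i j], of z]
    by (simp add: exp_series_def[abs_def])
qed

definition exp_fun :: "complex^'n^'n \<Rightarrow> 'n \<Rightarrow> 'n \<Rightarrow> real \<Rightarrow> complex" where
  "exp_fun M i j t = exp_series M i j (complex_of_real (- t))"

lemma exp_fun_deriv:
  "(exp_fun M i j has_vector_derivative - (\<Sum>l\<in>UNIV. M $ i $ l * exp_fun M l j t)) (at t)"
proof -
  have "((\<lambda>z. exp_series M i j (- z)) has_field_derivative (\<Sum>l\<in>UNIV. M $ i $ l * exp_series M l j (- complex_of_real t)) * (- 1)) (at (complex_of_real t))"
    by (rule DERIV_chain2[OF exp_series_deriv]) (auto intro!: derivative_eq_intros)
  from has_vector_derivative_real_field[OF this] show ?thesis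
    by (simp add: exp_fun_def[abs_def])
qed

lemma exp_fun_cont: "continuous_on UNIV (exp_fun M i j)"
  by (meson continuous_at_imp_continuous_on exp_fun_deriv has_vector_derivative_continuous)

text \<open>Coordinates may be taken under the vector-valued integral only once its integrand is
  known to be integrable.\<close>

lemma convolution_component:
  assumes k: "\<And>i j. continuous_on UNIV (\<lambda>t. k t $ i $ j)"
  shows "convolution k (lfv U) = lfv (\<chi> i. \<Sum>j\<in>UNIV. lconv (\<lambda>t. k t $ i $ j) (U $ j))"
proof (intro ext, subst vec_eq_iff, intro allI)
  fix t i
  have int: "set_integrable lborel {0..t} (\<lambda>s. k (t - s) $ i $ j * lf (U $ j) s)" for i j
    using set_integrable_conv[OF k] .
  \<comment> \<open>Assembling the integrand from its coordinates along the axes transfers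
    integrability from the scalar convolutions to the vector function.\<close>
  have eq: "(\<lambda>s. indicator {0..t} s *\<^sub>R (k (t - s) *v lfv U s)) = (\<lambda>s. \<Sum>i\<in>UNIV. axis i (\<Sum>j\<in>UNIV. indicator {0..t} s *\<^sub>R (k (t - s) $ i $ j * lf (U $ j) s)))"
  proof
    fix s show "indicator {0..t} s *\<^sub>R (k (t - s) *v lfv U s) = (\<Sum>i\<in>UNIV. axis i (\<Sum>j\<in>UNIV. indicator {0..t} s *\<^sub>R (k (t - s) $ i $ j * lf (U $ j) s)))"
      by (cases "s \<in> {0..t}") (simp_all add: vec_eq_iff axis_def matrix_vector_mult_def lfv_def)
  qed
  have bl: "bounded_linear (\<lambda>z :: complex. axis i z :: complex^'c)" for i
    by (intro linear_conv_bounded_linear[THEN iffD1] linearI) (auto simp: vec_eq_iff axis_def)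
  have vi: "integrable lborel (\<lambda>s. indicator {0..t} s *\<^sub>R (k (t - s) *v lfv U s))"
    unfolding eq by (intro Bochner_Integration.integrable_sum integrable_bounded_linear[OF bl])
      (use int in \<open>simp add: set_integrable_def\<close>)
  have "convolution k (lfv U) t $ i = (LINT s|lborel. (indicator {0..t} s *\<^sub>R (k (t - s) *v lfv U s)) $ i)"
    unfolding convolution_def set_lebesgue_integral_def
    by (rule integral_bounded_linear[symmetric, OF bounded_linear_vec_nth vi])
  also have "\<dots> = (LINT s|lborel. (\<Sum>j\<in>UNIV. indicator {0..t} s *\<^sub>R (k (t - s) $ i $ j * lf (U $ j) s)))"
    by (simp add: matrix_vector_mult_def lfv_def scaleR_sum_right)
  also have "\<dots> = (\<Sum>j\<in>UNIV. (LINT s|lborel. indicator {0..t} s *\<^sub>R (k (t - s) $ i $ j * lf (U $ j) s)))"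
    by (rule Bochner_Integration.integral_sum) (use int in \<open>auto simp: set_integrable_def\<close>)
  also have "\<dots> = lfv (\<chi> i. \<Sum>j\<in>UNIV. lconv (\<lambda>t. k t $ i $ j) (U $ j)) t $ i"
    by (simp add: lfv_def lf_lconv[OF k] set_lebesgue_integral_def)
  finally show "convolution k (lfv U) t $ i = lfv (\<chi> i. \<Sum>j\<in>UNIV. lconv (\<lambda>t. k t $ i $ j) (U $ j)) t $ i" .
qed

section \<open>The half-plane in the disc coordinate and matrix resolvents\<close>

lemma disc_point_simps:
  assumes "Re z \<ge> 0"
  shows "disc_point z \<noteq> 0" "disc_point z * (z + 1) = 1" "disc_point z \<in> spec_disc"
proof -
  have "z + 1 \<noteq> 0" using assms by (auto simp: complex_eq_iff)
  then show "disc_point z \<noteq> 0" "disc_point z * (z + 1) = 1" by (auto simp: disc_point_def)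
  then show "disc_point z \<in> spec_disc" using assms spec_disc_inverse_iff[of "disc_point z"] by (simp add: disc_point_def)
qed

lemma disc_point_onto:
  assumes "e \<in> spec_disc" "e \<noteq> 0"
  shows "Re (1 / e - 1) \<ge> 0" "disc_point (1 / e - 1) = e"
  using assms spec_disc_inverse_iff[of e] by (auto simp: disc_point_def)

lemma realizes_cong: "realizes T F \<Longrightarrow> (\<And>z. Re z \<ge> 0 \<Longrightarrow> F z = G z) \<Longrightarrow> realizes T G"
  unfolding realizes_def by metis

lemma realizes_op_cong: "realizes T F \<Longrightarrow> (\<And>U. S (lfv U) = T (lfv U)) \<Longrightarrow> realizes S F"
  unfolding realizes_def fraction_op_def by simp

text \<open>With e = 1/(z + 1), the matrix e (z I + M) equals I - e (I - M): the inverse of the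
  resolvent, rescaled to be polynomial in e and equal to I at infinity.\<close>

definition resolvent_poly :: "complex^'n^'n \<Rightarrow> complex poly^'n^'n" where
  "resolvent_poly M = mat 1 - pmul [:0, 1:] (pconst (mat 1 - M))"

lemma peval_resolvent_poly: "peval e (resolvent_poly M) = mat 1 - mat e ** (mat 1 - M)"
  by (simp add: resolvent_poly_def peval_simps peval_mat)

lemma det_pos_shift:
  assumes "\<forall>\<mu>\<in>eigenvalues M. Re \<mu> > 0" "Re z \<ge> 0"
  shows "det (mat z + M) \<noteq> 0"
proof
  assume "det (mat z + M) = 0"
  then obtain v where v: "v \<noteq> 0" "(mat z + M) *v v = 0" by (auto simp: det_zero_iff_ker)
  then have "M *v v = (- z) *s v"
    by (simp add: matrix_vector_mult_add_rdistrib mat_vector_mult add_eq_0_iff)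
  then have "- z \<in> eigenvalues M" using v(1) by (auto simp: eigenvalues_def)
  then show False using assms by force
qed

lemma peval_resolvent_poly_disc_point:
  fixes M :: "complex^'n^'n"
  assumes "Re z \<ge> 0"
  shows "peval (disc_point z) (resolvent_poly M) = mat (disc_point z) ** (mat z + M)"
proof -
  have "(mat 1 :: complex^'n^'n) = mat (disc_point z) ** mat (z + 1)"
    using disc_point_simps[OF assms] by (simp add: mat_mult_mat)
  then have "peval (disc_point z) (resolvent_poly M) = mat (disc_point z) ** mat (z + 1) - mat (disc_point z) ** (mat 1 - M)"
    by (simp only: peval_resolvent_poly)
  also have "\<dots> = mat (disc_point z) ** (mat (z + 1) - (mat 1 - M))"
    by (simp add: vec_eq_iff matrix_matrix_mult_def sum_subtractf sum.distrib algebra_simps)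
  also have "mat (z + 1) - (mat 1 - M) = mat z + M"
    by (simp add: vec_eq_iff mat_def)
  finally show ?thesis .
qed

lemma det_mat_mult: "det (mat c ** A) = c ^ CARD('n) * det (A :: complex^'n^'n)"
  by (simp add: det_mul det_diagonal mat_def)

text \<open>At e = 0 the determinant is 1. At any other point of the disc it is a power of e times
  det(z I + M), and - z is no eigenvalue because Re z \<ge> 0.\<close>

lemma stable_resolvent_poly:
  assumes M: "\<forall>\<mu>\<in>eigenvalues M. Re \<mu> > 0"
  shows "stable (det (resolvent_poly M))"
  unfolding stable_def
proof
  fix e assume e: "e \<in> spec_disc"
  show "poly (det (resolvent_poly M)) e \<noteq> 0"
  proof (cases "e = 0")
    case True
    have "mat 0 ** A = 0" for A :: "complex^'n^'n" by (simp add: vec_eq_iff matrix_matrix_mult_def mat_def)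
    then show ?thesis using True by (simp add: poly_det peval_resolvent_poly)
  next
    case False
    then show ?thesis
      using disc_point_onto[OF e False] det_pos_shift[OF M, of "1 / e - 1"] peval_resolvent_poly_disc_point[of "1 / e - 1" M]
      by (simp add: poly_det det_mat_mult)
  qed
qed

text \<open>Duhamel's formula comparing exp(- t M) with exp(- t) I: the integrand is the derivative
  in s of exp(s - t) exp(- s M), which equals exp(s - t) (I - M) exp(- s M).\<close>

lemma exp_fun_resolvent:
  assumes t: "t \<ge> 0"
  shows "exp_fun M i j t - exp (- complex_of_real t) * (mat 1 $ i $ j) =
    (LINT s:{0..t}|lborel. exp (- 1 * complex_of_real (t - s)) * (\<Sum>l\<in>UNIV. (mat 1 - M) $ i $ l * exp_fun M l j s))"
proof -
  define F where "F = (\<lambda>s. exp (complex_of_real s - complex_of_real t) * exp_fun M i j s)"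
  have sum1: "(\<Sum>l\<in>UNIV. (mat 1 - M) $ i $ l * exp_fun M l j s) = exp_fun M i j s - (\<Sum>l\<in>UNIV. M $ i $ l * exp_fun M l j s)" for s
    by (simp add: left_diff_distrib sum_subtractf mat_def mult_delta_left)
  have "(LINT s:{0..t}|lborel. exp (complex_of_real s - complex_of_real t) * (\<Sum>l\<in>UNIV. (mat 1 - M) $ i $ l * exp_fun M l j s)) = F t - F 0"
  proof (rule FTC_set_integral[OF t])
    fix s
    have e: "((\<lambda>s. exp (complex_of_real s - complex_of_real t)) has_vector_derivative exp (complex_of_real s - complex_of_real t)) (at s)"
      by (rule has_vector_derivative_real_field) (auto intro!: derivative_eq_intros)
    show "(F has_vector_derivative exp (complex_of_real s - complex_of_real t) * (\<Sum>l\<in>UNIV. (mat 1 - M) $ i $ l * exp_fun M l j s)) (at s)"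
      unfolding F_def sum1 using has_vector_derivative_mult[OF e exp_fun_deriv[of M i j s]]
      by (simp add: algebra_simps)
  next
    show "continuous_on UNIV (\<lambda>s. exp (complex_of_real s - complex_of_real t) * (\<Sum>l\<in>UNIV. (mat 1 - M) $ i $ l * exp_fun M l j s))"
      by (intro continuous_intros exp_fun_cont)
  qed
  also have "F t - F 0 = exp_fun M i j t - exp (- complex_of_real t) * (mat 1 $ i $ j)"
    by (simp add: F_def exp_fun_def exp_series_0)
  finally show ?thesis by simp
qed

text \<open>Duhamel's formula convolved with u. For X = convolution with exp(- t M) it is the
  entrywise form of E (I - M) X = X - E.\<close>

lemma lconv_exp_fun:
  "E1 (\<Sum>l\<in>UNIV. lscale ((mat 1 - M) $ i $ l) (lconv (exp_fun M l j) u)) =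
     lconv (exp_fun M i j) u - lscale (mat 1 $ i $ j) (E1 u)"
proof -
  have c1: "continuous_on UNIV (\<lambda>t. (mat 1 - M) $ i $ l * exp_fun M l j t)" for l
    by (intro continuous_intros exp_fun_cont)
  have c2: "continuous_on UNIV (\<lambda>t. (- mat 1 $ i $ j) * exp (- 1 * complex_of_real t))"
    by (intro continuous_intros)
  have c3: "continuous_on UNIV (\<lambda>t. \<Sum>l\<in>UNIV. (mat 1 - M) $ i $ l * exp_fun M l j t)"
    by (intro continuous_intros exp_fun_cont)
  have c4: "continuous_on UNIV (\<lambda>t. exp_fun M i j t + (- mat 1 $ i $ j) * exp (- 1 * complex_of_real t))"
    by (intro continuous_intros exp_fun_cont)
  have "E1 (\<Sum>l\<in>UNIV. lscale ((mat 1 - M) $ i $ l) (lconv (exp_fun M l j) u)) =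
      E1 (lconv (\<lambda>t. \<Sum>l\<in>UNIV. (mat 1 - M) $ i $ l * exp_fun M l j t) u)"
    by (subst lconv_kernel_sum[OF c1]) (simp only: lconv_kernel_scale[OF exp_fun_cont])
  also have "\<dots> = lconv (\<lambda>t. exp_fun M i j t + (- mat 1 $ i $ j) * exp (- 1 * complex_of_real t)) u"
    unfolding expconv_def
    by (rule lconv_assoc[OF continuous_exp_kernel c3 c4])
       (use exp_fun_resolvent[of _ M i j] in \<open>simp add: mult.commute\<close>)
  also have "\<dots> = lconv (exp_fun M i j) u + lscale (- mat 1 $ i $ j) (E1 u)"
    unfolding expconv_def
    by (subst lconv_kernel_add[OF exp_fun_cont c2], subst lconv_kernel_scale[OF continuous_exp_kernel]) simp
  finally show ?thesis by (auto intro!: locfun_eqI)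
qed

text \<open>The convolution W of exp(- t M) with U solves (I - E (I - M)) W = E U. The left adjugate
  isolates W over the scalar denominator det(I - e (I - M)), so M need not be
  diagonalizable.\<close>

theorem realizes_exp_convolution:
  assumes M: "\<forall>\<mu>\<in>eigenvalues M. Re \<mu> > 0"
  shows "realizes (convolution (\<lambda>t. matrix_exp (- t *\<^sub>R M))) (\<lambda>z. matrix_inv (mat z + M))"
proof -
  let ?P = "resolvent_poly M" let ?d = "det ?P" let ?Q = "left_adj ?P ** mat [:0, 1:]"
  have kij: "(\<lambda>t. matrix_exp (- t *\<^sub>R M) $ i $ j) = exp_fun M i j" for i j
    by (rule ext) (simp only: matrix_exp_entry exp_fun_def vec_lambda_beta)
  have st: "stable ?d" by (rule stable_resolvent_poly[OF M])
  show ?thesis unfolding realizes_def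
  proof (intro exI conjI allI impI)
    show "fraction_op (convolution (\<lambda>t. matrix_exp (- t *\<^sub>R M))) ?d ?Q"
      unfolding fraction_op_def
    proof (intro conjI allI)
      fix U
      define W where "W = (\<chi> i. \<Sum>j\<in>UNIV. lconv (exp_fun M i j) (U $ j))"
      have "convolution (\<lambda>t. matrix_exp (- t *\<^sub>R M)) (lfv U) = lfv W"
        unfolding W_def
        by (subst convolution_component) (simp_all only: kij exp_fun_cont)
      moreover have "W = stable_mact ?d ?Q U"
      proof (rule stable_mact_unique[OF st])
        have "mact ?P W $ i = vact [:0, 1:] U $ i" for i
        proof -
          have "mact ?P W $ i = W $ i - E1 (\<Sum>l\<in>UNIV. lscale ((mat 1 - M) $ i $ l) (W $ l))"
          proof -
            have "mact ?P W = W - vact [:0, 1:] (mact (pconst (mat 1 - M)) W)"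
              by (simp add: resolvent_poly_def mact_diff mact_mat vact_1 mact_pmul)
            then show ?thesis by (simp add: vact_def mact_def pconst_def)
          qed
          also have "(\<Sum>l\<in>UNIV. lscale ((mat 1 - M) $ i $ l) (W $ l)) =
              (\<Sum>j\<in>UNIV. \<Sum>l\<in>UNIV. lscale ((mat 1 - M) $ i $ l) (lconv (exp_fun M l j) (U $ j)))"
            unfolding W_def by (simp add: lscale_sum) (rule sum.swap)
          also have "E1 \<dots> = (\<Sum>j\<in>UNIV. lconv (exp_fun M i j) (U $ j) - lscale (mat 1 $ i $ j) (E1 (U $ j)))"
            by (subst expconv_sum) (simp only: lconv_exp_fun)
          also have "\<dots> = W $ i - E1 (U $ i)"
          proof -
            have "(\<Sum>j\<in>UNIV. lscale (mat 1 $ i $ j) (E1 (U $ j))) = (\<Sum>j\<in>UNIV. if j = i then E1 (U $ j) else 0)"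
              by (intro sum.cong) (auto simp: mat_def)
            then show ?thesis by (simp add: W_def sum_subtractf)
          qed
          finally show ?thesis by (simp add: vact_def)
        qed
        then have PW: "mact ?P W = vact [:0, 1:] U" by (simp add: vec_eq_iff)
        have "vact ?d W = mact (left_adj ?P) (mact ?P W)"
          by (simp add: left_adj_mult mact_mat flip: mact_mult)
        then show "vact ?d W = mact ?Q U"
          by (simp add: PW mact_mult mact_mat)
      qed
      ultimately show "convolution (\<lambda>t. matrix_exp (- t *\<^sub>R M)) (lfv U) = lfv (stable_mact ?d ?Q U)" by simp
    qed (rule st)
  next
    fix z :: complex assume z: "Re z \<ge> 0"
    have inv: "(mat z + M) ** matrix_inv (mat z + M) = mat 1"
      by (rule matrix_inv_mult[OF det_pos_shift[OF M z]])
    have "mat (poly ?d (disc_point z)) = peval (disc_point z) (left_adj ?P) ** (mat (disc_point z) ** (mat z + M))"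
      unfolding peval_resolvent_poly_disc_point[OF z, symmetric] peval_mult[symmetric] left_adj_mult peval_mat ..
    then have "mat (poly ?d (disc_point z)) ** matrix_inv (mat z + M) =
        peval (disc_point z) (left_adj ?P) ** mat (disc_point z) ** ((mat z + M) ** matrix_inv (mat z + M))"
      by (simp only: matrix_mul_assoc)
    then show "mat (poly ?d (disc_point z)) ** matrix_inv (mat z + M) = peval (disc_point z) ?Q"
      by (simp add: inv peval_mult peval_mat)
  qed
qed

text \<open>Each entry of the full kernel is a finite linear combination of entries of
  \<open>k\<close>, so constant matrices on either side can be split off.\<close>

lemma convolution_factor:
  assumes k: "\<And>i j. continuous_on UNIV (\<lambda>t. k t $ i $ j)"
  shows "convolution (\<lambda>t. X ** k t ** Y) (lfv U) = (\<lambda>t. X *v convolution k (\<lambda>s. Y *v lfv U s) t)"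
proof -
  have comp: "(X ** k t ** Y) $ i $ j = (\<Sum>b\<in>UNIV. \<Sum>a\<in>UNIV. (X $ i $ a * Y $ b $ j) * k t $ a $ b)" for t i j
    by (simp add: matrix_matrix_mult_def sum_distrib_right sum_distrib_left algebra_simps)
  have c: "continuous_on UNIV (\<lambda>t. (X ** k t ** Y) $ i $ j)" for i j
    unfolding comp by (intro continuous_intros k)
  have cab: "continuous_on UNIV (\<lambda>t. x * k t $ a $ b)" for x a b by (intro continuous_intros k)
  have cb: "continuous_on UNIV (\<lambda>t. \<Sum>a\<in>UNIV. (X $ i $ a * Y $ b $ j) * k t $ a $ b)" for i j b
    by (intro continuous_intros k)
  have L: "lconv (\<lambda>t. (X ** k t ** Y) $ i $ j) u = (\<Sum>b\<in>UNIV. \<Sum>a\<in>UNIV. lscale (X $ i $ a * Y $ b $ j) (lconv (\<lambda>t. k t $ a $ b) u))" for i j u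
    unfolding comp by (simp only: lconv_kernel_sum[OF cb] lconv_kernel_sum[OF cab] lconv_kernel_scale[OF k])
  have lsum: "lconv (\<lambda>t. k t $ a $ b) (\<Sum>j\<in>J. f j) = (\<Sum>j\<in>J. lconv (\<lambda>t. k t $ a $ b) (f j))" for a b f and J :: "'d set"
    by (induction J rule: infinite_finite_induct) (simp_all add: lconv_add[OF k])
  have "(\<chi> i. \<Sum>j\<in>UNIV. lconv (\<lambda>t. (X ** k t ** Y) $ i $ j) (U $ j)) =
    mact (pconst X) (\<chi> a. \<Sum>b\<in>UNIV. lconv (\<lambda>t. k t $ a $ b) (mact (pconst Y) U $ b))"
  proof (subst vec_eq_iff, intro allI)
    fix i
    have "(\<Sum>j\<in>UNIV. \<Sum>b\<in>UNIV. \<Sum>a\<in>UNIV. lscale (X $ i $ a * Y $ b $ j) (lconv (\<lambda>t. k t $ a $ b) (U $ j))) =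
      (\<Sum>a\<in>UNIV. \<Sum>b\<in>UNIV. \<Sum>j\<in>UNIV. lscale (X $ i $ a * Y $ b $ j) (lconv (\<lambda>t. k t $ a $ b) (U $ j)))"
      by (subst sum.swap, subst (2) sum.swap, subst sum.swap) (rule refl)
    then show "(\<chi> i. \<Sum>j\<in>UNIV. lconv (\<lambda>t. (X ** k t ** Y) $ i $ j) (U $ j)) $ i =
      mact (pconst X) (\<chi> a. \<Sum>b\<in>UNIV. lconv (\<lambda>t. k t $ a $ b) (mact (pconst Y) U $ b)) $ i"
      by (simp add: L mact_def pconst_def lsum lscale_sum lconv_scale[OF k])
  qed
  then show ?thesis
    by (simp add: convolution_component[OF c] convolution_component[OF k] flip: lfv_mact_pconst)
qed

lemma realizes_exp_kernel:
  assumes M: "\<forall>\<mu>\<in>eigenvalues M. Re \<mu> > 0"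
  shows "realizes (convolution (\<lambda>t. X ** matrix_exp (- t *\<^sub>R M) ** Y)) (\<lambda>z. X ** matrix_inv (mat z + M) ** Y)"
proof (rule realizes_op_cong)
  show "realizes (\<lambda>u t. X *v convolution (\<lambda>t. matrix_exp (- t *\<^sub>R M)) (\<lambda>s. Y *v u s) t) (\<lambda>z. X ** matrix_inv (mat z + M) ** Y)"
    using realizes_const_comp[OF realizes_comp[OF realizes_exp_convolution[OF M] realizes_const[of Y]], of X]
    by (simp add: matrix_mul_assoc)
  have "continuous_on UNIV (\<lambda>t. matrix_exp (- t *\<^sub>R M) $ i $ j)" for i j
    using exp_fun_cont[of M i j] by (simp only: matrix_exp_entry exp_fun_def[abs_def] vec_lambda_beta)
  then show "convolution (\<lambda>t. X ** matrix_exp (- t *\<^sub>R M) ** Y) (lfv U) = (\<lambda>t. X *v convolution (\<lambda>t. matrix_exp (- t *\<^sub>R M)) (\<lambda>s. Y *v lfv U s) t)" for U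
    by (rule convolution_factor)
qed

subsection \<open>Points outside the spectrum\<close>

text \<open>\<mu> I - T is the fraction d^-1 M with M = \<mu> d - Q, and its inverse M^-1 d equals
  (det M)^-1 (adj M) d. This is again a stable fraction, hence bounded, and it inverts pointwise
  rather than just almost everywhere.\<close>

lemma not_in_Lq_spectrum:
  fixes T :: "(real \<Rightarrow> complex^'n) \<Rightarrow> (real \<Rightarrow> complex^'n)"
  assumes T: "fraction_op T d Q" and q: "q \<ge> 1" and st: "stable (det (mat (smult \<mu> d) - Q))"
  shows "\<mu> \<notin> Lq_spectrum q T"
proof -
  let ?M = "mat (smult \<mu> d) - Q"
  let ?Q = "adj ?M ** mat d"
  have d: "stable d" and TU: "\<And>U. T (lfv U) = lfv (stable_mact d Q U)"
    using T by (auto simp: fraction_op_def)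
  \<comment> \<open>On functions of the form \<open>lfv U\<close> the choice is forced, because
    \<open>lfv\<close> is injective.\<close>
  define S where "S = (\<lambda>u. lfv (stable_mact (det ?M) ?Q (SOME U. u = lfv U)))"
  have SU: "S (lfv U) = lfv (stable_mact (det ?M) ?Q U)" for U
    by (simp add: S_def lfv_inject)
  have "Lq_bounded_operator q S"
    by (rule fraction_op_bounded[OF _ q]) (use SU st in \<open>auto simp: fraction_op_def\<close>)
  moreover have MS: "mact ?M (stable_mact (det ?M) ?Q V) = vact d V" for V
  proof (rule stable_vact_inj[OF st])
    have "vact (det ?M) (mact ?M (stable_mact (det ?M) ?Q V)) = mact ?M (mact ?Q V)"
      by (simp add: vact_stable_mact[OF st] flip: mact_vact)
    also have "\<dots> = mact (?M ** adj ?M) (vact d V)" by (simp add: mact_mult mact_mat)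
    finally show "vact (det ?M) (mact ?M (stable_mact (det ?M) ?Q V)) = vact (det ?M) (vact d V)"
      by (simp add: mult_adj mact_mat)
  qed
  have MU: "vact d (vscale \<mu> U - stable_mact d Q U) = mact ?M U" for U
  proof -
    have "vact d (A - B) = vact d A - vact d B" for A B :: "locfun^'n"
      using vact_add[of d "A - B" B] by (simp add: eq_diff_eq)
    then show ?thesis
      by (simp add: vact_stable_mact[OF d] mact_diff mact_mat vact_smult vact_vscale)
  qed
  have eq: "(\<lambda>t. \<mu> *s lfv U t - T (lfv U) t) = lfv (vscale \<mu> U - stable_mact d Q U)" for U
    by (simp add: lfv_diff lfv_vscale TU)
  have "S (\<lambda>t. \<mu> *s u t - T u t) = u \<and> (\<lambda>t. \<mu> *s S u t - T (S u) t) = u" if u: "u \<in> Lq_space q" for u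
  proof -
    obtain U where U: "u = lfv U" by (rule Lq_space_lfv[OF u q])
    have "stable_mact (det ?M) ?Q (vscale \<mu> U - stable_mact d Q U) = U"
      by (rule mact_inj[OF st]) (simp only: MS MU)
    moreover have "vscale \<mu> (stable_mact (det ?M) ?Q U) - stable_mact d Q (stable_mact (det ?M) ?Q U) = U"
      by (rule stable_vact_inj[OF d]) (simp only: MS MU)
    ultimately show ?thesis unfolding U eq SU by simp
  qed
  ultimately show ?thesis unfolding Lq_spectrum_def by auto
qed

subsection \<open>Laplace transform\<close>

definition lap :: "complex \<Rightarrow> locfun \<Rightarrow> complex" where
  "lap z u = (LINT t|half_line. exp (- z * complex_of_real t) * lf u t)"

lemma exp_half_line_integrable:
  assumes "Re z > 0"
  shows "set_integrable lborel {0..} (\<lambda>t. exp (- z * complex_of_real t))"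
  unfolding set_integrable_def
proof (rule integrableI_bounded)
  show "(\<lambda>t. indicator {0..} t *\<^sub>R exp (- z * complex_of_real t)) \<in> borel_measurable lborel" by measurable
  have "(\<integral>\<^sup>+t. ennreal (norm (indicator {0..} t *\<^sub>R exp (- z * complex_of_real t))) \<partial>lborel) =
    (\<integral>\<^sup>+t. ennreal (exp (- Re z * t)) * indicator {0..} t \<partial>lborel)"
    by (intro nn_integral_cong) (auto simp: indicator_def)
  then show "(\<integral>\<^sup>+t. ennreal (norm (indicator {0..} t *\<^sub>R exp (- z * complex_of_real t))) \<partial>lborel) < \<infinity>"
    using nn_integral_exp_half_line[OF assms] by simp
qed

lemma exp_half_line_integral:
  assumes z: "Re z > 0"
  shows "(LINT t:{0..}|lborel. exp (- z * complex_of_real t)) = 1 / z"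
proof -
  have z0: "z \<noteq> 0" using z by auto
  have "((\<lambda>n. LINT t:{0..n}|lborel. exp (- z * complex_of_real t)) \<longlongrightarrow> (LINT t:{0..}|lborel. exp (- z * complex_of_real t))) at_top"
    by (rule tendsto_set_lebesgue_integral_at_top[OF _ exp_half_line_integrable[OF z]]) simp
  moreover have "eventually (\<lambda>n. (LINT t:{0..n}|lborel. exp (- z * complex_of_real t)) = (1 - exp (- z * complex_of_real n)) / z) at_top"
    using eventually_ge_at_top[of 0]
  proof eventually_elim
    case (elim n)
    define F where "F = (\<lambda>t. - exp (- z * complex_of_real t) / z)"
    have "(LINT t:{0..n}|lborel. exp (- z * complex_of_real t)) = F n - F 0"
    proof (rule FTC_set_integral[OF elim])
      show "(F has_vector_derivative exp (- z * complex_of_real x)) (at x)" for x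
        unfolding F_def using z0 by (auto intro!: has_vector_derivative_real_field derivative_eq_intros)
    qed (intro continuous_intros)
    then show ?case by (simp add: F_def diff_divide_distrib)
  qed
  ultimately have lim1: "((\<lambda>n. (1 - exp (- z * complex_of_real n)) / z) \<longlongrightarrow> (LINT t:{0..}|lborel. exp (- z * complex_of_real t))) at_top"
    by (simp add: tendsto_cong)
  have "((\<lambda>n. exp (- z * complex_of_real n)) \<longlongrightarrow> 0) at_top"
  proof (rule tendsto_norm_zero_cancel)
    have "((\<lambda>n. exp (- Re z * n)) \<longlongrightarrow> 0) at_top"
      by (intro filterlim_compose[OF exp_at_bot] filterlim_tendsto_neg_mult_at_bot[OF tendsto_const _ filterlim_ident])
         (use z in auto)
    then show "((\<lambda>n. norm (exp (- z * complex_of_real n))) \<longlongrightarrow> 0) at_top" by simp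
  qed
  then have "((\<lambda>n. (1 - exp (- z * complex_of_real n)) / z) \<longlongrightarrow> (1 - 0) / z) at_top"
    by (intro tendsto_intros z0)
  then show ?thesis using tendsto_unique[OF _ lim1] by simp
qed

text \<open>The modulus a of the exponential is at most 1 and integrable, so a |u| \<le> a + |u|^q:
  bound |u| by 1 where it is small and by |u|^q elsewhere. No conjugate exponent is needed.\<close>

lemma lap_integrable:
  assumes z: "Re z > 0" and q: "q \<ge> 1" and u: "Jq q (lf u) < \<infinity>"
  shows "integrable half_line (\<lambda>t. exp (- z * complex_of_real t) * lf u t)"
proof (rule Bochner_Integration.integrable_bound[where f="\<lambda>t. norm (exp (- z * complex_of_real t)) + norm (lf u t) powr q"])
  have "set_integrable lborel {0<..} (\<lambda>t. norm (exp (- z * complex_of_real t)))"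
    by (rule set_integrable_subset[OF set_integrable_norm[OF exp_half_line_integrable[OF z]]]) auto
  then have "integrable half_line (\<lambda>t. norm (exp (- z * complex_of_real t)))"
    by (subst integrable_restrict_space) (auto simp: set_integrable_def)
  moreover have "integrable half_line (\<lambda>t. norm (lf u t) powr q)"
    using u by (intro integrableI_bounded) (auto simp: Jq_def)
  ultimately show "integrable half_line (\<lambda>t. norm (exp (- z * complex_of_real t)) + norm (lf u t) powr q)"
    by (rule Bochner_Integration.integrable_add)
  show "(\<lambda>t. exp (- z * complex_of_real t) * lf u t) \<in> borel_measurable half_line"
    by (intro borel_measurable_times lf_measurable measurable_restrict_space1) measurable
  show "AE t in half_line. norm (exp (- z * complex_of_real t) * lf u t) \<le> norm (norm (exp (- z * complex_of_real t)) + norm (lf u t) powr q)"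
  proof (rule AE_I2)
    fix t assume "t \<in> space half_line"
    then have t: "t > 0" by (simp add: space_restrict_space)
    define a where "a = norm (exp (- z * complex_of_real t))"
    have a: "0 \<le> a" "a \<le> 1" using t z by (auto simp: a_def)
    have "norm (lf u t) \<le> 1 + norm (lf u t) powr q \<and> a * norm (lf u t) \<le> a + norm (lf u t) powr q"
    proof (cases "norm (lf u t) \<le> 1")
      case True
      then show ?thesis using a mult_left_mono[OF True a(1)] by (auto simp: add_increasing2)
    next
      case False
      then have *: "norm (lf u t) powr 1 \<le> norm (lf u t) powr q" using q by (intro powr_mono) auto
      have "a * norm (lf u t) \<le> 1 * norm (lf u t)" by (intro mult_right_mono a) simp
      then show ?thesis using False * a by simp
    qed
    then show "norm (exp (- z * complex_of_real t) * lf u t) \<le> norm (norm (exp (- z * complex_of_real t)) + norm (lf u t) powr q)"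
      unfolding norm_mult a_def[symmetric] using a by simp
  qed
qed

lemma lap_add:
  assumes z: "Re z > 0" and q: "q \<ge> 1" and u: "Jq q (lf u) < \<infinity>" "Jq q (lf v) < \<infinity>"
  shows "lap z (u + v) = lap z u + lap z v"
  using Bochner_Integration.integral_add[OF lap_integrable[OF z q u(1)] lap_integrable[OF z q u(2)]]
  by (simp add: lap_def distrib_left)

lemma lap_scale: "lap z (lscale c u) = c * lap z u"
  unfolding lap_def by (subst integral_mult_right_zero[symmetric]) (simp add: mult.left_commute)

lemma lap_0: "lap z 0 = 0" using lap_scale[of z 0 0] by simp

text \<open>Finiteness is carried along in the conclusion because the induction step needs it for
  the partial sum.\<close>

lemma lap_sum:
  assumes z: "Re z > 0" and q: "q \<ge> 1" and u: "\<And>i. i \<in> I \<Longrightarrow> Jq q (lf (u i)) < \<infinity>" and I: "finite I"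
  shows "lap z (\<Sum>i\<in>I. u i) = (\<Sum>i\<in>I. lap z (u i)) \<and> Jq q (lf (\<Sum>i\<in>I. u i)) < \<infinity>"
  using I u
proof (induction I rule: finite_induct)
  case empty
  have "Jq q (lf 0) = 0" using q unfolding Jq_def by simp
  then show ?case using lap_0 by (simp del: lf_simps)
next
  case (insert i I)
  have J: "Jq q (lf (u i)) < \<infinity>" "Jq q (lf (\<Sum>i\<in>I. u i)) < \<infinity>" using insert by (blast, blast)
  have "Jq q (lf (u i + (\<Sum>i\<in>I. u i))) < \<infinity>"
    using J by (intro order_le_less_trans[OF Jq_add[OF q]]) (simp add: ennreal_mult_less_top)
  moreover have "lap z (\<Sum>i\<in>I. u i) = (\<Sum>i\<in>I. lap z (u i))" using insert by blast
  ultimately show ?case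
    using insert(1,2) lap_add[OF z q J] by (simp del: lf_simps lf_sum)
qed

lemma Jq_stable_finite: "stable_op S \<Longrightarrow> q \<ge> 1 \<Longrightarrow> Jq q (lf u) < \<infinity> \<Longrightarrow> Jq q (lf (S u)) < \<infinity>"
  using stable_op_bound[of S q] by (metis ennreal_less_top ennreal_mult_less_top infinity_ennreal_def order_le_less_trans)

text \<open>The convolution theorem for exp(- t). The identity exp(- z t) exp(- (t - s)) = exp(- z
  s) exp(- (z + 1) (t - s)) turns the double integral into that of w(s) h(t - s), and Fubini's
  theorem separates it into the transform of u and the integral 1/(z + 1) of h.\<close>

lemma lap_E1:
  assumes z: "Re z > 0" and q: "q \<ge> 1" and u: "Jq q (lf u) < \<infinity>"
  shows "lap z (E1 u) = disc_point z * lap z u"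
proof -
  define w where "w = (\<lambda>s. indicator {0<..} s *\<^sub>R (exp (- z * complex_of_real s) * lf u s))"
  define h where "h = (\<lambda>s. indicator {0..} s *\<^sub>R exp (- (z + 1) * complex_of_real s))"
  have z1: "Re (z + 1) > 0" using z by simp
  have wi: "integrable lborel w"
    using lap_integrable[OF z q u] unfolding w_def by (subst (asm) integrable_restrict_space) auto
  have hi: "integrable lborel h"
    using exp_half_line_integrable[OF z1] unfolding h_def set_integrable_def .
  have [measurable]: "w \<in> borel_measurable borel" "h \<in> borel_measurable borel"
    using borel_measurable_integrable[OF wi] borel_measurable_integrable[OF hi] by simp_all
  have hs: "integrable lborel (\<lambda>t. h (t - s))" for s
    using lborel_integrable_real_affine[OF hi, of 1 "- s"] by (simp add: algebra_simps)
  have hint: "(LINT t|lborel. h (t - s)) = disc_point z" for s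
  proof -
    have "(LINT t|lborel. h (t - s)) = (LINT t|lborel. h t)"
      using lborel_integral_real_affine[of 1 h "- s"] by (simp add: algebra_simps)
    also have "\<dots> = disc_point z"
      using exp_half_line_integral[OF z1] by (simp add: h_def set_lebesgue_integral_def disc_point_def)
    finally show ?thesis .
  qed
  have nh: "(LINT t|lborel. norm (h (t - s))) = (LINT t|lborel. norm (h t))" for s
    using lborel_integral_real_affine[of 1 "\<lambda>t. norm (h t)" "- s"] by (simp add: algebra_simps)
  have gi: "integrable (lborel \<Otimes>\<^sub>M lborel) (\<lambda>(s, t). w s * h (t - s))"
  proof (rule lborel_pair.Fubini_integrable)
    show "(\<lambda>(s, t). w s * h (t - s)) \<in> borel_measurable (lborel \<Otimes>\<^sub>M lborel)" by measurable
    show "integrable lborel (\<lambda>s. LINT t|lborel. norm (case (s, t) of (s, t) \<Rightarrow> w s * h (t - s)))"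
      using wi by (simp add: norm_mult nh)
    show "AE s in lborel. integrable lborel (\<lambda>t. case (s, t) of (s, t) \<Rightarrow> w s * h (t - s))"
      using hs by simp
  qed
  have "lap z (E1 u) = (LINT t|lborel. (LINT s|lborel. w s * h (t - s)))"
    unfolding lap_def
  proof (subst integral_restrict_space, simp, intro Bochner_Integration.integral_cong refl)
    fix t
    show "indicator {0<..} t *\<^sub>R (exp (- z * complex_of_real t) * lf (E1 u) t) = (LINT s|lborel. w s * h (t - s))"
    proof (cases "t > 0")
      case True
      have "exp (- z * complex_of_real t) * lf (E1 u) t =
         (LINT s|lborel. exp (- z * complex_of_real t) * (indicator {0..t} s *\<^sub>R (exp (- 1 * complex_of_real (t - s)) * lf u s)))"
        unfolding expconv_def lf_lconv[OF continuous_exp_kernel] set_lebesgue_integral_def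
        by (rule integral_mult_right_zero[symmetric])
      also have "\<dots> = (LINT s|lborel. w s * h (t - s))"
      proof (rule integral_cong_AE)
        have "(\<lambda>s. indicator {0..t} s *\<^sub>R (exp (- 1 * complex_of_real (t - s)) * lf u s)) \<in> borel_measurable lborel"
          using set_integrable_conv[OF continuous_exp_kernel, of t "- 1" u]
          unfolding set_integrable_def by (rule borel_measurable_integrable)
        then show "(\<lambda>s. exp (- z * complex_of_real t) * (indicator {0..t} s *\<^sub>R (exp (- 1 * complex_of_real (t - s)) * lf u s))) \<in> borel_measurable lborel"
          by (rule borel_measurable_times[OF borel_measurable_const])
        show "(\<lambda>s. w s * h (t - s)) \<in> borel_measurable lborel" by measurable
        have "exp (- z * complex_of_real t) * (indicator {0..t} s *\<^sub>R (exp (- 1 * complex_of_real (t - s)) * lf u s)) = w s * h (t - s)"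
          if "s \<noteq> 0" for s
        proof -
          have "exp (- z * complex_of_real t) * exp (- 1 * complex_of_real (t - s)) =
              exp (- z * complex_of_real s) * exp (- (z + 1) * complex_of_real (t - s))"
            unfolding exp_add[symmetric] by (simp add: algebra_simps)
          then show ?thesis using that
            by (auto simp: w_def h_def indicator_def)
        qed
        then show "AE s in lborel. exp (- z * complex_of_real t) * (indicator {0..t} s *\<^sub>R (exp (- 1 * complex_of_real (t - s)) * lf u s)) = w s * h (t - s)"
          using AE_lborel_singleton[of 0] by (auto elim: eventually_mono)
      qed
      finally show ?thesis using True by simp
    next
      case False
      then have "(\<lambda>s. w s * h (t - s)) = (\<lambda>s. 0)"
        by (intro ext) (auto simp: w_def h_def indicator_def)
      then show ?thesis using False by (simp only:) simp
    qed
  qed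
  also have "\<dots> = (LINT s|lborel. (LINT t|lborel. w s * h (t - s)))"
    by (rule lborel_pair.Fubini_integral[OF gi])
  also have "\<dots> = disc_point z * (LINT s|lborel. w s)" by (simp add: hint mult.commute)
  also have "(LINT s|lborel. w s) = lap z u"
    unfolding lap_def w_def by (subst integral_restrict_space) simp_all
  finally show ?thesis .
qed

lemma lap_pact:
  assumes z: "Re z > 0" and q: "q \<ge> 1" and u: "Jq q (lf u) < \<infinity>"
  shows "lap z (pact p u) = poly p (disc_point z) * lap z u"
proof (induction p)
  case 0
  then show ?case by (simp add: lap_0)
next
  case (pCons a p)
  have 1: "Jq q (lf (pact p u)) < \<infinity>" by (rule Jq_stable_finite[OF stable_op_pact q u])
  have 2: "Jq q (lf (E1 (pact p u))) < \<infinity>"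
    by (rule Jq_stable_finite[OF stable_op.exp[OF _ stable_op.id] q 1]) simp
  have 3: "Jq q (lf (lscale a u)) < \<infinity>"
    by (rule Jq_stable_finite[OF stable_op.scale[OF stable_op.id] q u])
  show ?case
    by (simp add: lap_add[OF z q 3 2] lap_E1[OF z q 1] lap_scale pCons algebra_simps del: lf_simps)
qed

definition lapv :: "complex \<Rightarrow> locfun^'n \<Rightarrow> complex^'n" where
  "lapv z U = (\<chi> i. lap z (U $ i))"

lemma lapv_mact:
  assumes z: "Re z > 0" and q: "q \<ge> 1" and U: "Jq q (lfv U) < \<infinity>"
  shows "lapv z (mact Q U) = peval (disc_point z) Q *v lapv z U"
proof -
  have 1: "Jq q (lf (U $ i)) < \<infinity>" for i
    using Jq_component[OF q, of U i] U by (rule order_le_less_trans)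
  have 2: "Jq q (lf (pact p (U $ i))) < \<infinity>" for p i
    by (rule Jq_stable_finite[OF stable_op_pact q 1])
  show ?thesis
    by (simp add: vec_eq_iff lapv_def mact_def peval_def matrix_vector_mult_def lap_sum[OF z q 2] lap_pact[OF z q 1] del: lf_simps lf_sum)
qed

lemma lap_cong:
  assumes "q \<ge> 1" "Jq q (lf (u - v)) = 0"
  shows "lap z u = lap z v"
proof -
  have "AE t in half_line. ennreal (norm (lf (u - v) t) powr q) = 0"
    using assms unfolding Jq_def by (subst (asm) nn_integral_0_iff_AE) auto
  then have "AE t in half_line. exp (- z * complex_of_real t) * lf u t = exp (- z * complex_of_real t) * lf v t"
    by (rule eventually_mono) auto
  then show ?thesis unfolding lap_def
    by (intro integral_cong_AE borel_measurable_times lf_measurable measurable_restrict_space1) measurable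
qed

text \<open>A left eigenvector \<open>y\<close> of the symbol yields the continuous functional
  \<open>u \<mapsto> y \<bullet> lap z u\<close>, which vanishes on the range of \<open>\<mu> I - T\<close>.\<close>

lemma eigenvalue_in_Lq_spectrum:
  fixes T :: "(real \<Rightarrow> complex^'n) \<Rightarrow> (real \<Rightarrow> complex^'n)"
  assumes T: "realizes T F" and q: "q \<ge> 1" and z: "Re z > 0" and \<mu>: "\<mu> \<in> eigenvalues (F z)"
  shows "\<mu> \<in> Lq_spectrum q T"
proof (rule ccontr)
  assume "\<mu> \<notin> Lq_spectrum q T"
  then obtain S where S: "Lq_bounded_operator q S" "\<And>u. u \<in> Lq_space q \<Longrightarrow> ae_eq (\<lambda>t. \<mu> *s S u t - T (S u) t) u"
    unfolding Lq_spectrum_def by blast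
  obtain d Q where fr: "fraction_op T d Q" and F: "\<And>z. Re z \<ge> 0 \<Longrightarrow> mat (poly d (disc_point z)) ** F z = peval (disc_point z) Q"
    using T unfolding realizes_def by blast
  have d: "stable d" and TU: "\<And>U. T (lfv U) = lfv (stable_mact d Q U)"
    using fr by (auto simp: fraction_op_def)
  have z0: "Re z \<ge> 0" using z by simp
  have de: "poly d (disc_point z) \<noteq> 0" using d disc_point_simps(3)[OF z0] by (auto simp: stable_def)
  have "det (transpose (mat \<mu> - F z)) = 0" using \<mu> by (simp add: eigenvalues_iff_det)
  then obtain y where y: "y \<noteq> 0" "transpose (mat \<mu> - F z) *v y = 0"
    unfolding det_zero_iff_ker by blast
  then obtain i where i: "y $ i \<noteq> 0" by (auto simp: vec_eq_iff)
  \<comment> \<open>A test input lying in every L_q whose transform 1/(z + 1) does not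
    vanish.\<close>
  define f where "f = Lf (\<lambda>t. exp (- complex_of_real t))"
  have f: "lf f t = exp (- complex_of_real t)" for t
  proof -
    have "set_integrable lborel {0..T} (\<lambda>t. exp (- complex_of_real t))" for T
      unfolding set_integrable_def by (rule borel_integrable_compact) (auto intro!: continuous_intros)
    then show ?thesis unfolding f_def by (simp add: Lf_inverse)
  qed
  have Jf: "Jq q (lf f) < \<infinity>"
  proof -
    have "Jq q (lf f) = (\<integral>\<^sup>+t. ennreal (exp (- q * t)) * indicator {0<..} t \<partial>lborel)"
      unfolding Jq_lborel f by (intro nn_integral_cong) (simp add: exp_powr_real mult.commute)
    also have "\<dots> \<le> (\<integral>\<^sup>+t. ennreal (exp (- q * t)) * indicator {0..} t \<partial>lborel)"
      by (intro nn_integral_mono) (auto simp: indicator_def)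
    also have "\<dots> < \<infinity>" using nn_integral_exp_half_line[of q] q by simp
    finally show ?thesis .
  qed
  have lapf: "lap z f = disc_point z"
  proof -
    have z1: "Re (z + 1) > 0" using z by simp
    have "lap z f = (LINT t|lborel. indicator {0<..} t *\<^sub>R (exp (- z * complex_of_real t) * exp (- complex_of_real t)))"
      unfolding lap_def f by (subst integral_restrict_space) simp_all
    also have "\<dots> = (LINT t|lborel. indicator {0..} t *\<^sub>R exp (- (z + 1) * complex_of_real t))"
    proof (rule integral_cong_AE)
      show "AE t in lborel. indicator {0<..} t *\<^sub>R (exp (- z * complex_of_real t) * exp (- complex_of_real t)) = indicator {0..} t *\<^sub>R exp (- (z + 1) * complex_of_real t)"
        using AE_lborel_singleton[of 0]
        by eventually_elim (auto simp: indicator_def algebra_simps simp flip: exp_add)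
    qed measurable
    also have "\<dots> = disc_point z"
      using exp_half_line_integral[OF z1] by (simp add: set_lebesgue_integral_def disc_point_def)
    finally show ?thesis .
  qed
  \<comment> \<open>The input sits in a coordinate where y is nonzero, so the functional takes the
    nonzero value y_i/(z + 1) on it.\<close>
  define U where "U = (\<chi> j. if j = i then f else 0)"
  have lapU: "lapv z U = axis i (disc_point z)"
    by (simp add: lapv_def U_def vec_eq_iff axis_def lapf lap_0)
  have "Jq q (lf (U $ j)) < \<infinity>" for j
    using Jf q by (cases "j = i") (auto simp: U_def Jq_def)
  then have "Jq q (lfv U) < \<infinity>"
    by (intro order_le_less_trans[OF Jq_lfv_le[OF q]]) (simp add: ennreal_mult_less_top)
  then have U: "lfv U \<in> Lq_space q" by (simp add: Lq_space_iff)
  then have SU: "S (lfv U) \<in> Lq_space q" using S(1) by (auto simp: Lq_bounded_operator_def)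
  then obtain V where V: "S (lfv U) = lfv V" by (rule Lq_space_lfv[OF _ q])
  then have JV: "Jq q (lfv V) < \<infinity>" using SU by (simp add: Lq_space_iff)
  define W where "W = stable_mact d Q V"
  obtain C where C: "C \<ge> 0" "\<And>U. Jq q (lfv (stable_mact d Q U)) \<le> ennreal C * Jq q (lfv U)"
    using stable_mact_bound[OF d q, of Q] by blast
  have JW: "Jq q (lfv W) < \<infinity>"
    unfolding W_def using JV by (intro order_le_less_trans[OF C(2)]) (simp add: ennreal_mult_less_top)
  \<comment> \<open>The transform is computed for the polynomial equation d W = Q V; afterwards d
    can be divided out, being nonzero at the point of the disc that belongs to z.\<close>
  have LW: "lapv z W = F z *v lapv z V"
  proof -
    have "poly d (disc_point z) *s lapv z W = lapv z (mact (mat d) W)"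
      by (simp add: lapv_mact[OF z q JW] peval_mat mat_vector_mult)
    also have "mact (mat d) W = mact Q V" by (simp add: mact_mat W_def vact_stable_mact[OF d])
    also have "lapv z \<dots> = mat (poly d (disc_point z)) ** F z *v lapv z V"
      by (simp add: lapv_mact[OF z q JV] F[OF z0])
    also have "\<dots> = poly d (disc_point z) *s (F z *v lapv z V)"
      by (simp add: mat_vector_mult flip: matrix_vector_mul_assoc)
    finally show ?thesis using de by (simp add: vec_eq_iff)
  qed
  have "ae_eq (lfv (vscale \<mu> V - W)) (lfv U)"
    using S(2)[OF U] by (simp add: V TU W_def lfv_diff lfv_vscale)
  then have J0: "Jq q (lfv (vscale \<mu> V - W - U)) = 0" by (simp add: ae_eq_iff_Jq[OF q])
  have comp: "\<mu> * lap z (V $ j) = lap z (U $ j) + lap z (W $ j)" for j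
  proof -
    have "Jq q (lf (lscale \<mu> (V $ j) - (U $ j + W $ j))) = 0"
      using Jq_component[OF q, of "vscale \<mu> V - W - U" j] J0
      by (simp add: vscale_def algebra_simps del: lf_simps)
    from lap_cong[OF q this, of z] show ?thesis
      using lap_add[OF z q, of "U $ j" "W $ j"] Jq_component[OF q, of U j] Jq_component[OF q, of W j] U JW
      by (simp add: lap_scale Lq_space_iff order_le_less_trans del: lf_simps)
  qed
  have "(mat \<mu> - F z) *v lapv z V = lapv z U"
  proof -
    have "\<mu> *s lapv z V = lapv z U + lapv z W" using comp by (simp add: vec_eq_iff lapv_def)
    then show ?thesis by (simp add: matrix_vector_mult_diff_rdistrib mat_vector_mult LW)
  qed
  then have A: "(\<Sum>j\<in>UNIV. y $ j * ((mat \<mu> - F z) *v lapv z V) $ j) = y $ i * disc_point z"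
    by (simp add: lapU axis_def mult_delta_right)
  have B: "(\<Sum>j\<in>UNIV. y $ j * ((mat \<mu> - F z) *v v) $ j) = (\<Sum>k\<in>UNIV. (transpose (mat \<mu> - F z) *v y) $ k * v $ k)" for v
    by (simp add: matrix_vector_mult_def transpose_def sum_distrib_left sum_distrib_right mult.assoc mult.left_commute) (rule sum.swap)
  have "y $ i * disc_point z = 0" using A unfolding B y(2) by simp
  then show False using i disc_point_simps(1)[OF z0] by simp
qed

subsection \<open>Eigenvalue bounds on the disc and on its boundary\<close>

text \<open>Wherever d is nonzero, the zeros \<tau> are the reciprocals of the nonzero eigenvalues
  of the symbol Q/d. At \<tau> = 0 the value is a power of d, which serves as anchor in the
  arguments below.\<close>

definition pencil_det :: "complex poly \<Rightarrow> complex poly^'n^'n \<Rightarrow> complex \<Rightarrow> complex \<Rightarrow> complex" where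
  "pencil_det d Q \<tau> e = det (mat (poly d e) - mat \<tau> ** peval e Q)"

lemma pencil_det_expand:
  "pencil_det d Q \<tau> e = (\<Sum>p | p permutes UNIV. of_int (sign p) *
     (\<Prod>i\<in>UNIV. poly (mat d $ i $ p i) e - \<tau> * poly (Q $ i $ p i) e))"
proof -
  have "(mat (poly d e) - mat \<tau> ** peval e Q) $ i $ j = poly (mat d $ i $ j) e - \<tau> * poly (Q $ i $ j) e" for i j
    by (simp add: matrix_matrix_mult_def mat_def peval_def mult_delta_left)
  then show ?thesis unfolding pencil_det_def det_def by simp
qed

lemma pencil_det_cont: "continuous_on UNIV (\<lambda>(\<tau>, e). pencil_det d Q \<tau> e)"
  unfolding pencil_det_expand case_prod_beta' by (intro continuous_intros)

lemma pencil_det_holomorphic: "(\<lambda>\<tau>. pencil_det d Q \<tau> e) holomorphic_on A" "pencil_det d Q \<tau> holomorphic_on A"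
  unfolding pencil_det_expand by (intro holomorphic_intros)+

lemma pencil_det_0: "pencil_det (d :: complex poly) (Q :: complex poly^'n^'n) 0 e = poly d e ^ CARD('n)"
proof -
  have "mat 0 ** A = 0" for A :: "complex^'n^'n" by (simp add: vec_eq_iff matrix_matrix_mult_def mat_def)
  then show ?thesis using det_mat_mult[of "poly d e" "mat 1 :: complex^'n^'n"] by (simp add: pencil_det_def)
qed

text \<open>A convergent sequence together with its limit is compact, so f is uniformly continuous
  on the product with K. This supplies the locally uniform convergence that Hurwitz's theorem
  requires.\<close>

lemma uniform_limit_parameter:
  fixes f :: "complex \<times> complex \<Rightarrow> complex"
  assumes f: "continuous_on UNIV f" and a: "a \<longlonglongrightarrow> l" and K: "compact K"
  shows "uniform_limit K (\<lambda>n x. f (a n, x)) (\<lambda>x. f (l, x)) sequentially"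
proof -
  have "compact (insert l (range a) \<times> K)"
    by (intro compact_Times K compact_sequence_with_limit[OF a])
  then have uc: "uniformly_continuous_on (insert l (range a) \<times> K) f"
    by (intro compact_uniformly_continuous continuous_on_subset[OF f]) auto
  show ?thesis
  proof (rule uniform_limitI)
    fix \<epsilon> :: real assume "\<epsilon> > 0"
    then obtain \<delta> where \<delta>: "\<delta> > 0" "\<And>x y. x \<in> insert l (range a) \<times> K \<Longrightarrow> y \<in> insert l (range a) \<times> K \<Longrightarrow> dist y x < \<delta> \<Longrightarrow> dist (f y) (f x) < \<epsilon>"
      using uc unfolding uniformly_continuous_on_def by meson
    have "eventually (\<lambda>n. dist (a n) l < \<delta>) sequentially" using a \<delta>(1) by (rule tendstoD)
    then show "\<forall>\<^sub>F n in sequentially. \<forall>x\<in>K. dist (f (a n, x)) (f (l, x)) < \<epsilon>"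
    proof eventually_elim
      case (elim n)
      show ?case
      proof
        fix x assume x: "x \<in> K"
        have "dist (a n, x) (l, x) < \<delta>" using elim by (simp add: dist_Pair_Pair)
        then show "dist (f (a n, x)) (f (l, x)) < \<epsilon>" using x by (intro \<delta>(2)) auto
      qed
    qed
  qed
qed

text \<open>The statement that all eigenvalues have modulus at most s, phrased without eigenvalues.
  The strict inequality keeps the set of \<tau> open, and for s = 0 it allows every \<tau>.\<close>

definition zero_free :: "complex poly \<Rightarrow> complex poly^'n^'n \<Rightarrow> real \<Rightarrow> complex \<Rightarrow> bool" where
  "zero_free d Q s e \<longleftrightarrow> (\<forall>\<tau>. s * cmod \<tau> < 1 \<longrightarrow> pencil_det d Q \<tau> e \<noteq> 0)"

text \<open>By Hurwitz's theorem a zero at \<open>l\<close> would make \<open>pencil_det d Q \<tau> l\<close> vanish for all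
  \<open>\<tau>\<close>, but its value at \<open>\<tau> = 0\<close> is a power of \<open>poly d l\<close>.\<close>

lemma zero_free_limit:
  assumes e: "e \<longlonglongrightarrow> l" and s: "s \<ge> 0" and zf: "\<And>n. zero_free d Q s (e n)" and d: "poly d l \<noteq> 0"
  shows "zero_free d Q s l"
  unfolding zero_free_def
proof (intro allI impI)
  fix \<tau> assume \<tau>: "s * cmod \<tau> < 1"
  define S where "S = {\<tau>. s * cmod \<tau> < 1}"
  have opn: "open S" unfolding S_def by (intro open_Collect_less continuous_intros)
  \<comment> \<open>A disc of radius 1/s, or the whole plane if s = 0.\<close>
  have "convex S"
  proof (cases "s = 0")
    case False
    then have "S = ball 0 (1 / s)" using s by (auto simp: S_def field_simps)
    then show ?thesis by simp
  qed (simp add: S_def)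
  then have con: "connected S" by (rule convex_connected)
  have z0: "pencil_det d Q 0 l \<noteq> 0" using d by (simp add: pencil_det_0)
  have S0: "0 \<in> S" "\<tau> \<in> S" using \<tau> by (simp_all add: S_def)
  \<comment> \<open>Hurwitz's theorem excludes a constant limit function; such a limit equals its
    nonzero value at \<tau> = 0.\<close>
  show "pencil_det d Q \<tau> l \<noteq> 0"
  proof (cases "(\<lambda>\<tau>. pencil_det d Q \<tau> l) constant_on S")
    case True
    then show ?thesis using z0 S0 unfolding constant_on_def by metis
  next
    case False
    show ?thesis
    proof (rule Hurwitz_no_zeros[OF opn con _ _ _ False _ S0(2)])
      show "(\<lambda>\<tau>. pencil_det d Q \<tau> (e n)) holomorphic_on S" for n by (rule pencil_det_holomorphic)
      show "(\<lambda>\<tau>. pencil_det d Q \<tau> l) holomorphic_on S" by (rule pencil_det_holomorphic)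
      show "pencil_det d Q z (e n) \<noteq> 0" if "z \<in> S" for n z
        using zf[of n] that by (simp add: zero_free_def S_def)
      fix K :: "complex set" assume K: "compact K"
      have "continuous_on UNIV (\<lambda>x. (\<lambda>(\<tau>, e). pencil_det d Q \<tau> e) (snd x, fst x))"
        by (intro continuous_on_compose2[OF pencil_det_cont] continuous_intros) auto
      then have "continuous_on UNIV (\<lambda>(e, \<tau>). pencil_det d Q \<tau> e)"
        by (simp add: case_prod_beta')
      from uniform_limit_parameter[OF this e K]
      show "uniform_limit K (\<lambda>n \<tau>. pencil_det d Q \<tau> (e n)) (\<lambda>\<tau>. pencil_det d Q \<tau> l) sequentially" by simp
    qed
  qed
qed

text \<open>Along a segment \<open>\<theta> \<tau>\<close>, take the first \<open>\<theta>\<close> at which a zero appears in the disc. It lies in the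
  interior, so Hurwitz's theorem makes the determinant vanish on the whole disc, boundary included.\<close>

lemma zero_free_disc:
  assumes d: "stable d" and bd: "\<And>e. e \<in> sphere (1/2) (1/2) \<Longrightarrow> zero_free d Q s e" and s: "s \<ge> 0"
    and e: "e \<in> spec_disc"
  shows "zero_free d Q s e"
  unfolding zero_free_def
proof (intro allI impI notI)
  fix \<tau> assume \<tau>: "s * cmod \<tau> < 1" and zero: "pencil_det d Q \<tau> e = 0"
  define G where "G = (\<lambda>(\<theta> :: real, e). pencil_det d Q (of_real \<theta> * \<tau>) e)"
  have "continuous_on UNIV (\<lambda>x. (\<lambda>(\<tau>, e). pencil_det d Q \<tau> e) (of_real (fst x) * \<tau>, snd x))"
    by (intro continuous_on_compose2[OF pencil_det_cont] continuous_intros) auto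
  then have Gc: "continuous_on UNIV G" by (simp add: G_def case_prod_beta')
  define B where "B = ({0..1} \<times> spec_disc) \<inter> G -` {0}"
  have "compact ({0..1::real} \<times> spec_disc)" by (intro compact_Times) (auto simp: spec_disc_def)
  moreover have "closed (G -` {0})" using Gc by (intro closed_vimage) auto
  ultimately have Bc: "compact B" unfolding B_def by (rule compact_Int_closed)
  moreover have "(1, e) \<in> B" using e zero by (simp add: B_def G_def)
  ultimately have "compact (fst ` B)" "fst ` B \<noteq> {}"
    by (auto intro!: compact_continuous_image continuous_intros)
  then obtain \<theta> where \<theta>: "\<theta> \<in> fst ` B" "\<And>x. x \<in> fst ` B \<Longrightarrow> \<theta> \<le> x"
    using compact_attains_inf[of "fst ` B"] by metis
  from \<theta>(1) obtain e0 where e0: "(\<theta>, e0) \<in> B" by auto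
  have \<theta>01: "0 \<le> \<theta>" "\<theta> \<le> 1" and e0d: "e0 \<in> spec_disc" and G0: "pencil_det d Q (of_real \<theta> * \<tau>) e0 = 0"
    using e0 by (auto simp: B_def G_def)
  \<comment> \<open>At \<theta> = 0 the determinant is a power of d, which is nonzero on the disc.
    Positivity leaves room to approach \<theta> from below.\<close>
  have "\<theta> \<noteq> 0" using G0 d e0d by (auto simp: pencil_det_0 stable_def)
  with \<theta>01 have \<theta>p: "\<theta> > 0" by simp
  have small: "s * cmod (of_real \<theta> * \<tau>) < 1"
  proof -
    have "s * cmod (of_real \<theta> * \<tau>) = \<theta> * (s * cmod \<tau>)" using \<theta>01 by (simp add: norm_mult)
    also have "\<dots> \<le> 1 * (s * cmod \<tau>)" using \<theta>01 s by (intro mult_right_mono) auto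
    finally show ?thesis using \<tau> by simp
  qed
  have nb: "pencil_det d Q (of_real \<theta> * \<tau>) x \<noteq> 0" if "x \<in> sphere (1/2) (1/2)" for x
    using bd[OF that] small by (simp add: zero_free_def)
  have e0b: "e0 \<in> ball (1/2) (1/2)"
    using e0d nb[of e0] G0 by (force simp: spec_disc_def)
  have "pencil_det d Q (of_real \<theta> * \<tau>) constant_on ball (1/2) (1/2)"
  proof (rule ccontr)
    assume nc: "\<not> pencil_det d Q (of_real \<theta> * \<tau>) constant_on ball (1/2) (1/2)"
    \<comment> \<open>The parameters \<theta> (1 - 1/(n + 1)) lie in [0, \<theta>), where minimality
      of \<theta> excludes zeros in the whole disc, and they converge to \<theta>.\<close>
    define a where "a = (\<lambda>n. complex_of_real (\<theta> * (1 - inverse (real (Suc n)))) * \<tau>)"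
    have al: "a \<longlonglongrightarrow> of_real \<theta> * \<tau>"
      unfolding a_def using tendsto_mult[OF tendsto_of_real[OF tendsto_mult[OF tendsto_const[of \<theta>] tendsto_diff[OF tendsto_const[of 1] LIMSEQ_inverse_real_of_nat]]] tendsto_const[of \<tau>]]
      by simp
    have "pencil_det d Q (of_real \<theta> * \<tau>) e0 \<noteq> 0"
    proof (rule Hurwitz_no_zeros[where S="ball (1/2) (1/2)" and \<F>="\<lambda>n. pencil_det d Q (a n)", OF _ _ _ _ _ nc _ e0b])
      show "pencil_det d Q (a n) holomorphic_on ball (1/2) (1/2)" for n by (rule pencil_det_holomorphic)
      show "pencil_det d Q (of_real \<theta> * \<tau>) holomorphic_on ball (1/2) (1/2)" by (rule pencil_det_holomorphic)
      fix K :: "complex set" assume K: "compact K"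
      from uniform_limit_parameter[OF pencil_det_cont al K]
      show "uniform_limit K (\<lambda>n. pencil_det d Q (a n)) (pencil_det d Q (of_real \<theta> * \<tau>)) sequentially" by simp
    next
      fix n z assume z: "z \<in> ball (1/2 :: complex) (1/2)"
      define x where "x = \<theta> * (1 - inverse (real (Suc n)))"
      have inv: "0 < inverse (real (Suc n))" "inverse (real (Suc n)) \<le> 1" by (auto simp: field_simps)
      have "x < \<theta> * 1" unfolding x_def by (intro mult_strict_left_mono \<theta>p) (use inv in linarith)
      moreover have "0 \<le> x" unfolding x_def using \<theta>01 inv by simp
      ultimately have x: "0 \<le> x" "x < \<theta>" by simp_all
      have "x \<notin> fst ` B" using \<theta>(2)[of x] x by auto
      then have "(x, z) \<notin> B" by force
      then have "G (x, z) \<noteq> 0" using x \<theta>01 z by (auto simp: B_def spec_disc_def)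
      then show "pencil_det d Q (a n) z \<noteq> 0" by (simp add: G_def a_def x_def)
    qed auto
    then show False using G0 by simp
  qed
  then have const: "pencil_det d Q (of_real \<theta> * \<tau>) x = 0" if "x \<in> ball (1/2) (1/2)" for x
    using that e0b G0 unfolding constant_on_def by metis
  have "pencil_det d Q (of_real \<theta> * \<tau>) x = 0" if "x \<in> closure (ball (1/2) (1/2))" for x
  proof (rule continuous_constant_on_closure[OF _ _ that])
    show "continuous_on (closure (ball (1/2) (1/2))) (pencil_det d Q (of_real \<theta> * \<tau>))"
      using pencil_det_holomorphic(2) holomorphic_on_imp_continuous_on by blast
  qed (use const in auto)
  \<comment> \<open>The point 0 lies on the bounding circle, where zeros have been excluded.\<close>
  then have "pencil_det d Q (of_real \<theta> * \<tau>) 0 = 0" by (simp add: dist_norm)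
  then show False using nb[of 0] by (simp add: dist_norm)
qed

section \<open>From the determinant condition to eigenvalues and to the spectrum\<close>

text \<open>For \<tau> \<noteq> 0, d - \<tau> Q equals d \<tau> (1/\<tau> - F), so a zero \<tau> of
  the determinant corresponds to the eigenvalue 1/\<tau>, and s |\<tau>| < 1 to modulus greater than
  s.\<close>

lemma zero_free_iff:
  fixes F :: "complex^'n^'n"
  assumes de: "poly d e \<noteq> 0" and F: "mat (poly d e) ** F = peval e Q" and s: "s \<ge> 0"
  shows "zero_free d Q s e \<longleftrightarrow> (\<forall>\<mu>\<in>eigenvalues F. cmod \<mu> \<le> s)"
proof -
  have hd: "pencil_det d Q \<tau> e = (poly d e * \<tau>) ^ CARD('n) * det (mat (1 / \<tau>) - F)" if "\<tau> \<noteq> 0" for \<tau>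
  proof -
    have "mat (poly d e) - mat \<tau> ** peval e Q = mat (poly d e * \<tau>) ** mat (1 / \<tau>) - mat (poly d e * \<tau>) ** F"
      using that by (simp add: mat_mult_mat matrix_mul_assoc mult.commute flip: F)
    also have "\<dots> = mat (poly d e * \<tau>) ** (mat (1 / \<tau>) - F)"
      by (simp add: vec_eq_iff matrix_matrix_mult_def sum_subtractf algebra_simps)
    finally show ?thesis by (simp add: pencil_det_def det_mat_mult)
  qed
  have eig: "1 / \<tau> \<in> eigenvalues F \<longleftrightarrow> pencil_det d Q \<tau> e = 0" if "\<tau> \<noteq> 0" for \<tau>
    using hd[OF that] that de by (simp add: eigenvalues_iff_det)
  show ?thesis
  proof
    assume zf: "zero_free d Q s e"
    show "\<forall>\<mu>\<in>eigenvalues F. cmod \<mu> \<le> s"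
    proof (rule ballI, rule ccontr)
      fix \<mu> assume \<mu>: "\<mu> \<in> eigenvalues F" "\<not> cmod \<mu> \<le> s"
      then have "cmod \<mu> > 0" using s by linarith
      then have "\<mu> \<noteq> 0" "s * cmod (1 / \<mu>) < 1" using \<mu>(2) by (auto simp: norm_divide)
      then show False using zf eig[of "1 / \<mu>"] \<mu>(1) by (auto simp: zero_free_def)
    qed
  next
    assume ev: "\<forall>\<mu>\<in>eigenvalues F. cmod \<mu> \<le> s"
    show "zero_free d Q s e" unfolding zero_free_def
    proof (intro allI impI)
      fix \<tau> assume \<tau>: "s * cmod \<tau> < 1"
      show "pencil_det d Q \<tau> e \<noteq> 0"
      proof (cases "\<tau> = 0")
        case False
        then have "\<not> cmod (1 / \<tau>) \<le> s" using \<tau> by (auto simp: norm_divide field_simps)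
        then show ?thesis using ev eig[OF False] by auto
      qed (simp add: pencil_det_0 de)
    qed
  qed
qed

text \<open>\<mu> d - Q = \<mu> (d - Q/\<mu>), and |\<mu>| > s means that \<tau> = 1/\<mu> is
  admissible. Thus a bound on the symbol over the disc gives the stability needed to invert \<mu> I
  - T.\<close>

lemma stable_shift:
  fixes Q :: "complex poly^'n^'n"
  assumes zf: "\<And>e. e \<in> spec_disc \<Longrightarrow> zero_free d Q s e" and \<mu>: "cmod \<mu> > s" and s: "s \<ge> 0"
  shows "stable (det (mat (smult \<mu> d) - Q))"
  unfolding stable_def
proof
  fix e assume e: "e \<in> spec_disc"
  have "cmod \<mu> > 0" using \<mu> s by linarith
  then have \<mu>0: "\<mu> \<noteq> 0" "s * cmod (1 / \<mu>) < 1" using \<mu> by (auto simp: norm_divide)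
  have "peval e (mat (smult \<mu> d) - Q) = mat \<mu> ** (mat (poly d e) - mat (1 / \<mu>) ** peval e Q)"
  proof -
    have "mat \<mu> ** (mat (poly d e) - mat (1 / \<mu>) ** peval e Q) = mat \<mu> ** mat (poly d e) - (mat \<mu> ** mat (1 / \<mu>)) ** peval e Q"
      unfolding matrix_mul_assoc[symmetric]
      by (simp add: vec_eq_iff matrix_matrix_mult_def[of "mat \<mu>"] sum_subtractf algebra_simps)
    then show ?thesis using \<mu>0 by (simp add: peval_simps peval_mat mat_mult_mat)
  qed
  then have "poly (det (mat (smult \<mu> d) - Q)) e = \<mu> ^ CARD('n) * pencil_det d Q (1 / \<mu>) e"
    by (simp add: poly_det det_mat_mult pencil_det_def)
  then show "poly (det (mat (smult \<mu> d) - Q)) e \<noteq> 0"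
    using zf[OF e] \<mu>0 by (auto simp: zero_free_def)
qed

text \<open>Each inequality between suprema is proved by taking the larger side as a bound s and
  carrying \<open>zero_free\<close> with that s to the required points. If the larger side is
  infinite there is nothing to prove.\<close>

lemma fraction_spectral_radius:
  fixes T :: "(real \<Rightarrow> complex^'n) \<Rightarrow> (real \<Rightarrow> complex^'n)"
  assumes T: "realizes T F" and q: "q \<ge> 1"
  shows "Lq_bounded_operator q T"
    and "Lq_spectral_radius q T = (SUP z\<in>{z. Re z \<ge> 0}. matrix_spectral_radius (F z))"
    and "(SUP z\<in>{z. Re z \<ge> 0}. matrix_spectral_radius (F z))
           = (SUP \<xi>\<in>(UNIV :: real set). matrix_spectral_radius (F (\<i> * complex_of_real \<xi>)))"
proof -
  obtain d Q where fr: "fraction_op T d Q" and F: "\<And>z. Re z \<ge> 0 \<Longrightarrow> mat (poly d (disc_point z)) ** F z = peval (disc_point z) Q"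
    using T unfolding realizes_def by blast
  have d: "stable d" using fr by (simp add: fraction_op_def)
  then have de: "poly d e \<noteq> 0" if "e \<in> spec_disc" for e using that by (simp add: stable_def)
  have zf_iff: "zero_free d Q s (disc_point z) \<longleftrightarrow> (\<forall>\<mu>\<in>eigenvalues (F z). cmod \<mu> \<le> s)" if "Re z \<ge> 0" "s \<ge> 0" for z s
    by (rule zero_free_iff[OF de[OF disc_point_simps(3)[OF that(1)]] F[OF that(1)] that(2)])
  have 0: "0 \<in> spec_disc" by (simp add: spec_disc_def dist_norm)
  \<comment> \<open>Infinity is approached along the imaginary axis, so that this step serves bounds
    on the axis as well as bounds on the half-plane.\<close>
  have disc0: "zero_free d Q s 0" if s: "s \<ge> 0" and zf: "\<And>\<xi> :: real. zero_free d Q s (disc_point (\<i> * of_real \<xi>))" for s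
  proof (rule zero_free_limit[OF _ s zf de[OF 0]])
    have "(\<lambda>n. norm (disc_point (\<i> * of_real (real n)))) \<longlonglongrightarrow> 0"
    proof (rule tendsto_sandwich[OF _ _ tendsto_const lim_1_over_n[THEN tendsto_norm_zero]])
      show "eventually (\<lambda>n. norm (disc_point (\<i> * of_real (real n))) \<le> norm (1 / of_nat n :: real)) sequentially"
        using eventually_gt_at_top[of 0]
      proof eventually_elim
        case (elim n)
        have "real n = \<bar>Im (\<i> * of_real (real n) + 1)\<bar>" by simp
        also have "\<dots> \<le> cmod (\<i> * of_real (real n) + 1)" by (rule abs_Im_le_cmod)
        finally show ?case using elim by (simp add: disc_point_def norm_divide frac_le)
      qed
    qed simp
    then show "(\<lambda>n. disc_point (\<i> * of_real (real n))) \<longlonglongrightarrow> 0" by (rule tendsto_norm_zero_cancel)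
  qed
  have upper: "matrix_spectral_radius (F z) \<le> ennreal s \<longleftrightarrow> (\<forall>\<mu>\<in>eigenvalues (F z). cmod \<mu> \<le> s)" if "s \<ge> 0" for z s
    using that by (simp add: matrix_spectral_radius_def SUP_le_iff ennreal_le_iff)
  let ?A = "SUP z\<in>{z. Re z \<ge> 0}. matrix_spectral_radius (F z)"
  let ?B = "SUP \<xi>\<in>(UNIV :: real set). matrix_spectral_radius (F (\<i> * complex_of_real \<xi>))"
  let ?R = "Lq_spectral_radius q T"
  show "Lq_bounded_operator q T" by (rule fraction_op_bounded[OF fr q])
  have BA: "?B \<le> ?A" by (intro SUP_least SUP_upper) simp
  have AB: "?A \<le> ?B"
  proof (cases ?B)
    case (real s)
    have zi: "zero_free d Q s (disc_point (\<i> * of_real \<xi>))" for \<xi> :: real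
    proof -
      have "matrix_spectral_radius (F (\<i> * of_real \<xi>)) \<le> ennreal s"
        unfolding real(2)[symmetric] by (rule SUP_upper) simp
      then show ?thesis using real(1) by (simp add: zf_iff upper)
    qed
    have "zero_free d Q s e" if e: "e \<in> sphere (1/2) (1/2)" for e
    proof (cases "e = 0")
      case False
      have "e \<in> spec_disc" using e by (simp add: spec_disc_def)
      note z = disc_point_onto[OF this False]
      \<comment> \<open>Equality in |e|^2 \<le> Re e: the bounding circle without 0 is the image of
        the imaginary axis.\<close>
      have "Re (1 / e - 1) = 0"
      proof -
        have pos: "(Re e)\<^sup>2 + (Im e)\<^sup>2 > 0" using False by (simp add: complex_neq_0)
        have "(cmod (1/2 - e))\<^sup>2 = (1/2)\<^sup>2" using e by (simp add: dist_norm)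
        then have "(Re e)\<^sup>2 + (Im e)\<^sup>2 = Re e"
          unfolding cmod_power2 by (simp add: power2_eq_square algebra_simps)
        then show ?thesis using pos by (simp add: Re_divide field_simps)
      qed
      then have "1 / e - 1 = \<i> * of_real (Im (1 / e - 1))" by (simp add: complex_eq_iff)
      then show ?thesis using zi[of "Im (1 / e - 1)"] z(2) by metis
    qed (use disc0[OF real(1) zi] in simp)
    then have "zero_free d Q s e" if "e \<in> spec_disc" for e
      by (rule zero_free_disc[OF d _ real(1) that])
    then have "\<forall>\<mu>\<in>eigenvalues (F z). cmod \<mu> \<le> s" if "Re z \<ge> 0" for z
      using zf_iff[OF that real(1)] disc_point_simps(3)[OF that] by blast
    then show ?thesis unfolding real(2) using upper[OF real(1)] by (intro SUP_least) simp
  next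
    case top
    show ?thesis unfolding top by (rule top_greatest)
  qed
  show "?A = ?B" by (rule antisym[OF AB BA])
  have "?R \<le> ?A"
  proof (cases ?A)
    case (real s)
    have zr: "zero_free d Q s (disc_point z)" if "Re z \<ge> 0" for z
    proof -
      have "matrix_spectral_radius (F z) \<le> ennreal s"
        unfolding real(2)[symmetric] by (rule SUP_upper) (use that in simp)
      then show ?thesis using real(1) that by (simp add: zf_iff upper)
    qed
    have zf: "zero_free d Q s e" if e: "e \<in> spec_disc" for e
    proof (cases "e = 0")
      case False
      then show ?thesis using zr[OF disc_point_onto(1)[OF e False]] disc_point_onto(2)[OF e False] by simp
    qed (use disc0[OF real(1)] zr in simp)
    have "cmod \<mu> \<le> s" if \<mu>: "\<mu> \<in> Lq_spectrum q T" for \<mu>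
      using not_in_Lq_spectrum[OF fr q stable_shift[OF zf _ real(1)]] \<mu> by force
    then show ?thesis unfolding real(2) Lq_spectral_radius_def by (intro SUP_least ennreal_leI) auto
  next
    case top
    show ?thesis unfolding top by (rule top_greatest)
  qed
  moreover have "?A \<le> ?R"
  proof (cases ?R)
    case (real s)
    have ev: "cmod \<mu> \<le> s" if "Re z > 0" "\<mu> \<in> eigenvalues (F z)" for z \<mu>
    proof -
      have "ennreal (cmod \<mu>) \<le> ?R"
        unfolding Lq_spectral_radius_def by (rule SUP_upper[OF eigenvalue_in_Lq_spectrum[where z=z and F=F, OF T q that]])
      then show ?thesis unfolding real(2) using real(1) by (simp add: ennreal_le_iff)
    qed
    \<comment> \<open>Spectral points come from the Laplace functional for Re z > 0 only.
      Approaching z from the right by z + 1/(n + 1) includes the imaginary axis.\<close>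
    have "zero_free d Q s (disc_point z)" if z: "Re z \<ge> 0" for z
    proof (rule zero_free_limit[OF _ real(1) _ de[OF disc_point_simps(3)[OF z]]])
      define a where "a = (\<lambda>n. z + of_real (inverse (real (Suc n))))"
      have "a \<longlonglongrightarrow> z + of_real 0"
        unfolding a_def by (intro tendsto_intros LIMSEQ_inverse_real_of_nat)
      moreover have "z + 1 \<noteq> 0" using disc_point_simps(2)[OF z] by auto
      ultimately show "(\<lambda>n. disc_point (a n)) \<longlonglongrightarrow> disc_point z"
        unfolding disc_point_def by (intro tendsto_intros) auto
      have "Re (a n) > 0" for n using z by (simp add: a_def add_nonneg_pos)
      then show "zero_free d Q s (disc_point (a n))" for n
        using ev zf_iff[OF less_imp_le real(1), of "a n"] by blast
    qed
    then show ?thesis unfolding real(2) using real(1) by (intro SUP_least) (simp add: zf_iff upper)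
  next
    case top
    show ?thesis unfolding top by (rule top_greatest)
  qed
  ultimately show "?R = ?A" by (rule antisym)
qed

subsection \<open>The two-grid operator\<close>

lemma matrix_inv_unique:
  fixes A B :: "complex^'n^'n"
  assumes "A ** B = mat 1"
  shows "matrix_inv A = B"
proof -
  have "det A \<noteq> 0" using assms invertible_det_nz invertible_right_inverse by blast
  then have "matrix_inv A ** (A ** B) = B"
    by (simp add: matrix_mul_assoc matrix_inv_mult)
  then show ?thesis using assms by simp
qed

lemma matrix_inv_mult_distrib:
  fixes A B :: "complex^'n^'n"
  assumes "det A \<noteq> 0" "det B \<noteq> 0"
  shows "matrix_inv (A ** B) = matrix_inv B ** matrix_inv A"
proof (rule matrix_inv_unique)
  have "A ** B ** (matrix_inv B ** matrix_inv A) = A ** (B ** matrix_inv B) ** matrix_inv A"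
    by (simp only: matrix_mul_assoc)
  then show "A ** B ** (matrix_inv B ** matrix_inv A) = mat 1"
    using assms by (simp add: matrix_inv_mult)
qed

lemma pencil_factor:
  fixes A B :: "complex^'n^'n"
  assumes "det B \<noteq> 0"
  shows "B ** (mat z + matrix_inv B ** A) = mat z ** B + A"
  using assms by (simp add: matrix_add_ldistrib mat_mult_comm matrix_mul_assoc matrix_inv_mult)

lemma matrix_add_rdistrib: "((B :: complex^'n^'m) + C) ** A = B ** A + C ** A"
  by (simp add: vec_eq_iff matrix_matrix_mult_def sum.distrib algebra_simps)

lemma matrix_inv_cancel:
  fixes A :: "complex^'n^'n" and B :: "complex^'m^'n"
  assumes "det A \<noteq> 0"
  shows "matrix_inv A ** (A ** B) = B"
  by (simp only: matrix_mul_assoc matrix_inv_mult(2)[OF assms] matrix_mul_lid)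

text \<open>With \<open>R = mat z + matrix_inv M\<^sub>B ** M\<^sub>A\<close>, the product
  \<open>M\<^sub>B ** R\<close> is \<open>mat z ** M\<^sub>B + M\<^sub>A\<close>. Multiplying the
  constant part plus the transformed kernel by it makes the terms with
  \<open>M\<^sub>A ** matrix_inv M\<^sub>B ** N\<^sub>B\<close> cancel, and the numerator of the
  symbol remains.\<close>

lemma realizes_wr_operator:
  assumes MB: "det M\<^sub>B \<noteq> 0" and ev: "\<forall>\<mu>\<in>eigenvalues (matrix_inv M\<^sub>B ** M\<^sub>A). Re \<mu> > 0"
  shows "realizes (wr_operator M\<^sub>B N\<^sub>B M\<^sub>A N\<^sub>A) (wr_symbol M\<^sub>B N\<^sub>B M\<^sub>A N\<^sub>A)"
proof (rule realizes_cong)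
  let ?Y = "matrix_inv M\<^sub>B ** (N\<^sub>A - M\<^sub>A ** matrix_inv M\<^sub>B ** N\<^sub>B)"
  let ?M = "matrix_inv M\<^sub>B ** M\<^sub>A"
  have k: "wr_kernel M\<^sub>B N\<^sub>B M\<^sub>A N\<^sub>A = (\<lambda>t. mat 1 ** matrix_exp (- t *\<^sub>R ?M) ** ?Y)"
    by (simp add: wr_kernel_def[abs_def] matrix_mul_assoc)
  show "realizes (wr_operator M\<^sub>B N\<^sub>B M\<^sub>A N\<^sub>A) (\<lambda>z. matrix_inv M\<^sub>B ** N\<^sub>B + mat 1 ** matrix_inv (mat z + ?M) ** ?Y)"
    unfolding wr_operator_def[abs_def] k
    by (intro realizes_add realizes_const realizes_exp_kernel ev)
  fix z :: complex assume z: "Re z \<ge> 0"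
  let ?R = "mat z + ?M"
  have R: "det ?R \<noteq> 0" by (rule det_pos_shift[OF ev z])
  have BR: "mat z ** M\<^sub>B + M\<^sub>A = M\<^sub>B ** ?R" using pencil_factor[OF MB, of z M\<^sub>A] by simp
  have dBR: "det (M\<^sub>B ** ?R) \<noteq> 0" using MB R by (simp add: det_mul)
  have "M\<^sub>B ** ?R ** (matrix_inv M\<^sub>B ** N\<^sub>B + matrix_inv ?R ** ?Y) =
      (mat z ** M\<^sub>B + M\<^sub>A) ** matrix_inv M\<^sub>B ** N\<^sub>B + M\<^sub>B ** (?R ** matrix_inv ?R) ** ?Y"
    unfolding BR by (simp add: matrix_add_ldistrib matrix_mul_assoc)
  also have "\<dots> = mat z ** N\<^sub>B + N\<^sub>A"
  proof -
    have "(mat z ** M\<^sub>B + M\<^sub>A) ** matrix_inv M\<^sub>B ** N\<^sub>B = mat z ** (M\<^sub>B ** matrix_inv M\<^sub>B) ** N\<^sub>B + M\<^sub>A ** matrix_inv M\<^sub>B ** N\<^sub>B"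
      by (simp add: matrix_add_rdistrib matrix_mul_assoc)
    moreover have "M\<^sub>B ** ?Y = N\<^sub>A - M\<^sub>A ** matrix_inv M\<^sub>B ** N\<^sub>B"
      using MB by (simp add: matrix_mul_assoc matrix_inv_mult)
    ultimately show ?thesis using MB R by (simp add: matrix_inv_mult)
  qed
  finally have "matrix_inv (M\<^sub>B ** ?R) ** (M\<^sub>B ** ?R ** (matrix_inv M\<^sub>B ** N\<^sub>B + matrix_inv ?R ** ?Y)) = wr_symbol M\<^sub>B N\<^sub>B M\<^sub>A N\<^sub>A z"
    by (simp add: wr_symbol_def BR)
  then show "matrix_inv M\<^sub>B ** N\<^sub>B + mat 1 ** matrix_inv ?R ** ?Y = wr_symbol M\<^sub>B N\<^sub>B M\<^sub>A N\<^sub>A z"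
    unfolding matrix_inv_cancel[OF dBR] by simp
qed

lemma scaleR_matrix_mult: "(c *\<^sub>R (A :: complex^'n^'m)) ** B = c *\<^sub>R (A ** B)"
  by (simp add: scaleR_matrix_eq_mat matrix_mul_assoc)

text \<open>The real factor c covers both correction kernels, which differ only by 1 + 1/w^2; it is
  absorbed into the prolongation.\<close>

lemma realizes_correction:
  assumes BH: "det B\<^sub>H \<noteq> 0" and ev: "\<forall>\<mu>\<in>eigenvalues (matrix_inv B\<^sub>H ** A\<^sub>H). Re \<mu> > 0"
  shows "realizes (convolution (\<lambda>t. c *\<^sub>R correction_kernel p r B\<^sub>H A\<^sub>H B\<^sub>h A\<^sub>h t))
    (\<lambda>z. c *\<^sub>R correction_symbol p r B\<^sub>H A\<^sub>H B\<^sub>h A\<^sub>h z)"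
proof (rule realizes_cong)
  let ?G = "A\<^sub>H ** matrix_inv B\<^sub>H ** r ** B\<^sub>h - r ** A\<^sub>h"
  let ?M = "matrix_inv B\<^sub>H ** A\<^sub>H"
  have k: "(\<lambda>t. c *\<^sub>R correction_kernel p r B\<^sub>H A\<^sub>H B\<^sub>h A\<^sub>h t) = (\<lambda>t. (c *\<^sub>R p) ** matrix_exp (- t *\<^sub>R ?M) ** (matrix_inv B\<^sub>H ** ?G))"
    by (simp add: correction_kernel_def matrix_mul_assoc scaleR_matrix_mult)
  show "realizes (convolution (\<lambda>t. c *\<^sub>R correction_kernel p r B\<^sub>H A\<^sub>H B\<^sub>h A\<^sub>h t))
      (\<lambda>z. (c *\<^sub>R p) ** matrix_inv (mat z + ?M) ** (matrix_inv B\<^sub>H ** ?G))"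
    unfolding k by (rule realizes_exp_kernel[OF ev])
  fix z :: complex assume z: "Re z \<ge> 0"
  have R: "det (mat z + ?M) \<noteq> 0" by (rule det_pos_shift[OF ev z])
  have "A\<^sub>H + mat z ** B\<^sub>H = B\<^sub>H ** (mat z + ?M)" using pencil_factor[OF BH, of z A\<^sub>H] by (simp add: add.commute)
  then have "matrix_inv (A\<^sub>H + mat z ** B\<^sub>H) = matrix_inv (mat z + ?M) ** matrix_inv B\<^sub>H"
    using matrix_inv_mult_distrib[OF BH R] by simp
  then show "(c *\<^sub>R p) ** matrix_inv (mat z + ?M) ** (matrix_inv B\<^sub>H ** ?G) = c *\<^sub>R correction_symbol p r B\<^sub>H A\<^sub>H B\<^sub>h A\<^sub>h z"
    by (simp add: correction_symbol_def matrix_mul_assoc scaleR_matrix_mult)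
qed

lemma realizes_two_grid:
  assumes K: "realizes \<K> Ksym" and C: "\<And>c. realizes (convolution (\<lambda>t. c *\<^sub>R C t)) (\<lambda>z. c *\<^sub>R Lsym z)"
  shows "realizes (two_grid_wr \<K> P C w \<nu>\<^sub>1 \<nu>\<^sub>2 \<nu>\<^sub>3) (\<lambda>z. two_grid_symbol (Ksym z) P (Lsym z) w \<nu>\<^sub>1 \<nu>\<^sub>2 \<nu>\<^sub>3)"
proof -
  let ?c = "1 + 1 / w\<^sup>2"
  have C1: "realizes (convolution C) Lsym" using C[of 1] by simp
  have K2: "realizes (\<K> ^^ k) (\<lambda>z. matrix_power (Ksym z) k)" for k by (rule realizes_power[OF K])
  have inner: "realizes (inner_stage \<K> P w \<nu>\<^sub>2)
      (\<lambda>z. mat 1 + w *\<^sub>R (matrix_power (Ksym z) \<nu>\<^sub>2 ** (mat 1 - ?c *\<^sub>R P)))"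
    unfolding inner_stage_def[abs_def]
    by (intro realizes_add realizes_id realizes_scaleR realizes_comp[OF K2] realizes_const)
  have y: "realizes (\<lambda>u. (\<K> ^^ \<nu>\<^sub>2) (convolution (\<lambda>t. ?c *\<^sub>R C t) u)) (\<lambda>z. matrix_power (Ksym z) \<nu>\<^sub>2 ** (?c *\<^sub>R Lsym z))"
    by (rule realizes_comp[OF K2 C])
  have conv: "realizes (two_grid_correction_conv \<K> P C w \<nu>\<^sub>2)
     (\<lambda>z. Lsym z ** (mat 1 + w *\<^sub>R (matrix_power (Ksym z) \<nu>\<^sub>2 ** (mat 1 - ?c *\<^sub>R P)))
        + w *\<^sub>R ((mat 1 - P) ** (matrix_power (Ksym z) \<nu>\<^sub>2 ** (?c *\<^sub>R Lsym z)))
        + w *\<^sub>R (Lsym z ** (matrix_power (Ksym z) \<nu>\<^sub>2 ** (?c *\<^sub>R Lsym z))))"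
    unfolding two_grid_correction_conv_def[abs_def] Let_def
    by (intro realizes_add realizes_scaleR realizes_const_comp y realizes_comp[OF C1] inner)
  have "realizes (two_grid_correction \<K> P C w \<nu>\<^sub>2) (\<lambda>z. two_grid_correction_symbol (Ksym z) P (Lsym z) w \<nu>\<^sub>2)"
    using realizes_add[OF realizes_const_comp[OF inner, of "mat 1 - P"] conv]
    by (simp add: two_grid_correction_def[abs_def] two_grid_correction_symbol_def matrix_mul_assoc add.assoc)
  from realizes_comp[OF K2 realizes_comp[OF this K2]] show ?thesis
    by (simp add: two_grid_wr_def[abs_def] two_grid_symbol_def matrix_mul_assoc)
qed

subsection \<open>The mass matrix\<close>

text \<open>A Gram matrix: if B v = 0, then f, the combination of the basis functions with
  coefficients v, satisfies \<integral> f^2 = v \<bullet> B v = 0. If some v_k were nonzero, then f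
  would be nonzero at node k, hence by continuity on a nonempty open set, which is not
  negligible.\<close>

lemma mass_matrix_invertible:
  fixes node :: "'n::finite \<Rightarrow> real^2"
  assumes \<Omega>: "open \<Omega>" "bounded \<Omega>" and basis: "nodal_basis \<Omega> \<T> node \<phi>"
  shows "invertible (mass_matrix \<Omega> \<phi>)"
proof -
  let ?B = "mass_matrix \<Omega> \<phi>"
  have cont: "continuous_on (closure \<Omega>) (\<phi> j)" for j
    using basis by (auto simp: nodal_basis_def fe_space_def)
  have int: "set_integrable lebesgue \<Omega> g" if g: "continuous_on (closure \<Omega>) g" for g :: "real^2 \<Rightarrow> real"
  proof -
    have "integrable lborel (\<lambda>x. indicator (closure \<Omega>) x *\<^sub>R g x)"
      by (rule borel_integrable_compact[OF _ g]) (use \<Omega> in \<open>simp add: compact_closure\<close>)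
    then have "set_integrable lebesgue (closure \<Omega>) g"
      unfolding set_integrable_def by (subst integrable_completion) (auto dest: borel_measurable_integrable)
    then show ?thesis by (rule set_integrable_subset) (use \<Omega> closure_subset in auto)
  qed
  have "v = 0" if v: "?B *v v = 0" for v
  proof (rule ccontr)
    assume "v \<noteq> 0"
    then obtain k where k: "v $ k \<noteq> 0" by (auto simp: vec_eq_iff)
    define f where "f = (\<lambda>x. \<Sum>j\<in>UNIV. v $ j * \<phi> j x)"
    have fc: "continuous_on (closure \<Omega>) f" unfolding f_def by (intro continuous_intros cont)
    have fn: "f (node k) = v $ k" and nk: "node k \<in> \<Omega>"
      using basis unfolding nodal_basis_def f_def by (auto simp: mult_delta_right bij_betw_def)
    have "0 = (\<Sum>i\<in>UNIV. v $ i * (?B *v v) $ i)" by (simp add: v)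
    also have "\<dots> = (\<Sum>i\<in>UNIV. \<Sum>j\<in>UNIV. LINT x:\<Omega>|lebesgue. (v $ i * v $ j) * (\<phi> i x * \<phi> j x))"
      by (simp add: matrix_vector_mult_def mass_matrix_def sum_distrib_left mult.assoc mult.left_commute mult.commute)
    also have "\<dots> = (LINT x:\<Omega>|lebesgue. (\<Sum>i\<in>UNIV. \<Sum>j\<in>UNIV. (v $ i * v $ j) * (\<phi> i x * \<phi> j x)))"
    proof -
      have "set_integrable lebesgue \<Omega> (\<lambda>x. (v $ i * v $ j) * (\<phi> i x * \<phi> j x))" for i j
        by (intro int continuous_intros cont)
      then show ?thesis
        unfolding set_lebesgue_integral_def set_integrable_def
        by (simp only: scaleR_sum_right Bochner_Integration.integral_sum Bochner_Integration.integrable_sum)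
    qed
    also have "(\<lambda>x. \<Sum>i\<in>UNIV. \<Sum>j\<in>UNIV. (v $ i * v $ j) * (\<phi> i x * \<phi> j x)) = (\<lambda>x. f x * f x)"
      by (simp add: f_def fun_eq_iff sum_product mult.assoc mult.left_commute)
    finally have zero: "(LINT x|lebesgue. indicator \<Omega> x *\<^sub>R (f x * f x)) = 0"
      by (simp add: set_lebesgue_integral_def)
    have "set_integrable lebesgue \<Omega> (\<lambda>x. f x * f x)" by (intro int continuous_intros fc)
    then have "AE x in lebesgue. indicator \<Omega> x *\<^sub>R (f x * f x) = 0"
      using zero unfolding set_integrable_def
      by (subst (asm) integral_nonneg_eq_0_iff_AE) (auto simp: indicator_def)
    moreover define U where "U = \<Omega> \<inter> f -` (- {0})"
    ultimately have "AE x in lebesgue. x \<notin> U" by (auto elim!: eventually_mono simp: indicator_def)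
    moreover have "open U" unfolding U_def
      by (rule continuous_open_preimage[OF continuous_on_subset[OF fc closure_subset] \<Omega>(1)]) auto
    ultimately have "negligible U"
      by (simp add: negligible_iff_null_sets AE_iff_null_sets)
    moreover have "U \<noteq> {}" using nk fn k by (auto simp: U_def)
    ultimately show False using \<open>open U\<close> open_not_negligible by blast
  qed
  then show ?thesis
    using invertible_left_inverse matrix_left_invertible_ker by blast
qed

section \<open>Complexification of real matrices and the conclusion\<close>

lemma cmat_mult: "cmat (A ** B) = cmat A ** cmat B"
  by (simp add: vec_eq_iff map_matrix_def matrix_matrix_mult_def)

lemma cmat_mat_1: "cmat (mat 1) = mat 1"
  by (simp add: vec_eq_iff map_matrix_def mat_def)

lemma cmat_inv:
  fixes A :: "real^'n^'n"
  assumes "invertible A"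
  shows "det (cmat A) \<noteq> 0" "matrix_inv (cmat A) = cmat (matrix_inv A)"
proof -
  have "A ** matrix_inv A = mat 1"
    using assms someI_ex[of "\<lambda>A'. A ** A' = mat 1 \<and> A' ** A = mat 1"] by (auto simp: matrix_inv_def invertible_def)
  then have *: "cmat A ** cmat (matrix_inv A) = mat 1"
    by (metis cmat_mult cmat_mat_1)
  then show "det (cmat A) \<noteq> 0" using invertible_det_nz invertible_right_inverse by blast
  show "matrix_inv (cmat A) = cmat (matrix_inv A)" by (rule matrix_inv_unique[OF *])
qed

theorem lemma2p7:
  fixes \<Omega> :: "(real^2) set"
    and \<T>h \<T>H :: "(real^2) set set"
    and node_h :: "'n::finite \<Rightarrow> real^2" and \<phi>h :: "'n \<Rightarrow> real^2 \<Rightarrow> real"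
    and node_H :: "'m::finite \<Rightarrow> real^2" and \<phi>H :: "'m \<Rightarrow> real^2 \<Rightarrow> real"
    and B\<^sub>h A\<^sub>h M\<^sub>B N\<^sub>B M\<^sub>A N\<^sub>A :: "real^'n^'n"
    and B\<^sub>H A\<^sub>H :: "real^'m^'m"
    and p :: "real^'m^'n" and r :: "real^'n^'m"
    and c w q :: real
    and \<nu>\<^sub>1 \<nu>\<^sub>2 \<nu>\<^sub>3 :: nat
    and \<K> \<N> :: "(real \<Rightarrow> complex^'n) \<Rightarrow> (real \<Rightarrow> complex^'n)"
    and P :: "complex^'n^'n"
    and C :: "real \<Rightarrow> complex^'n^'n"
    and Ksym Lsym Nsym :: "complex \<Rightarrow> complex^'n^'n"
  assumes domain: "open \<Omega>" "connected \<Omega>" "bounded \<Omega>" "\<Omega> \<noteq> {}"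
    and meshes: "admissible_mesh \<Omega> \<T>h" "admissible_mesh \<Omega> \<T>H"
    and coarsening: "mesh_refines \<T>h \<T>H" "mesh_size \<T>H = 2 * mesh_size \<T>h"
    and bases: "nodal_basis \<Omega> \<T>h node_h \<phi>h" "nodal_basis \<Omega> \<T>H node_H \<phi>H"
    and fine: "B\<^sub>h = mass_matrix \<Omega> \<phi>h" "A\<^sub>h = stiffness_matrix \<Omega> \<phi>h"
    and coarse: "B\<^sub>H = mass_matrix \<Omega> \<phi>H" "A\<^sub>H = stiffness_matrix \<Omega> \<phi>H"
    and transfer: "p = prolongation node_h \<phi>H" "c > 0" "r = c *\<^sub>R transpose p"
    and splittings: "B\<^sub>h = M\<^sub>B - N\<^sub>B" "A\<^sub>h = M\<^sub>A - N\<^sub>A" "invertible M\<^sub>B"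
    and params: "w \<noteq> 0" "1 \<le> q"
    and eig_coarse: "\<forall>\<mu>\<in>eigenvalues (cmat (matrix_inv B\<^sub>H ** A\<^sub>H)). Re \<mu> > 0"
    and eig_split: "\<forall>\<mu>\<in>eigenvalues (cmat (matrix_inv M\<^sub>B ** M\<^sub>A)). Re \<mu> > 0"
    and \<K>: "\<K> = wr_operator (cmat M\<^sub>B) (cmat N\<^sub>B) (cmat M\<^sub>A) (cmat N\<^sub>A)"
    and P: "P = coarse_projection (cmat p) (cmat r) (cmat B\<^sub>H) (cmat B\<^sub>h)"
    and C: "C = correction_kernel (cmat p) (cmat r) (cmat B\<^sub>H) (cmat A\<^sub>H) (cmat B\<^sub>h) (cmat A\<^sub>h)"
    and \<N>: "\<N> = two_grid_wr \<K> P C w \<nu>\<^sub>1 \<nu>\<^sub>2 \<nu>\<^sub>3"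
    and Ksym: "Ksym = wr_symbol (cmat M\<^sub>B) (cmat N\<^sub>B) (cmat M\<^sub>A) (cmat N\<^sub>A)"
    and Lsym: "Lsym = correction_symbol (cmat p) (cmat r) (cmat B\<^sub>H) (cmat A\<^sub>H) (cmat B\<^sub>h) (cmat A\<^sub>h)"
    and Nsym: "Nsym = (\<lambda>z. two_grid_symbol (Ksym z) P (Lsym z) w \<nu>\<^sub>1 \<nu>\<^sub>2 \<nu>\<^sub>3)"
  shows "Lq_bounded_operator q \<N> \<and>
    Lq_spectral_radius q \<N> = (SUP z\<in>{z. Re z \<ge> 0}. matrix_spectral_radius (Nsym z)) \<and>
    (SUP z\<in>{z. Re z \<ge> 0}. matrix_spectral_radius (Nsym z))
           = (SUP \<xi>\<in>(UNIV :: real set). matrix_spectral_radius (Nsym (\<i> * complex_of_real \<xi>)))"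
proof -
  \<comment> \<open>This makes \<open>matrix_inv\<close> a genuine inverse of the coarse mass
    matrix, so that it commutes with complexification and the eigenvalue hypothesis carries
    over.\<close>
  have BH: "invertible B\<^sub>H"
    unfolding coarse by (rule mass_matrix_invertible[OF domain(1,3) bases(2)])
  have ev_H: "\<forall>\<mu>\<in>eigenvalues (matrix_inv (cmat B\<^sub>H) ** cmat A\<^sub>H). Re \<mu> > 0"
    using eig_coarse by (simp add: cmat_mult cmat_inv(2)[OF BH])
  have ev_M: "\<forall>\<mu>\<in>eigenvalues (matrix_inv (cmat M\<^sub>B) ** cmat M\<^sub>A). Re \<mu> > 0"
    using eig_split by (simp add: cmat_mult cmat_inv(2)[OF splittings(3)])
  have "realizes \<K> Ksym"
    unfolding \<K> Ksym by (rule realizes_wr_operator[OF cmat_inv(1)[OF splittings(3)] ev_M])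
  moreover have "realizes (convolution (\<lambda>t. a *\<^sub>R C t)) (\<lambda>z. a *\<^sub>R Lsym z)" for a
    unfolding C Lsym by (rule realizes_correction[OF cmat_inv(1)[OF BH] ev_H])
  ultimately have "realizes \<N> Nsym"
    unfolding \<N> Nsym by (rule realizes_two_grid)
  from fraction_spectral_radius[OF this params(2)] show ?thesis by blast
qed

end
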